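(* Let $\Bbbk$ be a field and let $\mathcal{E}$ be the class of cleft extensions in the category $\mathsf{Hopf}_{\Bbbk,\mathrm{coc}}$ of cocommutative Hopf algebras over $\Bbbk$. Then: 1) $\mathcal{E}$ contains the isomorphisms in $\mathsf{Hopf}_{\Bbbk,\mathrm{coc}}$; 2) $\mathcal{E}$ is pullback stable (the pullback in $\mathsf{Hopf}_{\Bbbk,\mathrm{coc}}$ of a morphism in $\mathcal{E}$ along any morphism of $\mathsf{Hopf}_{\Bbbk,\mathrm{coc}}$ is in $\mathcal{E}$); 3) $\mathcal{E}$ is closed under composition; 4) if $f\colon A\to B$ and $g\colon B\to C$ are morphisms in $\mathsf{Hopf}_{\Bbbk,\mathrm{coc}}$ with $gf$ in $\mathcal{E}$, then $g$ is also in $\mathcal{E}$.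
   Context: A morphism $p\colon M\to N$ in $\mathsf{Hopf}_{\Bbbk,\mathrm{coc}}$ is called a cleft extension (i.e. belongs to $\mathcal{E}$) if it is surjective and has a section $N\to M$ that is a morphism of coalgebras. The pullback of $f\colon A\to C$ and $g\colon B\to C$ in $\mathsf{Hopf}_{\Bbbk,\mathrm{coc}}$ is the Hopf subalgebra of $A\otimes B$ of those elements $a\otimes b$ (sums understood) with $a_1\otimes f(a_2)\otimes b=a\otimes g(b_1)\otimes b_2$, with projections $\mathrm{Id}\otimes\varepsilon$ and $\varepsilon\otimes\mathrm{Id}$. *)

theory Defs
  imports "HOL-Algebra.Module" "HOL-Algebra.AbelCoset" "HOL.Hull"
begin

section \<open>Tensor products of modules\<close>

text \<open>
  The free module on a set \<open>S\<close> consists of the finitely supported formal linear combinations of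
  elements of \<open>S\<close>.  It is used as a module only: its \<open>mult\<close> and \<open>one\<close> fields carry no meaning.
\<close>

definition free_module :: "('k, 'm) ring_scheme \<Rightarrow> 's set \<Rightarrow> ('k, 's \<Rightarrow> 'k) module" where
  "free_module K S =
    \<lparr>carrier = {\<phi>. range \<phi> \<subseteq> carrier K \<and> finite {s. \<phi> s \<noteq> \<zero>\<^bsub>K\<^esub>} \<and> {s. \<phi> s \<noteq> \<zero>\<^bsub>K\<^esub>} \<subseteq> S},
     mult = undefined, one = undefined,
     zero = (\<lambda>s. \<zero>\<^bsub>K\<^esub>), add = (\<lambda>\<phi> \<psi> s. \<phi> s \<oplus>\<^bsub>K\<^esub> \<psi> s),
     smult = (\<lambda>c \<phi> s. c \<otimes>\<^bsub>K\<^esub> \<phi> s)\<rparr>"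

definition single :: "('k, 'm) ring_scheme \<Rightarrow> 's \<Rightarrow> 's \<Rightarrow> 'k" where
  "single K s = (\<lambda>t. if t = s then \<one>\<^bsub>K\<^esub> else \<zero>\<^bsub>K\<^esub>)"

definition bilinear_relations ::
    "('k, 'm) ring_scheme \<Rightarrow> ('k, 'a, 'n) module_scheme \<Rightarrow> ('k, 'b, 'p) module_scheme
      \<Rightarrow> ('a \<times> 'b \<Rightarrow> 'k) set" where
  "bilinear_relations K A B =
    (let F = free_module K (carrier A \<times> carrier B) in
      {single K (a \<oplus>\<^bsub>A\<^esub> a', b) \<ominus>\<^bsub>F\<^esub> (single K (a, b) \<oplus>\<^bsub>F\<^esub> single K (a', b)) |a a' b.
         a \<in> carrier A \<and> a' \<in> carrier A \<and> b \<in> carrier B} \<union>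
      {single K (a, b \<oplus>\<^bsub>B\<^esub> b') \<ominus>\<^bsub>F\<^esub> (single K (a, b) \<oplus>\<^bsub>F\<^esub> single K (a, b')) |a b b'.
         a \<in> carrier A \<and> b \<in> carrier B \<and> b' \<in> carrier B} \<union>
      {single K (c \<odot>\<^bsub>A\<^esub> a, b) \<ominus>\<^bsub>F\<^esub> (c \<odot>\<^bsub>F\<^esub> single K (a, b)) |c a b.
         c \<in> carrier K \<and> a \<in> carrier A \<and> b \<in> carrier B} \<union>
      {single K (a, c \<odot>\<^bsub>B\<^esub> b) \<ominus>\<^bsub>F\<^esub> (c \<odot>\<^bsub>F\<^esub> single K (a, b)) |c a b.
         c \<in> carrier K \<and> a \<in> carrier A \<and> b \<in> carrier B})"

definition tensor_null ::
    "('k, 'm) ring_scheme \<Rightarrow> ('k, 'a, 'n) module_scheme \<Rightarrow> ('k, 'b, 'p) module_scheme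
      \<Rightarrow> ('a \<times> 'b \<Rightarrow> 'k) set" where
  "tensor_null K A B =
    (\<lambda>N. submodule N K (free_module K (carrier A \<times> carrier B))) hull bilinear_relations K A B"

text \<open>
  The tensor product is the quotient of the free module on pairs by the submodule spanned by the
  bilinear relations; its elements are cosets.
\<close>

definition tensor_module ::
    "('k, 'm) ring_scheme \<Rightarrow> ('k, 'a, 'n) module_scheme \<Rightarrow> ('k, 'b, 'p) module_scheme
      \<Rightarrow> ('k, ('a \<times> 'b \<Rightarrow> 'k) set) module" where
  "tensor_module K A B =
    (let F = free_module K (carrier A \<times> carrier B); N = tensor_null K A B in
      \<lparr>carrier = a_rcosets\<^bsub>F\<^esub> N,
       mult = undefined, one = undefined,
       zero = N, add = (\<lambda>X Y. X <+>\<^bsub>F\<^esub> Y),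
       smult = (\<lambda>c X. \<Union>\<phi>\<in>X. N +>\<^bsub>F\<^esub> (c \<odot>\<^bsub>F\<^esub> \<phi>))\<rparr>)"

definition pure_tensor ::
    "('k, 'm) ring_scheme \<Rightarrow> ('k, 'a, 'n) module_scheme \<Rightarrow> ('k, 'b, 'p) module_scheme
      \<Rightarrow> 'a \<Rightarrow> 'b \<Rightarrow> ('a \<times> 'b \<Rightarrow> 'k) set" where
  "pure_tensor K A B a b =
    tensor_null K A B +>\<^bsub>free_module K (carrier A \<times> carrier B)\<^esub> single K (a, b)"

text \<open>
  \<open>tensor_lift K C h\<close> is the linear map into \<open>C\<close> that the universal property assigns to a bilinear
  map \<open>h\<close>: it sends the class of \<open>\<Sum> c\<^sub>i (a\<^sub>i, b\<^sub>i)\<close> to \<open>\<Sum> c\<^sub>i h a\<^sub>i b\<^sub>i\<close>, which for bilinear \<open>h\<close> is the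
  same for all representatives.
\<close>

definition tensor_lift ::
    "('k, 'm) ring_scheme \<Rightarrow> ('k, 'c, 'q) module_scheme \<Rightarrow> ('a \<Rightarrow> 'b \<Rightarrow> 'c)
      \<Rightarrow> ('a \<times> 'b \<Rightarrow> 'k) set \<Rightarrow> 'c" where
  "tensor_lift K C h X =
    the_elem ((\<lambda>\<phi>. \<Oplus>\<^bsub>C\<^esub>p\<in>{p. \<phi> p \<noteq> \<zero>\<^bsub>K\<^esub>}. \<phi> p \<odot>\<^bsub>C\<^esub> h (fst p) (snd p)) ` X)"

text \<open>
  For \<open>f\<close> and \<open>g\<close> with targets \<open>C\<close> and \<open>D\<close>, \<open>tensor_map K C D f g\<close> is the map \<open>f \<otimes> g\<close>.
\<close>

definition tensor_map ::
    "('k, 'm) ring_scheme \<Rightarrow> ('k, 'c, 'n) module_scheme \<Rightarrow> ('k, 'd, 'p) module_scheme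
      \<Rightarrow> ('a \<Rightarrow> 'c) \<Rightarrow> ('b \<Rightarrow> 'd) \<Rightarrow> ('a \<times> 'b \<Rightarrow> 'k) set \<Rightarrow> ('c \<times> 'd \<Rightarrow> 'k) set" where
  "tensor_map K C D f g =
    tensor_lift K (tensor_module K C D) (\<lambda>a b. pure_tensor K C D (f a) (g b))"

text \<open>The canonical map \<open>(A \<otimes> B) \<otimes> C \<rightarrow> A \<otimes> (B \<otimes> C)\<close>.\<close>

definition tensor_assoc ::
    "('k, 'm) ring_scheme \<Rightarrow> ('k, 'a, 'n) module_scheme \<Rightarrow> ('k, 'b, 'p) module_scheme
      \<Rightarrow> ('k, 'c, 'q) module_scheme
      \<Rightarrow> (('a \<times> 'b \<Rightarrow> 'k) set \<times> 'c \<Rightarrow> 'k) set \<Rightarrow> ('a \<times> ('b \<times> 'c \<Rightarrow> 'k) set \<Rightarrow> 'k) set" where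
  "tensor_assoc K A B C =
    (let T = tensor_module K A (tensor_module K B C) in
      tensor_lift K T (\<lambda>t c. tensor_lift K T
        (\<lambda>a b. pure_tensor K A (tensor_module K B C) a (pure_tensor K B C b c)) t))"

definition tensor_swap ::
    "('k, 'm) ring_scheme \<Rightarrow> ('k, 'a, 'n) module_scheme \<Rightarrow> ('k, 'b, 'p) module_scheme
      \<Rightarrow> ('a \<times> 'b \<Rightarrow> 'k) set \<Rightarrow> ('b \<times> 'a \<Rightarrow> 'k) set" where
  "tensor_swap K A B =
    tensor_lift K (tensor_module K B A) (\<lambda>a b. pure_tensor K B A b a)"

definition tensor_algebra ::
    "('k, 'm) ring_scheme \<Rightarrow> ('k, 'a, 'n) module_scheme \<Rightarrow> ('k, 'b, 'p) module_scheme
      \<Rightarrow> ('k, ('a \<times> 'b \<Rightarrow> 'k) set) module" where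
  "tensor_algebra K A B =
    (let T = tensor_module K A B in
      T\<lparr>mult := (\<lambda>X Y. tensor_lift K T (\<lambda>a b. tensor_lift K T
            (\<lambda>a' b'. pure_tensor K A B (a \<otimes>\<^bsub>A\<^esub> a') (b \<otimes>\<^bsub>B\<^esub> b')) Y) X),
        one := pure_tensor K A B \<one>\<^bsub>A\<^esub> \<one>\<^bsub>B\<^esub>\<rparr>)"

definition ground_module :: "('k, 'm) ring_scheme \<Rightarrow> ('k, 'k) module" where
  "ground_module K =
    \<lparr>carrier = carrier K, mult = mult K, one = \<one>\<^bsub>K\<^esub>, zero = \<zero>\<^bsub>K\<^esub>, add = add K, smult = mult K\<rparr>"

definition linear_map ::
    "('k, 'm) ring_scheme \<Rightarrow> ('k, 'a, 'n) module_scheme \<Rightarrow> ('k, 'b, 'p) module_scheme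
      \<Rightarrow> ('a \<Rightarrow> 'b) \<Rightarrow> bool" where
  "linear_map K A B f \<longleftrightarrow>
    f \<in> carrier A \<rightarrow> carrier B \<and>
    (\<forall>x\<in>carrier A. \<forall>y\<in>carrier A. f (x \<oplus>\<^bsub>A\<^esub> y) = f x \<oplus>\<^bsub>B\<^esub> f y) \<and>
    (\<forall>c\<in>carrier K. \<forall>x\<in>carrier A. f (c \<odot>\<^bsub>A\<^esub> x) = c \<odot>\<^bsub>B\<^esub> f x)"

section \<open>Cocommutative Hopf algebras over a field\<close>

record ('k, 'a) hopf = "('k, 'a) module" +
  comult :: "'a \<Rightarrow> ('a \<times> 'a \<Rightarrow> 'k) set"
  counit :: "'a \<Rightarrow> 'k"
  antipode :: "'a \<Rightarrow> 'a"

text \<open>The library locale \<open>algebra\<close> is about commutative algebras only.\<close>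

locale assoc_algebra = module K A + ring A for K (structure) and A (structure) +
  assumes smult_mult_left:
      "\<lbrakk>c \<in> carrier K; x \<in> carrier A; y \<in> carrier A\<rbrakk> \<Longrightarrow>
        (c \<odot>\<^bsub>A\<^esub> x) \<otimes>\<^bsub>A\<^esub> y = c \<odot>\<^bsub>A\<^esub> (x \<otimes>\<^bsub>A\<^esub> y)"
    and smult_mult_right:
      "\<lbrakk>c \<in> carrier K; x \<in> carrier A; y \<in> carrier A\<rbrakk> \<Longrightarrow>
        x \<otimes>\<^bsub>A\<^esub> (c \<odot>\<^bsub>A\<^esub> y) = c \<odot>\<^bsub>A\<^esub> (x \<otimes>\<^bsub>A\<^esub> y)"

locale coalgebra = module K A for K (structure) and A :: "('k, 'a, 'n) hopf_scheme" (structure) +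
  assumes comult_linear: "linear_map K A (tensor_module K A A) (comult A)"
    and counit_linear: "linear_map K A (ground_module K) (counit A)"
    and coassoc:
      "x \<in> carrier A \<Longrightarrow>
        tensor_assoc K A A A (tensor_map K (tensor_module K A A) A (comult A) id (comult A x)) =
        tensor_map K A (tensor_module K A A) id (comult A) (comult A x)"
    and counit_left: "x \<in> carrier A \<Longrightarrow> tensor_lift K A (\<lambda>a b. counit A a \<odot>\<^bsub>A\<^esub> b) (comult A x) = x"
    and counit_right: "x \<in> carrier A \<Longrightarrow> tensor_lift K A (\<lambda>a b. counit A b \<odot>\<^bsub>A\<^esub> a) (comult A x) = x"

locale bialgebra = assoc_algebra K A + coalgebra K A
  for K (structure) and A :: "('k, 'a, 'n) hopf_scheme" (structure) +
  assumes comult_mult: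
      "\<lbrakk>x \<in> carrier A; y \<in> carrier A\<rbrakk> \<Longrightarrow>
        comult A (x \<otimes>\<^bsub>A\<^esub> y) = comult A x \<otimes>\<^bsub>tensor_algebra K A A\<^esub> comult A y"
    and comult_one: "comult A \<one>\<^bsub>A\<^esub> = \<one>\<^bsub>tensor_algebra K A A\<^esub>"
    and counit_mult:
      "\<lbrakk>x \<in> carrier A; y \<in> carrier A\<rbrakk> \<Longrightarrow> counit A (x \<otimes>\<^bsub>A\<^esub> y) = counit A x \<otimes>\<^bsub>K\<^esub> counit A y"
    and counit_one: "counit A \<one>\<^bsub>A\<^esub> = \<one>\<^bsub>K\<^esub>"

locale cocomm_hopf_algebra = field K + bialgebra K A
  for K (structure) and A :: "('k, 'a, 'n) hopf_scheme" (structure) +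
  assumes antipode_linear: "linear_map K A A (antipode A)"
    and antipode_left:
      "x \<in> carrier A \<Longrightarrow>
        tensor_lift K A (\<lambda>a b. antipode A a \<otimes>\<^bsub>A\<^esub> b) (comult A x) = counit A x \<odot>\<^bsub>A\<^esub> \<one>\<^bsub>A\<^esub>"
    and antipode_right:
      "x \<in> carrier A \<Longrightarrow>
        tensor_lift K A (\<lambda>a b. a \<otimes>\<^bsub>A\<^esub> antipode A b) (comult A x) = counit A x \<odot>\<^bsub>A\<^esub> \<one>\<^bsub>A\<^esub>"
    and cocommutative: "x \<in> carrier A \<Longrightarrow> tensor_swap K A A (comult A x) = comult A x"

definition coalgebra_hom ::
    "('k, 'm) ring_scheme \<Rightarrow> ('k, 'a, 'n) hopf_scheme \<Rightarrow> ('k, 'b, 'p) hopf_scheme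
      \<Rightarrow> ('a \<Rightarrow> 'b) \<Rightarrow> bool" where
  "coalgebra_hom K A B f \<longleftrightarrow>
    linear_map K A B f \<and>
    (\<forall>x\<in>carrier A. comult B (f x) = tensor_map K B B f f (comult A x)) \<and>
    (\<forall>x\<in>carrier A. counit B (f x) = counit A x)"

text \<open>
  Morphisms of the category of cocommutative Hopf algebras over \<open>K\<close>; source and target are required
  to be objects.  Compatibility with the antipodes is automatic for bialgebra maps.
\<close>

definition hopf_coc_hom ::
    "('k, 'm) ring_scheme \<Rightarrow> ('k, 'a, 'n) hopf_scheme \<Rightarrow> ('k, 'b, 'p) hopf_scheme
      \<Rightarrow> ('a \<Rightarrow> 'b) \<Rightarrow> bool" where
  "hopf_coc_hom K A B f \<longleftrightarrow>
    cocomm_hopf_algebra K A \<and> cocomm_hopf_algebra K B \<and>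
    coalgebra_hom K A B f \<and> f \<in> ring_hom A B"

definition hopf_coc_iso ::
    "('k, 'm) ring_scheme \<Rightarrow> ('k, 'a, 'n) hopf_scheme \<Rightarrow> ('k, 'b, 'p) hopf_scheme
      \<Rightarrow> ('a \<Rightarrow> 'b) \<Rightarrow> bool" where
  "hopf_coc_iso K A B f \<longleftrightarrow>
    hopf_coc_hom K A B f \<and>
    (\<exists>g. hopf_coc_hom K B A g \<and> (\<forall>x\<in>carrier A. g (f x) = x) \<and> (\<forall>y\<in>carrier B. f (g y) = y))"

definition cleft_extension ::
    "('k, 'm) ring_scheme \<Rightarrow> ('k, 'a, 'n) hopf_scheme \<Rightarrow> ('k, 'b, 'p) hopf_scheme
      \<Rightarrow> ('a \<Rightarrow> 'b) \<Rightarrow> bool" where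
  "cleft_extension K M N p \<longleftrightarrow>
    hopf_coc_hom K M N p \<and> p ` carrier M = carrier N \<and>
    (\<exists>s. coalgebra_hom K N M s \<and> (\<forall>y\<in>carrier N. p (s y) = y))"

section \<open>Pullbacks\<close>

text \<open>
  The comultiplication sends \<open>a \<otimes> b\<close> to the sum of the \<open>(a\<^sub>1 \<otimes> b\<^sub>1) \<otimes> (a\<^sub>2 \<otimes> b\<^sub>2)\<close>.
\<close>

definition tensor_hopf ::
    "('k, 'm) ring_scheme \<Rightarrow> ('k, 'a, 'n) hopf_scheme \<Rightarrow> ('k, 'b, 'p) hopf_scheme
      \<Rightarrow> ('k, ('a \<times> 'b \<Rightarrow> 'k) set) hopf" where
  "tensor_hopf K A B =
    (let T = tensor_module K A B; TT = tensor_module K T T in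
      module.extend (tensor_algebra K A B)
       \<lparr>comult = tensor_lift K TT (\<lambda>a b.
            tensor_lift K TT (\<lambda>a\<^sub>1 a\<^sub>2.
              tensor_lift K TT (\<lambda>b\<^sub>1 b\<^sub>2.
                pure_tensor K T T (pure_tensor K A B a\<^sub>1 b\<^sub>1) (pure_tensor K A B a\<^sub>2 b\<^sub>2))
              (comult B b))
            (comult A a)),
        counit = tensor_lift K (ground_module K) (\<lambda>a b. counit A a \<otimes>\<^bsub>K\<^esub> counit B b),
        antipode = tensor_map K A B (antipode A) (antipode B)\<rparr>)"

text \<open>
  The Hopf algebra structure induced on a subset \<open>S\<close> of \<open>H\<close>.  The tensor square of \<open>S\<close> consists of
  other cosets than that of \<open>H\<close>, so the comultiplication of \<open>H\<close> has to be transported back along the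
  canonical map \<open>S \<otimes> S \<rightarrow> H \<otimes> H\<close>, which is injective if \<open>S\<close> is a subspace.
  The result is a Hopf algebra only if \<open>S\<close> is a Hopf subalgebra of \<open>H\<close>; in particular the
  comultiplication must map \<open>S\<close> into the image of \<open>S \<otimes> S\<close>.
\<close>

definition sub_hopf ::
    "('k, 'm) ring_scheme \<Rightarrow> ('k, 'a) hopf \<Rightarrow> 'a set \<Rightarrow> ('k, 'a) hopf" where
  "sub_hopf K H S =
    H\<lparr>carrier := S,
      comult := (\<lambda>x. THE t. t \<in> carrier (tensor_module K (H\<lparr>carrier := S\<rparr>) (H\<lparr>carrier := S\<rparr>)) \<and>
                            tensor_map K H H id id t = comult H x)\<rparr>"

text \<open>
  For \<open>f\<close> from \<open>A\<close> to \<open>C\<close> and \<open>g\<close> from \<open>B\<close> to \<open>C\<close>, the elements \<open>a \<otimes> b\<close> (sums understood) with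
  \<open>a\<^sub>1 \<otimes> f a\<^sub>2 \<otimes> b = a \<otimes> g b\<^sub>1 \<otimes> b\<^sub>2\<close>, an equation in \<open>A \<otimes> (C \<otimes> B)\<close>.
\<close>

definition pullback_carrier ::
    "('k, 'm) ring_scheme \<Rightarrow> ('k, 'a, 'n) hopf_scheme \<Rightarrow> ('k, 'b, 'p) hopf_scheme
      \<Rightarrow> ('k, 'c, 'q) hopf_scheme \<Rightarrow> ('a \<Rightarrow> 'c) \<Rightarrow> ('b \<Rightarrow> 'c) \<Rightarrow> ('a \<times> 'b \<Rightarrow> 'k) set set" where
  "pullback_carrier K A B C f g =
    (let CB = tensor_module K C B; T = tensor_module K A CB in
      {t \<in> carrier (tensor_module K A B).
        tensor_lift K T (\<lambda>a b. tensor_lift K T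
          (\<lambda>a\<^sub>1 a\<^sub>2. pure_tensor K A CB a\<^sub>1 (pure_tensor K C B (f a\<^sub>2) b)) (comult A a)) t =
        tensor_lift K T (\<lambda>a b. tensor_lift K T
          (\<lambda>b\<^sub>1 b\<^sub>2. pure_tensor K A CB a (pure_tensor K C B (g b\<^sub>1) b\<^sub>2)) (comult B b)) t})"

definition pullback ::
    "('k, 'm) ring_scheme \<Rightarrow> ('k, 'a, 'n) hopf_scheme \<Rightarrow> ('k, 'b, 'p) hopf_scheme
      \<Rightarrow> ('k, 'c, 'q) hopf_scheme \<Rightarrow> ('a \<Rightarrow> 'c) \<Rightarrow> ('b \<Rightarrow> 'c)
      \<Rightarrow> ('k, ('a \<times> 'b \<Rightarrow> 'k) set) hopf" where
  "pullback K A B C f g = sub_hopf K (tensor_hopf K A B) (pullback_carrier K A B C f g)"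

text \<open>The projection \<open>\<epsilon> \<otimes> Id\<close>.\<close>

definition pullback_snd ::
    "('k, 'm) ring_scheme \<Rightarrow> ('k, 'a, 'n) hopf_scheme \<Rightarrow> ('k, 'b, 'p) hopf_scheme
      \<Rightarrow> ('a \<times> 'b \<Rightarrow> 'k) set \<Rightarrow> 'b" where
  "pullback_snd K A B = tensor_lift K B (\<lambda>a b. counit A a \<odot>\<^bsub>B\<^esub> b)"

end

theory Submission
  imports Defs
begin

text \<open>
  A linear map out of a tensor product is determined by its values on pure tensors, so identities in
  Sweedler notation become rewriting: \<open>tlift K A A D F (comult A x)\<close> stands for the sum of the
  \<open>F x\<^sub>1 x\<^sub>2\<close>, and coassociativity, used from left to right, brings iterated sums into
  right-nested form.

  The pullback of \<open>f\<close> and \<open>g\<close> is the equalizer of two algebra maps \<open>u, v\<close> from \<open>H = A \<otimes> B\<close> to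
  \<open>A \<otimes> (C \<otimes> B)\<close>.  The map \<open>a \<otimes> c \<otimes> b \<mapsto> (a\<^sub>1 \<otimes> c \<otimes> b\<^sub>1) \<otimes> (a\<^sub>2 \<otimes> b\<^sub>2)\<close> sends \<open>u h\<close> to \<open>u h\<^sub>1 \<otimes> h\<^sub>2\<close>, by
  cocommutativity of \<open>A\<close>, and \<open>v h\<close> to \<open>v h\<^sub>1 \<otimes> h\<^sub>2\<close>; hence \<open>u h\<^sub>1 \<otimes> h\<^sub>2 = v h\<^sub>1 \<otimes> h\<^sub>2\<close> on the equalizer.
  Over a field \<open>u - v\<close> has a generalized inverse, which gives a linear retraction \<open>\<pi>\<close> of \<open>H\<close> onto the
  equalizer with \<open>\<pi> h\<^sub>1 \<otimes> \<pi> h\<^sub>2 = h\<^sub>1 \<otimes> h\<^sub>2\<close>, so the equalizer is a subcoalgebra.  It is stable under the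
  antipode \<open>S\<close> because \<open>u \<circ> S\<close> and \<open>v \<circ> S\<close>, restricted to it, are convolution inverses of the same map.
  If \<open>s\<close> is a coalgebra section of \<open>f\<close>, then \<open>b \<mapsto> s (g b\<^sub>1) \<otimes> b\<^sub>2\<close> is one of the projection to \<open>B\<close>.
\<close>

section \<open>Free modules and quotient modules\<close>

text \<open>The tensor square of a subspace consists of other cosets than the tensor square of the
  whole space, so being a subcoalgebra is not an inclusion of sets. The usual argument, that the
  comultiplication lands in the intersection of \<open>P \<otimes> H\<close> and
  \<open>H \<otimes> P\<close>, which is \<open>P \<otimes> P\<close>, is replaced by the
  retraction: \<open>\<pi> \<otimes> \<pi>\<close> is a left inverse of the canonical map from
  \<open>P \<otimes> P\<close> to \<open>H \<otimes> H\<close>, which makes that map injective, and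
  the equation satisfied by \<open>\<pi>\<close> exhibits a preimage of every comultiplication. With
  \<open>w = u - v\<close> and a linear \<open>k\<close> such that \<open>w k w = w\<close>, the
  retraction is the identity minus \<open>k w\<close>. The field enters through \<open>k\<close>,
  which is built from complements of the kernel and of the image of \<open>w\<close>. The other
  obstacle is bookkeeping: every rewriting step with a lifted map needs bilinearity. That predicate
  unfolds to linearity in each argument, and the linearity rules are mostly stated for composites
  with an inner linear map, so that the simplifier can descend to the variable.\<close>

lemma free_module_sel [simp]:
  "zero (free_module K S) = (\<lambda>s. \<zero>\<^bsub>K\<^esub>)"
  "add (free_module K S) = (\<lambda>\<phi> \<psi> s. \<phi> s \<oplus>\<^bsub>K\<^esub> \<psi> s)"
  "smult (free_module K S) = (\<lambda>c \<phi> s. c \<otimes>\<^bsub>K\<^esub> \<phi> s)"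
  by (simp_all add: free_module_def)

lemma free_module_carrier:
  "\<phi> \<in> carrier (free_module K S) \<longleftrightarrow>
    (\<forall>s. \<phi> s \<in> carrier K) \<and> finite {s. \<phi> s \<noteq> \<zero>\<^bsub>K\<^esub>} \<and> {s. \<phi> s \<noteq> \<zero>\<^bsub>K\<^esub>} \<subseteq> S"
  by (auto simp: free_module_def)

lemma (in cring) free_module_module: "module R (free_module R S)"
proof -
  let ?F = "free_module R S"
  have add: "\<phi> \<oplus>\<^bsub>?F\<^esub> \<psi> \<in> carrier ?F" if "\<phi> \<in> carrier ?F" "\<psi> \<in> carrier ?F" for \<phi> \<psi>
  proof -
    have "{s. \<phi> s \<oplus> \<psi> s \<noteq> \<zero>} \<subseteq> {s. \<phi> s \<noteq> \<zero>} \<union> {s. \<psi> s \<noteq> \<zero>}"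
      by auto
    moreover from this have "finite {s. \<phi> s \<oplus> \<psi> s \<noteq> \<zero>}"
      by (rule finite_subset) (use that in \<open>auto simp: free_module_carrier\<close>)
    ultimately show ?thesis
      using that by (simp add: free_module_carrier) blast
  qed
  have smult: "c \<odot>\<^bsub>?F\<^esub> \<phi> \<in> carrier ?F" if "c \<in> carrier R" "\<phi> \<in> carrier ?F" for c \<phi>
  proof -
    have "{s. c \<otimes> \<phi> s \<noteq> \<zero>} \<subseteq> {s. \<phi> s \<noteq> \<zero>}"
      using that by auto
    moreover from this have "finite {s. c \<otimes> \<phi> s \<noteq> \<zero>}"
      by (rule finite_subset) (use that in \<open>auto simp: free_module_carrier\<close>)
    ultimately show ?thesis
      using that by (simp add: free_module_carrier) blast
  qed
  have "abelian_group ?F"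
  proof (rule abelian_groupI)
    \<comment> \<open>The negative is taken as minus one times \<open>\<phi>\<close>; its finite
      support is then an instance of \<open>smult\<close>.\<close>
    show "\<exists>\<psi>\<in>carrier ?F. \<psi> \<oplus>\<^bsub>?F\<^esub> \<phi> = \<zero>\<^bsub>?F\<^esub>" if "\<phi> \<in> carrier ?F" for \<phi>
      using smult[of "\<ominus> \<one>" \<phi>] that
      by (intro bexI[of _ "\<lambda>s. \<ominus> \<one> \<otimes> \<phi> s"])
        (auto simp: free_module_carrier l_minus l_neg)
  qed (use add in \<open>simp_all add: free_module_carrier a_ac\<close>)
  then show ?thesis
    by (rule moduleI[OF is_cring])
      (use smult in \<open>simp_all add: free_module_carrier l_distr r_distr m_assoc\<close>)
qed

lemma (in cring) single_closed: "s \<in> S \<Longrightarrow> single R s \<in> carrier (free_module R S)"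
  by (auto simp: free_module_carrier single_def)

text \<open>The induction runs over a finite set that contains the support, not over the support
  itself, so a point may be split off even if its coefficient is zero.\<close>

lemma (in cring) free_module_induct [consumes 1, case_names zero add]:
  assumes \<phi>: "\<phi> \<in> carrier (free_module R S)"
    and zero: "P (\<lambda>s. \<zero>)"
    and add: "\<And>c s \<phi>. \<lbrakk>c \<in> carrier R; s \<in> S; \<phi> \<in> carrier (free_module R S); P \<phi>\<rbrakk> \<Longrightarrow>
      P ((c \<odot>\<^bsub>free_module R S\<^esub> single R s) \<oplus>\<^bsub>free_module R S\<^esub> \<phi>)"
  shows "P \<phi>"
proof -
  interpret F: module R "free_module R S" by (rule free_module_module)
  have "P \<phi>" if "finite U" "\<phi> \<in> carrier (free_module R S)" "{s. \<phi> s \<noteq> \<zero>} \<subseteq> U" "U \<subseteq> S" for U \<phi>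
    using that
  proof (induction U arbitrary: \<phi>)
    case empty
    then have "\<phi> = (\<lambda>s. \<zero>)" by auto
    then show ?case using zero by simp
  next
    case (insert s U)
    let ?\<psi> = "\<phi>(s := \<zero>)"
    have "{t. ?\<psi> t \<noteq> \<zero>} \<subseteq> {t. \<phi> t \<noteq> \<zero>}"
      by auto
    then have "finite {t. ?\<psi> t \<noteq> \<zero>}"
      by (rule finite_subset) (use insert.prems in \<open>auto simp: free_module_carrier\<close>)
    then have \<psi>: "?\<psi> \<in> carrier (free_module R S)"
      using insert.prems by (auto simp: free_module_carrier)
    have "P ((\<phi> s \<odot>\<^bsub>free_module R S\<^esub> single R s) \<oplus>\<^bsub>free_module R S\<^esub> ?\<psi>)"
      using insert.prems \<psi> by (intro add insert.IH) (auto simp: free_module_carrier)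
    moreover have "(\<phi> s \<odot>\<^bsub>free_module R S\<^esub> single R s) \<oplus>\<^bsub>free_module R S\<^esub> ?\<psi> = \<phi>"
      using insert.prems by (auto simp: free_module_carrier single_def fun_eq_iff)
    ultimately show ?case by simp
  qed
  with \<phi> show ?thesis
    by (auto simp: free_module_carrier)
qed

lemma linear_mapI:
  assumes "\<And>x. x \<in> carrier A \<Longrightarrow> f x \<in> carrier B"
    and "\<And>x y. \<lbrakk>x \<in> carrier A; y \<in> carrier A\<rbrakk> \<Longrightarrow> f (x \<oplus>\<^bsub>A\<^esub> y) = f x \<oplus>\<^bsub>B\<^esub> f y"
    and "\<And>c x. \<lbrakk>c \<in> carrier K; x \<in> carrier A\<rbrakk> \<Longrightarrow> f (c \<odot>\<^bsub>A\<^esub> x) = c \<odot>\<^bsub>B\<^esub> f x"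
  shows "linear_map K A B f"
  using assms by (auto simp: linear_map_def)

lemma linear_mapD:
  assumes "linear_map K A B f"
  shows "x \<in> carrier A \<Longrightarrow> f x \<in> carrier B"
    and "\<lbrakk>x \<in> carrier A; y \<in> carrier A\<rbrakk> \<Longrightarrow> f (x \<oplus>\<^bsub>A\<^esub> y) = f x \<oplus>\<^bsub>B\<^esub> f y"
    and "\<lbrakk>c \<in> carrier K; x \<in> carrier A\<rbrakk> \<Longrightarrow> f (c \<odot>\<^bsub>A\<^esub> x) = c \<odot>\<^bsub>B\<^esub> f x"
  using assms by (auto simp: linear_map_def)

lemma linear_map_zero:
  assumes "module K A" "module K B" "linear_map K A B f"
  shows "f \<zero>\<^bsub>A\<^esub> = \<zero>\<^bsub>B\<^esub>"
proof -
  interpret A: module K A by fact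
  interpret B: module K B by fact
  have "f (\<zero>\<^bsub>K\<^esub> \<odot>\<^bsub>A\<^esub> \<zero>\<^bsub>A\<^esub>) = \<zero>\<^bsub>K\<^esub> \<odot>\<^bsub>B\<^esub> f \<zero>\<^bsub>A\<^esub>"
    using assms(3) by (simp add: linear_mapD del: A.smult_l_null A.smult_r_null)
  then show ?thesis
    using linear_mapD(1)[OF assms(3), of "\<zero>\<^bsub>A\<^esub>"] by simp
qed

lemma linear_map_minus:
  assumes "module K A" "module K B" "linear_map K A B f" "x \<in> carrier A" "y \<in> carrier A"
  shows "f (x \<ominus>\<^bsub>A\<^esub> y) = f x \<ominus>\<^bsub>B\<^esub> f y"
proof -
  interpret A: module K A by fact
  interpret B: module K B by fact
  have "f (\<ominus>\<^bsub>A\<^esub> y) \<oplus>\<^bsub>B\<^esub> f y = f (\<ominus>\<^bsub>A\<^esub> y \<oplus>\<^bsub>A\<^esub> y)"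
    using assms by (simp add: linear_mapD del: A.l_neg A.r_neg)
  also have "\<dots> = \<zero>\<^bsub>B\<^esub>"
    using assms by (simp add: A.l_neg linear_map_zero)
  finally have "f (\<ominus>\<^bsub>A\<^esub> y) = \<ominus>\<^bsub>B\<^esub> f y"
    using assms by (intro B.minus_equality[symmetric]) (auto simp: linear_mapD)
  then show ?thesis
    using assms by (simp add: a_minus_def linear_mapD)
qed

lemma submodule_kernel:
  assumes "module K A" "module K B" "linear_map K A B f"
  shows "submodule {x \<in> carrier A. f x = \<zero>\<^bsub>B\<^esub>} K A"
proof -
  interpret A: module K A by fact
  interpret B: module K B by fact
  have "f (\<ominus>\<^bsub>A\<^esub> x) = \<zero>\<^bsub>B\<^esub>" if "x \<in> carrier A" "f x = \<zero>\<^bsub>B\<^esub>" for x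
    using linear_map_minus[OF assms A.zero_closed that(1)] linear_map_zero[OF assms] that
    by (simp add: a_minus_def)
  then show ?thesis
    using linear_map_zero[OF assms] assms(3)
    by (intro A.submoduleI) (auto simp: linear_mapD)
qed

text \<open>The record that \<open>tensor_module\<close> writes out for one particular pair,
  abstracted so that its operations can be checked without mentioning tensors.\<close>

definition quotient_module ::
    "('k, 'a, 'n) module_scheme \<Rightarrow> 'a set \<Rightarrow> ('k, 'a set) module" where
  "quotient_module M N =
    \<lparr>carrier = a_rcosets\<^bsub>M\<^esub> N, mult = undefined, one = undefined,
     zero = N, add = (\<lambda>X Y. X <+>\<^bsub>M\<^esub> Y),
     smult = (\<lambda>c X. \<Union>\<phi>\<in>X. N +>\<^bsub>M\<^esub> (c \<odot>\<^bsub>M\<^esub> \<phi>))\<rparr>"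

locale module_quotient = module K M + submodule N K M for K (structure) and M (structure) and N
begin

sublocale abelian_subgroup N M
  by (rule abelian_subgroupI3)
    (use subgroup_axioms abelian_group_axioms in \<open>auto simp: additive_subgroup_def\<close>)

lemma quotient_carrier: "carrier (quotient_module M N) = (\<lambda>x. N +>\<^bsub>M\<^esub> x) ` carrier M"
  by (auto simp: quotient_module_def A_RCOSETS_def')

lemma quotient_zero: "\<zero>\<^bsub>quotient_module M N\<^esub> = N +>\<^bsub>M\<^esub> \<zero>\<^bsub>M\<^esub>"
  by (simp add: quotient_module_def a_subset)

lemma quotient_add:
  "\<lbrakk>x \<in> carrier M; y \<in> carrier M\<rbrakk> \<Longrightarrow>
    (N +>\<^bsub>M\<^esub> x) \<oplus>\<^bsub>quotient_module M N\<^esub> (N +>\<^bsub>M\<^esub> y) = N +>\<^bsub>M\<^esub> (x \<oplus>\<^bsub>M\<^esub> y)"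
  by (simp add: quotient_module_def a_rcos_sum)

lemma coset_eq_iff:
  assumes "x \<in> carrier M" "y \<in> carrier M"
  shows "N +>\<^bsub>M\<^esub> x = N +>\<^bsub>M\<^esub> y \<longleftrightarrow> x \<ominus>\<^bsub>M\<^esub> y \<in> N"
proof -
  have "N +>\<^bsub>M\<^esub> x = N +>\<^bsub>M\<^esub> y \<longleftrightarrow> x \<in> N +>\<^bsub>M\<^esub> y"
    using assms a_rcos_self[of x] a_repr_independence'[of x y] by blast
  also have "\<dots> \<longleftrightarrow> x \<ominus>\<^bsub>M\<^esub> y \<in> N"
    using assms a_rcos_module[of y x] by (simp add: a_minus_def)
  finally show ?thesis .
qed

text \<open>The union in the definition runs over all representatives, but each of them contributes
  the same coset: two representatives differ by an element of \<open>N\<close>, and \<open>N\<close>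
  is closed under scalars.\<close>

lemma quotient_smult:
  assumes c: "c \<in> carrier K" and x: "x \<in> carrier M"
  shows "c \<odot>\<^bsub>quotient_module M N\<^esub> (N +>\<^bsub>M\<^esub> x) = N +>\<^bsub>M\<^esub> (c \<odot>\<^bsub>M\<^esub> x)"
proof -
  have "N +>\<^bsub>M\<^esub> (c \<odot>\<^bsub>M\<^esub> y) = N +>\<^bsub>M\<^esub> (c \<odot>\<^bsub>M\<^esub> x)" if y: "y \<in> N +>\<^bsub>M\<^esub> x" for y
  proof -
    have yM: "y \<in> carrier M"
      using y x a_elemrcos_carrier by blast
    have "y \<ominus>\<^bsub>M\<^esub> x \<in> N"
      using a_repr_independence'[OF y x] coset_eq_iff[OF yM x] by simp
    then have "c \<odot>\<^bsub>M\<^esub> (y \<ominus>\<^bsub>M\<^esub> x) \<in> N"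
      using c by blast
    then show ?thesis
      using c x yM by (simp add: coset_eq_iff a_minus_def smult_r_distr smult_r_minus)
  qed
  moreover have "x \<in> N +>\<^bsub>M\<^esub> x"
    using x by (rule a_rcos_self)
  ultimately have "(\<Union>y\<in>N +>\<^bsub>M\<^esub> x. N +>\<^bsub>M\<^esub> (c \<odot>\<^bsub>M\<^esub> y)) = N +>\<^bsub>M\<^esub> (c \<odot>\<^bsub>M\<^esub> x)"
    by blast
  then show ?thesis
    by (simp add: quotient_module_def)
qed

lemma quotient_module: "module K (quotient_module M N)"
proof (rule moduleI[OF is_cring])
  show "abelian_group (quotient_module M N)"
  proof (rule abelian_groupI)
    show "\<exists>Y\<in>carrier (quotient_module M N).
        Y \<oplus>\<^bsub>quotient_module M N\<^esub> X = \<zero>\<^bsub>quotient_module M N\<^esub>"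
      if X: "X \<in> carrier (quotient_module M N)" for X
    proof -
      obtain x where "x \<in> carrier M" "X = N +>\<^bsub>M\<^esub> x"
        using X by (auto simp: quotient_carrier)
      then show ?thesis
        \<comment> \<open>The zero coset has to keep the form of a coset of the zero element, since
          \<open>quotient_add\<close> speaks of sums of cosets; this is why the rule that simplifies
          it is removed.\<close>
        by (intro bexI[of _ "N +>\<^bsub>M\<^esub> (\<ominus>\<^bsub>M\<^esub> x)"])
          (auto simp: quotient_carrier quotient_add quotient_zero M.l_neg simp del: a_coset_add_zero)
    qed
  qed (auto simp: quotient_carrier quotient_add quotient_zero M.a_ac
    simp del: a_coset_add_zero)
qed (auto simp: quotient_carrier quotient_add quotient_smult smult_l_distr smult_r_distr smult_assoc1)

end

section \<open>Linear extension of a map from the basis to the free module\<close>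

definition free_lift ::
    "('k, 'm) ring_scheme \<Rightarrow> ('k, 'c, 'q) module_scheme \<Rightarrow> ('s \<Rightarrow> 'c) \<Rightarrow> ('s \<Rightarrow> 'k) \<Rightarrow> 'c" where
  "free_lift K C h \<phi> = (\<Oplus>\<^bsub>C\<^esub>p\<in>{p. \<phi> p \<noteq> \<zero>\<^bsub>K\<^esub>}. \<phi> p \<odot>\<^bsub>C\<^esub> h p)"

context module
begin

text \<open>The support of a sum is in general smaller than the union of the supports. Summing over
  a common finite superset makes linearity a termwise statement.\<close>

lemma free_lift_superset:
  assumes "h \<in> S \<rightarrow> carrier M" "\<phi> \<in> carrier (free_module R S)"
    and "finite U" "{p. \<phi> p \<noteq> \<zero>} \<subseteq> U" "U \<subseteq> S"
  shows "free_lift R M h \<phi> = (\<Oplus>\<^bsub>M\<^esub>p\<in>U. \<phi> p \<odot>\<^bsub>M\<^esub> h p)"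
  unfolding free_lift_def
  using assms
  by (intro M.add.finprod_mono_neutral_cong_left) (auto simp: free_module_carrier subset_eq Pi_iff)

lemma free_lift_linear:
  assumes h: "h \<in> S \<rightarrow> carrier M"
  shows "linear_map R (free_module R S) M (free_lift R M h)"
proof (rule linear_mapI)
  interpret F: module R "free_module R S" by (rule free_module_module)
  show "free_lift R M h \<phi> \<in> carrier M" if "\<phi> \<in> carrier (free_module R S)" for \<phi>
    unfolding free_lift_def
    using that h by (intro M.finsum_closed) (auto simp: free_module_carrier subset_eq Pi_iff)
  show "free_lift R M h (\<phi> \<oplus>\<^bsub>free_module R S\<^esub> \<psi>) = free_lift R M h \<phi> \<oplus>\<^bsub>M\<^esub> free_lift R M h \<psi>"
    if \<phi>: "\<phi> \<in> carrier (free_module R S)" and \<psi>: "\<psi> \<in> carrier (free_module R S)" for \<phi> \<psi>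
  proof -
    let ?U = "{p. \<phi> p \<noteq> \<zero>} \<union> {p. \<psi> p \<noteq> \<zero>}"
    have U: "finite ?U" "?U \<subseteq> S"
      using \<phi> \<psi> by (auto simp: free_module_carrier)
    have *: "free_lift R M h \<chi> = (\<Oplus>\<^bsub>M\<^esub>p\<in>?U. \<chi> p \<odot>\<^bsub>M\<^esub> h p)"
      if "\<chi> \<in> carrier (free_module R S)" "{p. \<chi> p \<noteq> \<zero>} \<subseteq> ?U" for \<chi>
      using that U by (intro free_lift_superset[OF h])
    have sub: "{p. (\<phi> \<oplus>\<^bsub>free_module R S\<^esub> \<psi>) p \<noteq> \<zero>} \<subseteq> ?U"
      by auto
    have "free_lift R M h (\<phi> \<oplus>\<^bsub>free_module R S\<^esub> \<psi>) =
        (\<Oplus>\<^bsub>M\<^esub>p\<in>?U. (\<phi> \<oplus>\<^bsub>free_module R S\<^esub> \<psi>) p \<odot>\<^bsub>M\<^esub> h p)"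
      using F.a_closed[OF \<phi> \<psi>] sub by (rule *)
    also have "\<dots> = (\<Oplus>\<^bsub>M\<^esub>p\<in>?U. \<phi> p \<odot>\<^bsub>M\<^esub> h p \<oplus>\<^bsub>M\<^esub> \<psi> p \<odot>\<^bsub>M\<^esub> h p)"
      using \<phi> \<psi> h U by (intro M.finsum_cong') (auto simp: free_module_carrier subset_eq Pi_iff smult_l_distr)
    also have "\<dots> = free_lift R M h \<phi> \<oplus>\<^bsub>M\<^esub> free_lift R M h \<psi>"
      using \<phi> \<psi> h U by (subst M.finsum_addf) (auto simp: * free_module_carrier subset_eq Pi_iff)
    finally show ?thesis .
  qed
  show "free_lift R M h (c \<odot>\<^bsub>free_module R S\<^esub> \<phi>) = c \<odot>\<^bsub>M\<^esub> free_lift R M h \<phi>"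
    if c: "c \<in> carrier R" and \<phi>: "\<phi> \<in> carrier (free_module R S)" for c \<phi>
  proof -
    let ?U = "{p. \<phi> p \<noteq> \<zero>}"
    have U: "finite ?U" "?U \<subseteq> S"
      using \<phi> by (auto simp: free_module_carrier)
    have "free_lift R M h (c \<odot>\<^bsub>free_module R S\<^esub> \<phi>) =
        (\<Oplus>\<^bsub>M\<^esub>p\<in>?U. (c \<odot>\<^bsub>free_module R S\<^esub> \<phi>) p \<odot>\<^bsub>M\<^esub> h p)"
      using F.smult_closed[OF c \<phi>] U c by (intro free_lift_superset[OF h]) auto
    also have "\<dots> = (\<Oplus>\<^bsub>M\<^esub>p\<in>?U. c \<odot>\<^bsub>M\<^esub> (\<phi> p \<odot>\<^bsub>M\<^esub> h p))"
      using \<phi> h U c by (intro M.finsum_cong') (auto simp: free_module_carrier subset_eq Pi_iff smult_assoc1)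
    also have "\<dots> = c \<odot>\<^bsub>M\<^esub> free_lift R M h \<phi>"
      unfolding free_lift_def
      using \<phi> h U c by (subst finsum_smult_ldistr) (auto simp: free_module_carrier subset_eq Pi_iff)
    finally show ?thesis .
  qed
qed

lemma free_lift_single:
  assumes "s \<in> S" "h \<in> S \<rightarrow> carrier M"
  shows "free_lift R M h (single R s) = h s"
proof -
  have "free_lift R M h (single R s) = (\<Oplus>\<^bsub>M\<^esub>p\<in>{s}. single R s p \<odot>\<^bsub>M\<^esub> h p)"
    using assms by (intro free_lift_superset[OF _ single_closed]) (auto simp: single_def)
  then show ?thesis
    using assms by (simp add: M.finsum_insert Pi_iff single_def)
qed

end

declare free_module_sel [simp del]

section \<open>The universal property of the tensor product\<close>

definition bilinear_map ::
    "('k, 'm) ring_scheme \<Rightarrow> ('k, 'a, 'n) module_scheme \<Rightarrow> ('k, 'b, 'p) module_scheme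
      \<Rightarrow> ('k, 'c, 'q) module_scheme \<Rightarrow> ('a \<Rightarrow> 'b \<Rightarrow> 'c) \<Rightarrow> bool" where
  "bilinear_map K A B C h \<longleftrightarrow>
    (\<forall>a\<in>carrier A. linear_map K B C (h a)) \<and> (\<forall>b\<in>carrier B. linear_map K A C (\<lambda>a. h a b))"

lemma bilinear_mapD:
  assumes "bilinear_map K A B C h" "a \<in> carrier A" "b \<in> carrier B"
  shows "h a b \<in> carrier C"
    and "a' \<in> carrier A \<Longrightarrow> h (a \<oplus>\<^bsub>A\<^esub> a') b = h a b \<oplus>\<^bsub>C\<^esub> h a' b"
    and "b' \<in> carrier B \<Longrightarrow> h a (b \<oplus>\<^bsub>B\<^esub> b') = h a b \<oplus>\<^bsub>C\<^esub> h a b'"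
    and "c \<in> carrier K \<Longrightarrow> h (c \<odot>\<^bsub>A\<^esub> a) b = c \<odot>\<^bsub>C\<^esub> h a b"
    and "c \<in> carrier K \<Longrightarrow> h a (c \<odot>\<^bsub>B\<^esub> b) = c \<odot>\<^bsub>C\<^esub> h a b"
  using assms by (auto simp: bilinear_map_def linear_map_def)

lemma minus_zero_iff:
  assumes "abelian_group G" "x \<in> carrier G" "y \<in> carrier G"
  shows "x \<ominus>\<^bsub>G\<^esub> y = \<zero>\<^bsub>G\<^esub> \<longleftrightarrow> x = y"
proof -
  interpret abelian_group G by fact
  show ?thesis
    using assms(2,3) by (metis a_minus_def add.inv_closed add.inv_equality minus_minus r_neg)
qed

locale module_pair = A: module K A + B: module K B
  for K (structure) and A (structure) and B (structure)
begin

abbreviation "F \<equiv> free_module K (carrier A \<times> carrier B)"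
abbreviation "N \<equiv> tensor_null K A B"
abbreviation "T \<equiv> tensor_module K A B"

sublocale F: module K F
  by (rule A.free_module_module)

lemma single_in_F [simp]: "\<lbrakk>a \<in> carrier A; b \<in> carrier B\<rbrakk> \<Longrightarrow> single K (a, b) \<in> carrier F"
  by (rule A.single_closed) simp

text \<open>A hull has the property it is formed with only if that property survives intersections.
  Submodules do for nonempty families, and the whole free module shows that the family is
  nonempty.\<close>

lemma tensor_null_submodule: "submodule N K F"
proof -
  have rel: "bilinear_relations K A B \<subseteq> carrier F"
    unfolding bilinear_relations_def Let_def
    by (auto intro!: F.minus_closed F.a_closed F.smult_closed)
  have "submodule (\<Inter>X) K F" if X: "\<And>N. N \<in> X \<Longrightarrow> submodule N K F" "X \<noteq> {}" for X
  proof (rule F.submoduleI)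
    show "\<Inter>X \<subseteq> carrier F"
      using X F.submoduleE(1) by blast
    show "\<zero>\<^bsub>F\<^esub> \<in> \<Inter>X"
      using X(1) subgroup.one_closed[OF submodule.axioms(1)] by fastforce
  qed (use X(1) F.submoduleE(3-5) in \<open>blast+\<close>)
  from this[of "{t. submodule t K F \<and> bilinear_relations K A B \<subseteq> t}"] show ?thesis
    using F.carrier_is_submodule rel unfolding tensor_null_def hull_def by blast
qed

sublocale Q: module_quotient K F N
  by (intro module_quotient.intro F.module_axioms tensor_null_submodule)

lemma tensor_module_eq: "T = quotient_module F N"
  by (simp add: tensor_module_def quotient_module_def Let_def)

sublocale T: module K T
  unfolding tensor_module_eq by (rule Q.quotient_module)

lemma relations_null: "x \<in> bilinear_relations K A B \<Longrightarrow> x \<in> N"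
  unfolding tensor_null_def by (rule hull_inc)

lemma pure_tensor_closed [simp]: "\<lbrakk>a \<in> carrier A; b \<in> carrier B\<rbrakk> \<Longrightarrow> pure_tensor K A B a b \<in> carrier T"
  by (auto simp: tensor_module_eq Q.quotient_carrier pure_tensor_def)

lemma pure_tensor_bilinear: "bilinear_map K A B T (pure_tensor K A B)"
proof -
  have 1: "pure_tensor K A B (a \<oplus>\<^bsub>A\<^esub> a') b = pure_tensor K A B a b \<oplus>\<^bsub>T\<^esub> pure_tensor K A B a' b"
    if "a \<in> carrier A" "a' \<in> carrier A" "b \<in> carrier B" for a a' b
  proof -
    have "single K (a \<oplus>\<^bsub>A\<^esub> a', b) \<ominus>\<^bsub>F\<^esub> (single K (a, b) \<oplus>\<^bsub>F\<^esub> single K (a', b)) \<in> N"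
      using that by (intro relations_null, unfold bilinear_relations_def Let_def) blast
    then show ?thesis
      using that by (simp add: tensor_module_eq pure_tensor_def Q.quotient_add Q.coset_eq_iff)
  qed
  have 2: "pure_tensor K A B a (b \<oplus>\<^bsub>B\<^esub> b') = pure_tensor K A B a b \<oplus>\<^bsub>T\<^esub> pure_tensor K A B a b'"
    if "a \<in> carrier A" "b \<in> carrier B" "b' \<in> carrier B" for a b b'
  proof -
    have "single K (a, b \<oplus>\<^bsub>B\<^esub> b') \<ominus>\<^bsub>F\<^esub> (single K (a, b) \<oplus>\<^bsub>F\<^esub> single K (a, b')) \<in> N"
      using that by (intro relations_null, unfold bilinear_relations_def Let_def) blast
    then show ?thesis
      using that by (simp add: tensor_module_eq pure_tensor_def Q.quotient_add Q.coset_eq_iff)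
  qed
  have 3: "pure_tensor K A B (c \<odot>\<^bsub>A\<^esub> a) b = c \<odot>\<^bsub>T\<^esub> pure_tensor K A B a b"
    if "c \<in> carrier K" "a \<in> carrier A" "b \<in> carrier B" for a b c
  proof -
    have "single K (c \<odot>\<^bsub>A\<^esub> a, b) \<ominus>\<^bsub>F\<^esub> (c \<odot>\<^bsub>F\<^esub> single K (a, b)) \<in> N"
      using that by (intro relations_null, unfold bilinear_relations_def Let_def) blast
    then show ?thesis
      using that by (simp add: tensor_module_eq pure_tensor_def Q.quotient_smult Q.coset_eq_iff)
  qed
  have 4: "pure_tensor K A B a (c \<odot>\<^bsub>B\<^esub> b) = c \<odot>\<^bsub>T\<^esub> pure_tensor K A B a b"
    if "c \<in> carrier K" "a \<in> carrier A" "b \<in> carrier B" for a b c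
  proof -
    have "single K (a, c \<odot>\<^bsub>B\<^esub> b) \<ominus>\<^bsub>F\<^esub> (c \<odot>\<^bsub>F\<^esub> single K (a, b)) \<in> N"
      using that by (intro relations_null, unfold bilinear_relations_def Let_def) blast
    then show ?thesis
      using that by (simp add: tensor_module_eq pure_tensor_def Q.quotient_smult Q.coset_eq_iff)
  qed
  show ?thesis
    by (auto simp: bilinear_map_def 1 2 3 4 intro!: linear_mapI)
qed

lemma tensor_induct [consumes 1, case_names pure add smult]:
  assumes t: "t \<in> carrier T"
    and pure: "\<And>a b. \<lbrakk>a \<in> carrier A; b \<in> carrier B\<rbrakk> \<Longrightarrow> P (pure_tensor K A B a b)"
    and add: "\<And>x y. \<lbrakk>x \<in> carrier T; y \<in> carrier T; P x; P y\<rbrakk> \<Longrightarrow> P (x \<oplus>\<^bsub>T\<^esub> y)"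
    and smult: "\<And>c x. \<lbrakk>c \<in> carrier K; x \<in> carrier T; P x\<rbrakk> \<Longrightarrow> P (c \<odot>\<^bsub>T\<^esub> x)"
  shows "P t"
proof -
  obtain \<phi> where \<phi>: "\<phi> \<in> carrier F" and t': "t = N +>\<^bsub>F\<^esub> \<phi>"
    using t by (auto simp: tensor_module_eq Q.quotient_carrier)
  have "P (N +>\<^bsub>F\<^esub> \<phi>)"
    using \<phi>
  proof (induction \<phi> rule: A.free_module_induct)
    case zero
    \<comment> \<open>Zero needs no case of its own in the induction rule: it is the scalar zero
      times a pure tensor.\<close>
    have "P (\<zero> \<odot>\<^bsub>T\<^esub> pure_tensor K A B \<zero>\<^bsub>A\<^esub> \<zero>\<^bsub>B\<^esub>)"
      by (intro smult pure) auto
    then show ?case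
      using Q.quotient_zero by (simp add: tensor_module_eq[symmetric] free_module_sel)
  next
    case (add c s \<phi>)
    then obtain a b where s: "s = (a, b)" and ab: "a \<in> carrier A" "b \<in> carrier B"
      by auto
    have "N +>\<^bsub>F\<^esub> (c \<odot>\<^bsub>F\<^esub> single K s \<oplus>\<^bsub>F\<^esub> \<phi>) = c \<odot>\<^bsub>T\<^esub> pure_tensor K A B a b \<oplus>\<^bsub>T\<^esub> (N +>\<^bsub>F\<^esub> \<phi>)"
      using add.hyps ab
      unfolding s pure_tensor_def tensor_module_eq
      by (simp add: Q.quotient_add Q.quotient_smult F.smult_closed)
    moreover have "N +>\<^bsub>F\<^esub> \<phi> \<in> carrier T"
      using add.hyps by (auto simp: tensor_module_eq Q.quotient_carrier)
    ultimately show ?case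
      using add.hyps add.IH ab by (auto intro!: assms(3) smult pure)
  qed
  then show ?thesis
    by (simp add: t')
qed

text \<open>\<open>tensor_lift\<close> evaluates \<open>h\<close> only at the pairs in the support
  of a representative, and these lie in the carriers.\<close>

lemma tensor_lift_cong:
  assumes "t \<in> carrier T" "\<And>a b. \<lbrakk>a \<in> carrier A; b \<in> carrier B\<rbrakk> \<Longrightarrow> h a b = h' a b"
    and "bilinear_map K A B C h" "module K C"
  shows "tensor_lift K C h t = tensor_lift K C h' t"
proof -
  interpret C: module K C by fact
  have "free_lift K C (\<lambda>p. h (fst p) (snd p)) \<phi> = free_lift K C (\<lambda>p. h' (fst p) (snd p)) \<phi>"
    if "\<phi> \<in> t" for \<phi>
  proof -
    have "\<phi> \<in> carrier F"
      using that assms(1) Q.a_rcosets_carrier by (auto simp: tensor_module_eq quotient_module_def)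
    moreover have "h' a b \<in> carrier C" if "a \<in> carrier A" "b \<in> carrier B" for a b
      using that assms(2) bilinear_mapD(1)[OF assms(3)] by metis
    ultimately show ?thesis
      unfolding free_lift_def using assms(2)
      by (intro C.finsum_cong')
        (auto simp: free_module_carrier subset_eq Pi_iff mem_Times_iff intro!: C.smult_closed)
  qed
  then show ?thesis
    unfolding tensor_lift_def free_lift_def by (simp cong: image_cong)
qed

end

locale bilinear_lift = module_pair K A B + C: module K C
  for K (structure) and A (structure) and B (structure) and C (structure) +
  fixes h
  assumes bilinear: "bilinear_map K A B C h"
begin

lemma h_Pi: "(\<lambda>p. h (fst p) (snd p)) \<in> carrier A \<times> carrier B \<rightarrow> carrier C"
  using bilinear by (auto simp: bilinear_mapD)

abbreviation "hF \<equiv> free_lift K C (\<lambda>p. h (fst p) (snd p))"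

text \<open>The kernel of the linear extension is a submodule, and it contains the bilinear
  relations because \<open>h\<close> is bilinear; hence it contains their hull.\<close>

lemma free_lift_null:
  assumes "\<phi> \<in> N"
  shows "hF \<phi> = \<zero>\<^bsub>C\<^esub>"
proof -
  have lin: "linear_map K F C hF"
    by (rule C.free_lift_linear[OF h_Pi])
  note linD = linear_mapD[OF lin] linear_map_minus[OF F.module_axioms C.module_axioms lin]
  have single: "hF (single K (a, b)) = h a b" if "a \<in> carrier A" "b \<in> carrier B" for a b
    using that by (subst C.free_lift_single[OF _ h_Pi]) auto
  have "bilinear_relations K A B \<subseteq> {\<phi> \<in> carrier F. hF \<phi> = \<zero>\<^bsub>C\<^esub>}"
    unfolding bilinear_relations_def Let_def
    by (auto simp: linD single bilinear_mapD[OF bilinear] F.minus_closed F.a_closed F.smult_closed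
        minus_zero_iff[OF C.abelian_group_axioms])
  then show ?thesis
    using hull_minimal[where S = "\<lambda>N. submodule N K F" and t = "{\<phi> \<in> carrier F. hF \<phi> = \<zero>\<^bsub>C\<^esub>}"]
      submodule_kernel[OF F.module_axioms C.module_axioms lin] assms
    unfolding tensor_null_def by blast
qed

text \<open>This justifies the \<open>the_elem\<close> in \<open>tensor_lift\<close>:
  representatives differ by a null element, so the image of a coset is a singleton.\<close>

lemma tensor_lift_coset:
  assumes "\<phi> \<in> carrier F"
  shows "tensor_lift K C h (N +>\<^bsub>F\<^esub> \<phi>) = hF \<phi>"
proof -
  have lin: "linear_map K F C hF"
    by (rule C.free_lift_linear[OF h_Pi])
  have "hF \<psi> = hF \<phi>" if "\<psi> \<in> N +>\<^bsub>F\<^esub> \<phi>" for \<psi>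
  proof -
    have \<psi>: "\<psi> \<in> carrier F"
      using that assms Q.a_elemrcos_carrier by blast
    have "\<psi> \<ominus>\<^bsub>F\<^esub> \<phi> \<in> N"
      using Q.a_repr_independence'[OF that assms] Q.coset_eq_iff[OF \<psi> assms] by simp
    then have "hF \<psi> \<ominus>\<^bsub>C\<^esub> hF \<phi> = \<zero>\<^bsub>C\<^esub>"
      using free_lift_null linear_map_minus[OF F.module_axioms C.module_axioms lin \<psi> assms] by simp
    then show ?thesis
      using linear_mapD(1)[OF lin] \<psi> assms by (simp add: minus_zero_iff[OF C.abelian_group_axioms])
  qed
  moreover have "\<phi> \<in> N +>\<^bsub>F\<^esub> \<phi>"
    using assms by (rule Q.a_rcos_self)
  ultimately have "hF ` (N +>\<^bsub>F\<^esub> \<phi>) = {hF \<phi>}"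
    by blast
  then show ?thesis
    unfolding tensor_lift_def free_lift_def by simp
qed

lemma tensor_lift_linear: "linear_map K T C (tensor_lift K C h)"
proof (rule linear_mapI)
  note linD = linear_mapD[OF C.free_lift_linear[OF h_Pi]]
  note * = tensor_module_eq Q.quotient_carrier tensor_lift_coset Q.quotient_add Q.quotient_smult
    F.a_closed F.smult_closed linD
  show "tensor_lift K C h x \<in> carrier C" if "x \<in> carrier T" for x
    using that by (auto simp: *)
  show "tensor_lift K C h (x \<oplus>\<^bsub>T\<^esub> y) = tensor_lift K C h x \<oplus>\<^bsub>C\<^esub> tensor_lift K C h y"
    if "x \<in> carrier T" "y \<in> carrier T" for x y
    using that by (auto simp: *)
  show "tensor_lift K C h (c \<odot>\<^bsub>T\<^esub> x) = c \<odot>\<^bsub>C\<^esub> tensor_lift K C h x"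
    if "c \<in> carrier K" "x \<in> carrier T" for c x
    using that by (auto simp: *)
qed

lemma tensor_lift_pure:
  "\<lbrakk>a \<in> carrier A; b \<in> carrier B\<rbrakk> \<Longrightarrow> tensor_lift K C h (pure_tensor K A B a b) = h a b"
  unfolding pure_tensor_def
  by (subst tensor_lift_coset, simp, subst C.free_lift_single[OF _ h_Pi]) auto

end

section \<open>Calculus with lifted bilinear maps\<close>

text \<open>
  Unlike \<open>tensor_lift\<close>, \<open>tlift\<close> records the source modules, so that the linearity conditions of its
  rules are fully instantiated when the simplifier meets them.  The value \<open>\<zero>\<close> outside the carriers
  makes its congruence rule unconditional.
\<close>

definition tlift ::
    "('k, 'm) ring_scheme \<Rightarrow> ('k, 'a, 'n) module_scheme \<Rightarrow> ('k, 'b, 'p) module_scheme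
      \<Rightarrow> ('k, 'c, 'q) module_scheme \<Rightarrow> ('a \<Rightarrow> 'b \<Rightarrow> 'c) \<Rightarrow> ('a \<times> 'b \<Rightarrow> 'k) set \<Rightarrow> 'c" where
  "tlift K A B C h =
    tensor_lift K C (\<lambda>a b. if a \<in> carrier A \<and> b \<in> carrier B then h a b else \<zero>\<^bsub>C\<^esub>)"

lemma tlift_cong:
  assumes "t = t'" "\<And>a b. \<lbrakk>a \<in> carrier A; b \<in> carrier B\<rbrakk> \<Longrightarrow> h a b = h' a b"
  shows "tlift K A B C h t = tlift K A B C h' t'"
  using assms by (auto simp: tlift_def cong: if_cong conj_cong intro!: arg_cong[where f = "\<lambda>h. tensor_lift K C h t'"])

text \<open>As a congruence rule it makes the two carrier memberships available under the binders,
  where closedness conditions inside nested lifts need them.\<close>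

lemma tlift_cong_simp [cong]:
  assumes "t = t'" "\<And>a b. a \<in> carrier A =simp=> b \<in> carrier B =simp=> h a b = h' a b"
  shows "tlift K A B C h t = tlift K A B C h' t'"
  using assms unfolding simp_implies_def by (rule tlift_cong)

text \<open>
  The weak congruence rules stop the simplifier from rewriting the map in a linearity condition,
  which has to keep the shape that the linearity rules match.
\<close>

lemma linear_map_weak_cong [cong]: "linear_map K A B f = linear_map K A B f" ..

lemma bilinear_map_weak_cong [cong]: "bilinear_map K A B C h = bilinear_map K A B C h" ..

declare bilinear_map_def [simp]

lemma linear_map_cong:
  assumes "\<And>x. x \<in> carrier A \<Longrightarrow> f x = g x" "linear_map K A B f" "module K A"
  shows "linear_map K A B g"
proof -
  interpret A: module K A by fact
  show ?thesis
    using assms(1,2) unfolding linear_map_def by (auto simp: Pi_iff)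
qed

lemma bilinear_map_restrict:
  assumes "module K A" "module K B" "bilinear_map K A B C h"
  shows "bilinear_map K A B C (\<lambda>a b. if a \<in> carrier A \<and> b \<in> carrier B then h a b else z)"
  unfolding bilinear_map_def
proof safe
  show "linear_map K B C (\<lambda>b. if a \<in> carrier A \<and> b \<in> carrier B then h a b else z)" if "a \<in> carrier A" for a
    by (rule linear_map_cong[of B "h a" _ K C]) (use that assms in auto)
  show "linear_map K A C (\<lambda>a. if a \<in> carrier A \<and> b \<in> carrier B then h a b else z)" if "b \<in> carrier B" for b
    by (rule linear_map_cong[of A "\<lambda>a. h a b" _ K C]) (use that assms in auto)
qed

lemma bilinear_lift_restrict:
  assumes "module K A" "module K B" "module K C" "bilinear_map K A B C h"
  shows "bilinear_lift K A B C (\<lambda>a b. if a \<in> carrier A \<and> b \<in> carrier B then h a b else z)"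
  using assms bilinear_map_restrict[OF assms(1,2,4)]
  by (simp add: bilinear_lift_def bilinear_lift_axioms_def module_pair_def del: bilinear_map_def)

text \<open>The bridge from the definitions of Hopf algebras and pullbacks, which speak of
  \<open>tensor_lift\<close>, to the calculus with \<open>tlift\<close>.\<close>

lemma tensor_lift_tlift:
  assumes "module K A" "module K B" "module K C" "bilinear_map K A B C h"
    and "t \<in> carrier (tensor_module K A B)"
  shows "tensor_lift K C h t = tlift K A B C h t"
proof -
  interpret module_pair K A B using assms by (simp add: module_pair_def)
  show ?thesis
    unfolding tlift_def by (rule tensor_lift_cong) (use assms in \<open>simp_all del: bilinear_map_def\<close>)
qed

lemma tensor_module_module [simp]:
  assumes "module K A" "module K B"
  shows "module K (tensor_module K A B)"
proof -
  interpret module_pair K A B using assms by (simp add: module_pair_def)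
  show ?thesis by unfold_locales
qed

lemma pure_closed [simp]:
  assumes "module K A" "module K B" "a \<in> carrier A" "b \<in> carrier B"
  shows "pure_tensor K A B a b \<in> carrier (tensor_module K A B)"
proof -
  interpret module_pair K A B using assms by (simp add: module_pair_def)
  show ?thesis using assms by simp
qed

lemma tlift_linear [simp]:
  assumes "module K A" "module K B" "module K C" "bilinear_map K A B C h"
  shows "linear_map K (tensor_module K A B) C (tlift K A B C h)"
proof -
  interpret bilinear_lift K A B C "\<lambda>a b. if a \<in> carrier A \<and> b \<in> carrier B then h a b else \<zero>\<^bsub>C\<^esub>"
    using assms by (rule bilinear_lift_restrict)
  show ?thesis unfolding tlift_def by (rule tensor_lift_linear)
qed

lemma tlift_pure [simp]:
  assumes "module K A" "module K B" "module K C" "bilinear_map K A B C h"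
    and "a \<in> carrier A" "b \<in> carrier B"
  shows "tlift K A B C h (pure_tensor K A B a b) = h a b"
proof -
  interpret bilinear_lift K A B C "\<lambda>a b. if a \<in> carrier A \<and> b \<in> carrier B then h a b else \<zero>\<^bsub>C\<^esub>"
    using assms(1-4) by (rule bilinear_lift_restrict)
  show ?thesis unfolding tlift_def using assms by (simp add: tensor_lift_pure)
qed

lemma linear_map_comp:
  assumes "linear_map K A B f" "linear_map K X A g"
  shows "linear_map K X B (\<lambda>x. f (g x))"
  using assms by (auto simp: linear_map_def Pi_iff)

lemma linear_map_id [simp]: "linear_map K A A (\<lambda>x. x)" "linear_map K A A id"
  by (auto simp: linear_map_def)

lemma linear_tlift [simp]:
  assumes "module K A" "module K B" "module K C" "bilinear_map K A B C h"
    and "linear_map K X (tensor_module K A B) g"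
  shows "linear_map K X C (\<lambda>x. tlift K A B C h (g x))"
  using linear_map_comp[OF tlift_linear[OF assms(1-4)] assms(5)] .

lemma tlift_closed [simp]:
  assumes "module K A" "module K B" "module K C" "bilinear_map K A B C h"
    and "t \<in> carrier (tensor_module K A B)"
  shows "tlift K A B C h t \<in> carrier C"
  using linear_mapD(1)[OF tlift_linear[OF assms(1-4)] assms(5)] .

lemma linear_pure [simp]:
  assumes "module K A" "module K B"
  shows "\<lbrakk>linear_map K X A g; b \<in> carrier B\<rbrakk> \<Longrightarrow>
      linear_map K X (tensor_module K A B) (\<lambda>x. pure_tensor K A B (g x) b)"
    and "\<lbrakk>linear_map K X B h; a \<in> carrier A\<rbrakk> \<Longrightarrow>
      linear_map K X (tensor_module K A B) (\<lambda>x. pure_tensor K A B a (h x))"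
proof -
  interpret module_pair K A B using assms by (simp add: module_pair_def)
  show "\<lbrakk>linear_map K X A g; b \<in> carrier B\<rbrakk> \<Longrightarrow>
      linear_map K X (tensor_module K A B) (\<lambda>x. pure_tensor K A B (g x) b)"
    by (rule linear_map_comp[of _ A _ _ _ g]) (use pure_tensor_bilinear in auto)
  show "\<lbrakk>linear_map K X B h; a \<in> carrier A\<rbrakk> \<Longrightarrow>
      linear_map K X (tensor_module K A B) (\<lambda>x. pure_tensor K A B a (h x))"
    by (rule linear_map_comp[of _ B _ _ _ h]) (use pure_tensor_bilinear in auto)
qed

lemma tensor_ext:
  assumes "module K A" "module K B"
    and "linear_map K (tensor_module K A B) C \<phi>" "linear_map K (tensor_module K A B) C \<psi>"
    and "\<And>a b. \<lbrakk>a \<in> carrier A; b \<in> carrier B\<rbrakk> \<Longrightarrow> \<phi> (pure_tensor K A B a b) = \<psi> (pure_tensor K A B a b)"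
    and "t \<in> carrier (tensor_module K A B)"
  shows "\<phi> t = \<psi> t"
proof -
  interpret module_pair K A B using assms by (simp add: module_pair_def)
  show ?thesis
    using assms(6) by (induction t rule: tensor_induct) (simp_all add: linear_mapD[OF assms(3)] linear_mapD[OF assms(4)] assms(5))
qed

text \<open>Both sides are linear in \<open>t\<close> and agree on pure tensors. In Sweedler
  notation: a linear map passes under the summation sign.\<close>

lemma tlift_push:
  assumes "linear_map K C D \<phi>" "module K A" "module K B" "module K C" "module K D"
    and "bilinear_map K A B C h" "t \<in> carrier (tensor_module K A B)"
  shows "\<phi> (tlift K A B C h t) = tlift K A B D (\<lambda>a b. \<phi> (h a b)) t"
proof (rule tensor_ext[OF assms(2,3) _ _ _ assms(7)])
  have *: "bilinear_map K A B D (\<lambda>a b. \<phi> (h a b))"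
    using assms(6) by (simp add: linear_map_comp[OF assms(1)])
  show "linear_map K (tensor_module K A B) D (\<lambda>t. \<phi> (tlift K A B C h t))"
    by (rule linear_map_comp[OF assms(1) tlift_linear]) (use assms in auto)
  show "linear_map K (tensor_module K A B) D (tlift K A B D (\<lambda>a b. \<phi> (h a b)))"
    using assms * by (intro tlift_linear)
  show "\<phi> (tlift K A B C h (pure_tensor K A B a b)) = tlift K A B D (\<lambda>a b. \<phi> (h a b)) (pure_tensor K A B a b)"
    if "a \<in> carrier A" "b \<in> carrier B" for a b
    using that assms * by (simp del: bilinear_map_def)
qed

lemma tlift_pure_id [simp]:
  assumes "module K A" "module K B" "t \<in> carrier (tensor_module K A B)"
  shows "tlift K A B (tensor_module K A B) (pure_tensor K A B) t = t"
  by (rule tensor_ext[OF assms(1,2) _ _ _ assms(3), where C = "tensor_module K A B"])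
    (use assms in simp_all)

text \<open>Here the variable sits in the lifted map and the tensor is fixed, so the claim is no
  composition of linear maps; it is proved by induction on the tensor.\<close>

lemma linear_tlift_param [simp]:
  assumes "module K A" "module K B" "module K C" "module K X" "t \<in> carrier (tensor_module K A B)"
    and "\<forall>x\<in>carrier X. bilinear_map K A B C (F x)"
    and "\<forall>a\<in>carrier A. \<forall>b\<in>carrier B. linear_map K X C (\<lambda>x. F x a b)"
  shows "linear_map K X C (\<lambda>x. tlift K A B C (F x) t)"
proof -
  have F: "\<And>x. x \<in> carrier X \<Longrightarrow> bilinear_map K A B C (F x)"
    and lin: "\<And>a b. \<lbrakk>a \<in> carrier A; b \<in> carrier B\<rbrakk> \<Longrightarrow> linear_map K X C (\<lambda>x. F x a b)"
    using assms(6,7) by blast+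
  interpret X: module K X by fact
  interpret C: module K C by fact
  interpret module_pair K A B using assms by (simp add: module_pair_def)
  note L = linear_mapD[OF tlift_linear[OF assms(1-3) F]]
  show ?thesis
  proof (rule linear_mapI)
    show "tlift K A B C (F x) t \<in> carrier C" if "x \<in> carrier X" for x
      using L(1) that assms(5) .
    show "tlift K A B C (F (x \<oplus>\<^bsub>X\<^esub> y)) t = tlift K A B C (F x) t \<oplus>\<^bsub>C\<^esub> tlift K A B C (F y) t"
      if "x \<in> carrier X" "y \<in> carrier X" for x y
      using assms(5)
    proof (induction t rule: tensor_induct)
      case (pure a b)
      then show ?case
        using that assms(1-3) F by (simp add: linear_mapD[OF lin] del: bilinear_map_def cong del: tlift_cong_simp)
    next
      case (add s t)
      then show ?case
        using that by (simp add: L C.a_ac)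
    next
      case (smult c t)
      then show ?case
        using that by (simp add: L C.smult_r_distr)
    qed
    show "tlift K A B C (F (c \<odot>\<^bsub>X\<^esub> x)) t = c \<odot>\<^bsub>C\<^esub> tlift K A B C (F x) t"
      if "c \<in> carrier K" "x \<in> carrier X" for c x
      using assms(5)
    proof (induction t rule: tensor_induct)
      case (pure a b)
      then show ?case
        using that assms(1-3) F by (simp add: linear_mapD[OF lin] del: bilinear_map_def cong del: tlift_cong_simp)
    next
      case (add s t)
      then show ?case
        using that by (simp add: L C.smult_r_distr)
    next
      case (smult d t)
      then show ?case
        using that by (simp add: L X.m_comm flip: C.smult_assoc1)
    qed
  qed
qed

text \<open>With \<open>pure_tlift\<close> and \<open>mult_tlift\<close> it moves every sum
  outwards, so that expressions become iterated sums with a plain expression inside.\<close>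

lemma tlift_tlift [simp]:
  assumes "module K A" "module K B" "module K C" "module K D" "module K E"
    and "bilinear_map K A B (tensor_module K D E) h" "bilinear_map K D E C k"
    and "t \<in> carrier (tensor_module K A B)"
  shows "tlift K D E C k (tlift K A B (tensor_module K D E) h t) =
    tlift K A B C (\<lambda>a b. tlift K D E C k (h a b)) t"
  by (rule tlift_push[OF tlift_linear]) (use assms in \<open>simp_all del: bilinear_map_def\<close>)

lemma pure_tlift [simp]:
  assumes "module K A" "module K B" "module K C" "module K D"
    and "t \<in> carrier (tensor_module K A B)"
  shows "\<lbrakk>bilinear_map K A B C h; d \<in> carrier D\<rbrakk> \<Longrightarrow> pure_tensor K C D (tlift K A B C h t) d =
      tlift K A B (tensor_module K C D) (\<lambda>a b. pure_tensor K C D (h a b) d) t"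
    and "\<lbrakk>bilinear_map K A B D k; c \<in> carrier C\<rbrakk> \<Longrightarrow> pure_tensor K C D c (tlift K A B D k t) =
      tlift K A B (tensor_module K C D) (\<lambda>a b. pure_tensor K C D c (k a b)) t"
  by (rule tlift_push[where \<phi> = "\<lambda>x. pure_tensor K C D x d" and D = "tensor_module K C D"],
      use assms in \<open>simp_all del: bilinear_map_def\<close>)
    (rule tlift_push[where \<phi> = "\<lambda>x. pure_tensor K C D c x" and D = "tensor_module K C D"],
      use assms in \<open>simp_all del: bilinear_map_def\<close>)

text \<open>Fubini for sums over independent tensors. In general form it would loop as a rewrite
  rule; only instances that fix the order of two given coalgebras are handed to the
  simplifier.\<close>

lemma tlift_swap:
  assumes "module K A" "module K B" "module K C" "module K D" "module K E"
    and "t \<in> carrier (tensor_module K A B)" "s \<in> carrier (tensor_module K C D)"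
    and "\<And>a b. \<lbrakk>a \<in> carrier A; b \<in> carrier B\<rbrakk> \<Longrightarrow> bilinear_map K C D E (F a b)"
    and "\<And>c d. \<lbrakk>c \<in> carrier C; d \<in> carrier D\<rbrakk> \<Longrightarrow> bilinear_map K A B E (\<lambda>a b. F a b c d)"
  shows "tlift K A B E (\<lambda>a b. tlift K C D E (F a b) s) t =
    tlift K C D E (\<lambda>c d. tlift K A B E (\<lambda>a b. F a b c d) t) s"
proof -
  have bi: "bilinear_map K A B E (\<lambda>a b. tlift K C D E (F a b) s)"
    using assms by (auto intro!: linear_tlift_param)
  have bi': "bilinear_map K C D E (\<lambda>c d. tlift K A B E (\<lambda>a b. F a b c d) t)"
     if "t \<in> carrier (tensor_module K A B)" for t
    using assms that by (auto intro!: linear_tlift_param)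
  show ?thesis
  proof (rule tensor_ext[OF assms(1,2) _ _ _ assms(6), where \<phi> = "tlift K A B E (\<lambda>a b. tlift K C D E (F a b) s)"
      and C = E])
    show "linear_map K (tensor_module K A B) E (tlift K A B E (\<lambda>a b. tlift K C D E (F a b) s))"
      using assms bi by (intro tlift_linear)
    show "linear_map K (tensor_module K A B) E (\<lambda>t. tlift K C D E (\<lambda>c d. tlift K A B E (\<lambda>a b. F a b c d) t) s)"
      using assms bi' by (intro linear_tlift_param) (auto intro!: tlift_linear simp del: bilinear_map_def)
    fix a b assume "a \<in> carrier A" "b \<in> carrier B"
    then show "tlift K A B E (\<lambda>a b. tlift K C D E (F a b) s) (pure_tensor K A B a b) =
        tlift K C D E (\<lambda>c d. tlift K A B E (\<lambda>a b. F a b c d) (pure_tensor K A B a b)) s"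
      using assms bi by (simp del: bilinear_map_def)
  qed
qed

lemma bilinear_map_cong:
  assumes "module K A" "module K B" "bilinear_map K A B C h'"
    and "\<And>a b. \<lbrakk>a \<in> carrier A; b \<in> carrier B\<rbrakk> \<Longrightarrow> h a b = h' a b"
  shows "bilinear_map K A B C h"
  unfolding bilinear_map_def
proof safe
  show "linear_map K B C (h a)" if "a \<in> carrier A" for a
    by (rule linear_map_cong[of B "h' a"]) (use that assms in auto)
  show "linear_map K A C (\<lambda>a. h a b)" if "b \<in> carrier B" for b
    by (rule linear_map_cong[of A "\<lambda>a. h' a b"]) (use that assms in auto)
qed

text \<open>Made for nested lifts: bilinearity of the outer map becomes visible only after the inner
  \<open>tensor_lift\<close> has been replaced, so the hypothesis is placed on
  \<open>h'\<close>.\<close>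

lemma tensor_lift_tliftI:
  assumes "module K A" "module K B" "module K C" "t \<in> carrier (tensor_module K A B)"
    and "\<And>a b. \<lbrakk>a \<in> carrier A; b \<in> carrier B\<rbrakk> \<Longrightarrow> h a b = h' a b"
    and "bilinear_map K A B C h'"
  shows "tensor_lift K C h t = tlift K A B C h' t"
proof -
  have "bilinear_map K A B C h"
    using assms(1,2,6,5) by (rule bilinear_map_cong)
  then have "tensor_lift K C h t = tlift K A B C h t"
    using assms by (intro tensor_lift_tlift)
  also have "\<dots> = tlift K A B C h' t"
    using assms(5) by (rule tlift_cong[OF refl])
  finally show ?thesis .
qed

section \<open>The maps \<open>f \<otimes> g\<close>, associator and interchange in terms of
  \<open>tlift\<close>\<close>

lemma tensor_map_tlift:
  assumes "module K A" "module K B" "module K C" "module K D"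
    and "linear_map K A C f" "linear_map K B D g" "t \<in> carrier (tensor_module K A B)"
  shows "tensor_map K C D f g t =
    tlift K A B (tensor_module K C D) (\<lambda>a b. pure_tensor K C D (f a) (g b)) t"
  unfolding tensor_map_def
  by (rule tensor_lift_tlift) (use assms in \<open>simp_all add: linear_mapD(1)[OF assms(5)] linear_mapD(1)[OF assms(6)]\<close>)

lemma tensor_assoc_tlift:
  assumes "module K A" "module K B" "module K C"
    and "t \<in> carrier (tensor_module K (tensor_module K A B) C)"
  shows "tensor_assoc K A B C t =
    tlift K (tensor_module K A B) C (tensor_module K A (tensor_module K B C))
      (\<lambda>s c. tlift K A B (tensor_module K A (tensor_module K B C))
        (\<lambda>a b. pure_tensor K A (tensor_module K B C) a (pure_tensor K B C b c)) s) t"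
  unfolding tensor_assoc_def Let_def
  by (rule tensor_lift_tliftI; (rule tensor_lift_tlift)?) (use assms in simp_all)

lemma tensor_swap_tlift:
  assumes "module K A" "module K B" "t \<in> carrier (tensor_module K A B)"
  shows "tensor_swap K A B t = tlift K A B (tensor_module K B A) (\<lambda>a b. pure_tensor K B A b a) t"
  unfolding tensor_swap_def by (rule tensor_lift_tlift) (use assms in simp_all)

section \<open>Scalars and products under lifted maps\<close>

lemma ground_module_sel [simp]:
  "carrier (ground_module K) = carrier K" "\<zero>\<^bsub>ground_module K\<^esub> = \<zero>\<^bsub>K\<^esub>"
  "add (ground_module K) = add K" "smult (ground_module K) = mult K"
  by (simp_all add: ground_module_def)

lemma ground_module_module [simp]: "cring K \<Longrightarrow> module K (ground_module K)"
proof -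
  assume "cring K"
  then interpret cring K .
  show ?thesis
    by (intro moduleI is_cring abelian_groupI)
      (auto simp: a_ac l_distr r_distr m_assoc intro: l_neg bexI[of _ "\<ominus>\<^bsub>K\<^esub> _"])
qed

lemma module_imp_cring: "module K A \<Longrightarrow> cring K"
  by (simp add: module_def)

lemma linear_ground_closed:
  "\<lbrakk>linear_map K X (ground_module K) g; x \<in> carrier X\<rbrakk> \<Longrightarrow> g x \<in> carrier K"
  using linear_mapD(1) by fastforce

lemma linear_smult [simp]:
  assumes "module K A"
  shows "\<lbrakk>linear_map K X (ground_module K) g; v \<in> carrier A\<rbrakk> \<Longrightarrow> linear_map K X A (\<lambda>x. g x \<odot>\<^bsub>A\<^esub> v)"
    and "\<lbrakk>linear_map K X A h; c \<in> carrier K\<rbrakk> \<Longrightarrow> linear_map K X A (\<lambda>x. c \<odot>\<^bsub>A\<^esub> h x)"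
proof -
  interpret A: module K A by fact
  show "\<lbrakk>linear_map K X (ground_module K) g; v \<in> carrier A\<rbrakk> \<Longrightarrow> linear_map K X A (\<lambda>x. g x \<odot>\<^bsub>A\<^esub> v)"
    by (auto intro!: linear_mapI simp: linear_mapD A.smult_l_distr A.smult_assoc1 linear_ground_closed)
  show "\<lbrakk>linear_map K X A h; c \<in> carrier K\<rbrakk> \<Longrightarrow> linear_map K X A (\<lambda>x. c \<odot>\<^bsub>A\<^esub> h x)"
    by (auto intro!: linear_mapI simp: linear_mapD A.smult_r_distr A.m_comm simp flip: A.smult_assoc1)
qed

lemma linear_ground_mult [simp]:
  assumes "cring K"
  shows "\<lbrakk>linear_map K X (ground_module K) g; c \<in> carrier K\<rbrakk> \<Longrightarrow>
      linear_map K X (ground_module K) (\<lambda>x. g x \<otimes>\<^bsub>K\<^esub> c)"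
    and "\<lbrakk>linear_map K X (ground_module K) g; c \<in> carrier K\<rbrakk> \<Longrightarrow>
      linear_map K X (ground_module K) (\<lambda>x. c \<otimes>\<^bsub>K\<^esub> g x)"
  using linear_smult[OF ground_module_module[OF assms], unfolded ground_module_sel] by auto

lemma linear_mult [simp]:
  assumes "assoc_algebra K A"
  shows "\<lbrakk>linear_map K X A g; a \<in> carrier A\<rbrakk> \<Longrightarrow> linear_map K X A (\<lambda>x. g x \<otimes>\<^bsub>A\<^esub> a)"
    and "\<lbrakk>linear_map K X A g; a \<in> carrier A\<rbrakk> \<Longrightarrow> linear_map K X A (\<lambda>x. a \<otimes>\<^bsub>A\<^esub> g x)"
proof -
  interpret A: assoc_algebra K A by fact
  show "\<lbrakk>linear_map K X A g; a \<in> carrier A\<rbrakk> \<Longrightarrow> linear_map K X A (\<lambda>x. g x \<otimes>\<^bsub>A\<^esub> a)"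
    by (auto intro!: linear_mapI simp: linear_mapD A.l_distr A.smult_mult_left dest: linear_mapD)
  show "\<lbrakk>linear_map K X A g; a \<in> carrier A\<rbrakk> \<Longrightarrow> linear_map K X A (\<lambda>x. a \<otimes>\<^bsub>A\<^esub> g x)"
    by (auto intro!: linear_mapI simp: linear_mapD A.r_distr A.smult_mult_right dest: linear_mapD)
qed

lemma pure_smult [simp]:
  assumes "module K A" "module K B" "c \<in> carrier K" "a \<in> carrier A" "b \<in> carrier B"
  shows "pure_tensor K A B (c \<odot>\<^bsub>A\<^esub> a) b = c \<odot>\<^bsub>tensor_module K A B\<^esub> pure_tensor K A B a b"
    and "pure_tensor K A B a (c \<odot>\<^bsub>B\<^esub> b) = c \<odot>\<^bsub>tensor_module K A B\<^esub> pure_tensor K A B a b"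
proof -
  interpret module_pair K A B using assms by (simp add: module_pair_def)
  show "pure_tensor K A B (c \<odot>\<^bsub>A\<^esub> a) b = c \<odot>\<^bsub>tensor_module K A B\<^esub> pure_tensor K A B a b"
    and "pure_tensor K A B a (c \<odot>\<^bsub>B\<^esub> b) = c \<odot>\<^bsub>tensor_module K A B\<^esub> pure_tensor K A B a b"
    using bilinear_mapD(4,5)[OF pure_tensor_bilinear] assms by auto
qed

lemma smult_tlift:
  assumes "module K A" "module K B" "module K C" "c \<in> carrier K"
    and "t \<in> carrier (tensor_module K A B)" "bilinear_map K A B C h"
  shows "c \<odot>\<^bsub>C\<^esub> tlift K A B C h t = tlift K A B C (\<lambda>a b. c \<odot>\<^bsub>C\<^esub> h a b) t"
  by (rule tlift_push[where \<phi> = "\<lambda>x. c \<odot>\<^bsub>C\<^esub> x" and D = C]) (use assms in \<open>simp_all del: bilinear_map_def\<close>)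

lemma mult_tlift [simp]:
  assumes "assoc_algebra K C" "module K C" "module K A" "module K B" "c \<in> carrier C"
    and "t \<in> carrier (tensor_module K A B)" "bilinear_map K A B C h"
  shows "c \<otimes>\<^bsub>C\<^esub> tlift K A B C h t = tlift K A B C (\<lambda>a b. c \<otimes>\<^bsub>C\<^esub> h a b) t"
    and "tlift K A B C h t \<otimes>\<^bsub>C\<^esub> c = tlift K A B C (\<lambda>a b. h a b \<otimes>\<^bsub>C\<^esub> c) t"
  by (rule tlift_push[where \<phi> = "\<lambda>x. c \<otimes>\<^bsub>C\<^esub> x" and D = C], use assms in \<open>simp_all del: bilinear_map_def\<close>)
    (rule tlift_push[where \<phi> = "\<lambda>x. x \<otimes>\<^bsub>C\<^esub> c" and D = C], use assms in \<open>simp_all del: bilinear_map_def\<close>)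

definition trilinear_map ::
    "('k, 'm) ring_scheme \<Rightarrow> ('k, 'a, 'n) module_scheme \<Rightarrow> ('k, 'b, 'p) module_scheme
      \<Rightarrow> ('k, 'c, 'q) module_scheme \<Rightarrow> ('k, 'd, 'r) module_scheme \<Rightarrow> ('a \<Rightarrow> 'b \<Rightarrow> 'c \<Rightarrow> 'd) \<Rightarrow> bool" where
  trilinear_map_def [simp]: "trilinear_map K A B C D h \<longleftrightarrow>
    (\<forall>a\<in>carrier A. \<forall>b\<in>carrier B. linear_map K C D (h a b)) \<and>
    (\<forall>a\<in>carrier A. \<forall>c\<in>carrier C. linear_map K B D (\<lambda>b. h a b c)) \<and>
    (\<forall>b\<in>carrier B. \<forall>c\<in>carrier C. linear_map K A D (\<lambda>a. h a b c))"

lemma trilinear_map_weak_cong [cong]: "trilinear_map K A B C D h = trilinear_map K A B C D h" ..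

lemma trilinear_mapD:
  assumes "trilinear_map K A B C D F"
  shows "\<lbrakk>linear_map K X A f; b \<in> carrier B; c \<in> carrier C\<rbrakk> \<Longrightarrow> linear_map K X D (\<lambda>x. F (f x) b c)"
    and "\<lbrakk>linear_map K X B g; a \<in> carrier A; c \<in> carrier C\<rbrakk> \<Longrightarrow> linear_map K X D (\<lambda>x. F a (g x) c)"
    and "\<lbrakk>linear_map K X C h; a \<in> carrier A; b \<in> carrier B\<rbrakk> \<Longrightarrow> linear_map K X D (\<lambda>x. F a b (h x))"
    and "\<lbrakk>a \<in> carrier A; b \<in> carrier B; c \<in> carrier C\<rbrakk> \<Longrightarrow> F a b c \<in> carrier D"
proof -
  show "linear_map K X D (\<lambda>x. F (f x) b c)" if "linear_map K X A f" "b \<in> carrier B" "c \<in> carrier C"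
    by (rule linear_map_comp[of _ A D "\<lambda>a. F a b c"]) (use that assms in auto)
  show "linear_map K X D (\<lambda>x. F a (g x) c)" if "linear_map K X B g" "a \<in> carrier A" "c \<in> carrier C"
    by (rule linear_map_comp[of _ B D "\<lambda>b. F a b c"]) (use that assms in auto)
  show "linear_map K X D (\<lambda>x. F a b (h x))" if "linear_map K X C h" "a \<in> carrier A" "b \<in> carrier B"
    by (rule linear_map_comp[of _ C D "F a b"]) (use that assms in auto)
  show "F a b c \<in> carrier D" if "a \<in> carrier A" "b \<in> carrier B" "c \<in> carrier C"
    by (rule linear_mapD(1)[of K C D "F a b"]) (use that assms in auto)
qed

section \<open>The coalgebra laws as rules for Sweedler sums\<close>

lemma coalgebra_module [simp]: "coalgebra K A \<Longrightarrow> module K A"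
  by (simp add: coalgebra_def)

lemma linear_comult [simp]:
  "\<lbrakk>coalgebra K A; linear_map K X A g\<rbrakk> \<Longrightarrow>
    linear_map K X (tensor_module K A A) (\<lambda>x. comult A (g x))"
  by (rule linear_map_comp[OF coalgebra.comult_linear])

lemma linear_counit [simp]:
  "\<lbrakk>coalgebra K A; linear_map K X A g\<rbrakk> \<Longrightarrow> linear_map K X (ground_module K) (\<lambda>x. counit A (g x))"
  by (rule linear_map_comp[OF coalgebra.counit_linear])

lemma comult_closed [simp]:
  "\<lbrakk>coalgebra K A; x \<in> carrier A\<rbrakk> \<Longrightarrow> comult A x \<in> carrier (tensor_module K A A)"
  by (rule linear_mapD(1)[OF coalgebra.comult_linear])

lemma counit_closed [simp]:
  "\<lbrakk>coalgebra K A; x \<in> carrier A\<rbrakk> \<Longrightarrow> counit A x \<in> carrier K"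
  using linear_mapD(1)[OF coalgebra.counit_linear] by fastforce

lemma coalgebraI:
  assumes [simp]: "module K A" "linear_map K A (tensor_module K A A) (comult A)"
    "linear_map K A (ground_module K) (counit A)"
    and coassoc: "\<And>x. x \<in> carrier A \<Longrightarrow>
      tlift K A A (tensor_module K A (tensor_module K A A))
        (\<lambda>a b. tlift K A A (tensor_module K A (tensor_module K A A))
          (\<lambda>a\<^sub>1 a\<^sub>2. pure_tensor K A (tensor_module K A A) a\<^sub>1 (pure_tensor K A A a\<^sub>2 b)) (comult A a))
        (comult A x) =
      tlift K A A (tensor_module K A (tensor_module K A A))
        (\<lambda>a b. pure_tensor K A (tensor_module K A A) a (comult A b)) (comult A x)"
    and counit: "\<And>x. x \<in> carrier A \<Longrightarrow> tlift K A A A (\<lambda>a b. counit A a \<odot>\<^bsub>A\<^esub> b) (comult A x) = x"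
      "\<And>x. x \<in> carrier A \<Longrightarrow> tlift K A A A (\<lambda>a b. counit A b \<odot>\<^bsub>A\<^esub> a) (comult A x) = x"
  shows "coalgebra K A"
proof -
  have [simp]: "linear_map K X (tensor_module K A A) (\<lambda>x. comult A (g x))"
    "linear_map K X (ground_module K) (\<lambda>x. counit A (g x))" if "linear_map K X A g" for X :: "(_, 'x, 'xx) module_scheme" and g
    using that by (auto intro: linear_map_comp[where A = A])
  have [simp]: "comult A x \<in> carrier (tensor_module K A A)" "counit A x \<in> carrier K" if "x \<in> carrier A" for x
    using that linear_mapD(1)[OF assms(2)] linear_mapD(1)[OF assms(3)] by auto
  have [simp]: "cring K" using assms(1) by (rule module_imp_cring)
  show ?thesis
  proof (rule coalgebra.intro, fact assms(1), unfold_locales)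
    fix x assume x: "x \<in> carrier A"
    show "tensor_assoc K A A A (tensor_map K (tensor_module K A A) A (comult A) id (comult A x)) =
        tensor_map K A (tensor_module K A A) id (comult A) (comult A x)"
      using x coassoc[OF x] by (simp add: tensor_map_tlift[where A = A and B = A] tensor_assoc_tlift)
    show "tensor_lift K A (\<lambda>a b. counit A a \<odot>\<^bsub>A\<^esub> b) (comult A x) = x"
      using x counit(1)[OF x] by (subst tensor_lift_tlift[where A = A and B = A]) simp_all
    show "tensor_lift K A (\<lambda>a b. counit A b \<odot>\<^bsub>A\<^esub> a) (comult A x) = x"
      using x counit(2)[OF x] by (subst tensor_lift_tlift[where A = A and B = A]) simp_all
  qed fact+
qed

text \<open>The axiom is an equation in \<open>A \<otimes> (A \<otimes> A)\<close>. Applying to both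
  sides the linear map induced by \<open>F\<close> turns it into a rule for an arbitrary trilinear
  summand and target.\<close>

lemma coassoc_tlift [simp]:
  assumes "coalgebra K A" "module K D" "x \<in> carrier A" "trilinear_map K A A A D F"
  shows "tlift K A A D (\<lambda>a b. tlift K A A D (\<lambda>a\<^sub>1 a\<^sub>2. F a\<^sub>1 a\<^sub>2 b) (comult A a)) (comult A x) =
    tlift K A A D (\<lambda>a b. tlift K A A D (F a) (comult A b)) (comult A x)"
proof -
  interpret A: coalgebra K A by fact
  let ?T = "tensor_module K A (tensor_module K A A)"
  note [simp] = assms A.module_axioms
  note [simp] = trilinear_mapD[OF assms(4)]
  have "tensor_assoc K A A A (tensor_map K (tensor_module K A A) A (comult A) id (comult A x)) =
    tlift K A A ?T (\<lambda>a b. tlift K A A ?T (\<lambda>a\<^sub>1 a\<^sub>2. pure_tensor K A (tensor_module K A A) a\<^sub>1 (pure_tensor K A A a\<^sub>2 b)) (comult A a)) (comult A x)"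
    by (simp add: tensor_map_tlift[where A = A and B = A] tensor_assoc_tlift A.comult_linear del: trilinear_map_def)
  moreover have "tensor_map K A (tensor_module K A A) id (comult A) (comult A x) =
    tlift K A A ?T (\<lambda>a b. pure_tensor K A (tensor_module K A A) a (comult A b)) (comult A x)"
    by (simp add: tensor_map_tlift[where A = A and B = A] A.comult_linear del: trilinear_map_def)
  ultimately have eq: "tlift K A A ?T (\<lambda>a b. tlift K A A ?T (\<lambda>a\<^sub>1 a\<^sub>2. pure_tensor K A (tensor_module K A A) a\<^sub>1 (pure_tensor K A A a\<^sub>2 b)) (comult A a)) (comult A x)
      = tlift K A A ?T (\<lambda>a b. pure_tensor K A (tensor_module K A A) a (comult A b)) (comult A x)"
    using A.coassoc[OF assms(3)] by simp
  have "tlift K A (tensor_module K A A) D (\<lambda>a. tlift K A A D (F a))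
      (tlift K A A ?T (\<lambda>a b. tlift K A A ?T (\<lambda>a\<^sub>1 a\<^sub>2. pure_tensor K A (tensor_module K A A) a\<^sub>1 (pure_tensor K A A a\<^sub>2 b)) (comult A a)) (comult A x))
    = tlift K A (tensor_module K A A) D (\<lambda>a. tlift K A A D (F a))
      (tlift K A A ?T (\<lambda>a b. pure_tensor K A (tensor_module K A A) a (comult A b)) (comult A x))"
    by (simp only: eq)
  then show ?thesis
    by (simp add: tlift_linear del: trilinear_map_def)
qed

text \<open>Obtained by applying \<open>F\<close> to the counit axiom and moving it under the
  sum.\<close>

lemma counit_left_tlift [simp]:
  assumes "coalgebra K A" "module K D" "x \<in> carrier A" "linear_map K A D F"
  shows "tlift K A A D (\<lambda>a b. counit A a \<odot>\<^bsub>D\<^esub> F b) (comult A x) = F x"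
proof -
  interpret A: coalgebra K A by fact
  note [simp] = assms A.module_axioms linear_mapD[OF assms(4)] linear_map_comp[OF assms(4)]
  have "F x = F (tensor_lift K A (\<lambda>a b. counit A a \<odot>\<^bsub>A\<^esub> b) (comult A x))"
    by (simp add: A.counit_left)
  also have "\<dots> = F (tlift K A A A (\<lambda>a b. counit A a \<odot>\<^bsub>A\<^esub> b) (comult A x))"
    by (subst tensor_lift_tlift[where A = A and B = A]) simp_all
  also have "\<dots> = tlift K A A D (\<lambda>a b. F (counit A a \<odot>\<^bsub>A\<^esub> b)) (comult A x)"
    by (rule tlift_push[OF assms(4)]) simp_all
  finally show ?thesis by simp
qed

lemma counit_right_tlift [simp]:
  assumes "coalgebra K A" "module K D" "x \<in> carrier A" "linear_map K A D F"
  shows "tlift K A A D (\<lambda>a b. counit A b \<odot>\<^bsub>D\<^esub> F a) (comult A x) = F x"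
proof -
  interpret A: coalgebra K A by fact
  note [simp] = assms A.module_axioms linear_mapD[OF assms(4)] linear_map_comp[OF assms(4)]
  have "F x = F (tensor_lift K A (\<lambda>a b. counit A b \<odot>\<^bsub>A\<^esub> a) (comult A x))"
    by (simp add: A.counit_right)
  also have "\<dots> = F (tlift K A A A (\<lambda>a b. counit A b \<odot>\<^bsub>A\<^esub> a) (comult A x))"
    by (subst tensor_lift_tlift[where A = A and B = A]) simp_all
  also have "\<dots> = tlift K A A D (\<lambda>a b. F (counit A b \<odot>\<^bsub>A\<^esub> a)) (comult A x)"
    by (rule tlift_push[OF assms(4)]) simp_all
  finally show ?thesis by simp
qed

section \<open>Tensor products of algebras\<close>

text \<open>
  Algebras and Hopf algebras are used as modules through different records with the same module
  fields; the rules below replace such a record by its underlying module.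
\<close>

definition same_module ::
    "('k, 'a, 'n) module_scheme \<Rightarrow> ('k, 'a, 'p) module_scheme \<Rightarrow> bool" where
  "same_module M M' \<longleftrightarrow>
    carrier M = carrier M' \<and> zero M = zero M' \<and> add M = add M' \<and> smult M = smult M'"

lemma same_module_sel:
  assumes "same_module M M'"
  shows "carrier M = carrier M'" "zero M = zero M'" "add M = add M'" "smult M = smult M'"
  using assms by (auto simp: same_module_def)

lemma same_module_imp_module:
  assumes "same_module M M'" "module K M'"
  shows "module K M"
proof -
  interpret M': module K M' by fact
  note [simp] = same_module_sel[OF assms(1)]
  show ?thesis
  proof (rule moduleI[OF M'.is_cring])
    show "abelian_group M"
    proof (rule abelian_groupI)
      show "\<exists>y\<in>carrier M. y \<oplus>\<^bsub>M\<^esub> x = \<zero>\<^bsub>M\<^esub>" if "x \<in> carrier M" for x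
        using that M'.l_neg by auto
    qed (auto simp: M'.a_ac)
  qed (auto simp: M'.smult_l_distr M'.smult_r_distr M'.smult_assoc1)
qed

lemma same_module_finsum:
  assumes "same_module M M'"
  shows "finsum M f X = finsum M' f X"
  by (simp add: finsum_def finprod_def same_module_sel[OF assms])

lemma same_module_rules:
  assumes M: "same_module M M'"
  shows "tensor_module K M X = tensor_module K M' X"
    and "tensor_module K X M = tensor_module K X M'"
    and "pure_tensor K M X = pure_tensor K M' X"
    and "pure_tensor K X M = pure_tensor K X M'"
    and "linear_map K M X = linear_map K M' X"
    and "linear_map K X M = linear_map K X M'"
    and "tlift K M X Y = tlift K M' X Y"
    and "tlift K X M Y = tlift K X M' Y"
    and "tlift K X Y M = tlift K X Y M'"
    and "module K M = module K M'"
    and "bilinear_map K M X Y = bilinear_map K M' X Y"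
    and "bilinear_map K X M Y = bilinear_map K X M' Y"
    and "bilinear_map K X Y M = bilinear_map K X Y M'"
proof -
  note sel = same_module_sel[OF M]
  have "bilinear_relations K M X = bilinear_relations K M' X"
    "bilinear_relations K X M = bilinear_relations K X M'"
    unfolding bilinear_relations_def sel by simp_all
  then have "tensor_null K M X = tensor_null K M' X" "tensor_null K X M = tensor_null K X M'"
    unfolding tensor_null_def sel by simp_all
  then show "tensor_module K M X = tensor_module K M' X" "tensor_module K X M = tensor_module K X M'"
    "pure_tensor K M X = pure_tensor K M' X" "pure_tensor K X M = pure_tensor K X M'"
    unfolding tensor_module_def pure_tensor_def sel by simp_all
  show lin: "linear_map K M X = linear_map K M' X" "linear_map K X M = linear_map K X M'"
    unfolding linear_map_def sel by simp_all
  show "tlift K M X Y = tlift K M' X Y" "tlift K X M Y = tlift K X M' Y"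
    unfolding tlift_def sel by simp_all
  show "tlift K X Y M = tlift K X Y M'"
    unfolding tlift_def tensor_lift_def sel same_module_finsum[OF M] by simp
  have "same_module M' M" using M by (simp add: same_module_def)
  with M show "module K M = module K M'"
    by (auto intro: same_module_imp_module[where M = M and M' = M'] same_module_imp_module[where M = M' and M' = M])
  show "bilinear_map K M X Y = bilinear_map K M' X Y" "bilinear_map K X M Y = bilinear_map K X M' Y"
    "bilinear_map K X Y M = bilinear_map K X Y M'"
    unfolding bilinear_map_def linear_map_def sel by simp_all
qed

text \<open>For identities that involve the product of two tensors: each argument is reduced to pure
  tensors while the other is kept fixed.\<close>

lemma tensor_ext2:
  assumes "module K A" "module K B" "module K A'" "module K B'"
    and \<phi>: "bilinear_map K (tensor_module K A B) (tensor_module K A' B') C \<phi>"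
    and \<psi>: "bilinear_map K (tensor_module K A B) (tensor_module K A' B') C \<psi>"
    and eq: "\<And>a b a' b'. \<lbrakk>a \<in> carrier A; b \<in> carrier B; a' \<in> carrier A'; b' \<in> carrier B'\<rbrakk> \<Longrightarrow>
      \<phi> (pure_tensor K A B a b) (pure_tensor K A' B' a' b') = \<psi> (pure_tensor K A B a b) (pure_tensor K A' B' a' b')"
    and "s \<in> carrier (tensor_module K A B)" "t \<in> carrier (tensor_module K A' B')"
  shows "\<phi> s t = \<psi> s t"
proof (rule tensor_ext[OF assms(1,2), where C = C and \<phi> = "\<lambda>s. \<phi> s t" and \<psi> = "\<lambda>s. \<psi> s t"])
  fix a b assume ab: "a \<in> carrier A" "b \<in> carrier B"
  show "\<phi> (pure_tensor K A B a b) t = \<psi> (pure_tensor K A B a b) t"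
    by (rule tensor_ext[OF assms(3,4), where C = C and \<phi> = "\<phi> (pure_tensor K A B a b)"
          and \<psi> = "\<psi> (pure_tensor K A B a b)"])
      (use assms ab in simp_all)
qed (use assms in simp_all)

lemma assoc_algebra_module [simp]: "assoc_algebra K A \<Longrightarrow> module K A"
  by (simp add: assoc_algebra_def)

lemma assoc_algebra_simps:
  assumes "assoc_algebra K A"
  shows "\<lbrakk>x \<in> carrier A; y \<in> carrier A\<rbrakk> \<Longrightarrow> x \<otimes>\<^bsub>A\<^esub> y \<in> carrier A"
    and "\<one>\<^bsub>A\<^esub> \<in> carrier A"
    and "x \<in> carrier A \<Longrightarrow> \<one>\<^bsub>A\<^esub> \<otimes>\<^bsub>A\<^esub> x = x"
    and "x \<in> carrier A \<Longrightarrow> x \<otimes>\<^bsub>A\<^esub> \<one>\<^bsub>A\<^esub> = x"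
    and "\<lbrakk>x \<in> carrier A; y \<in> carrier A; z \<in> carrier A\<rbrakk> \<Longrightarrow> (x \<otimes>\<^bsub>A\<^esub> y) \<otimes>\<^bsub>A\<^esub> z = x \<otimes>\<^bsub>A\<^esub> (y \<otimes>\<^bsub>A\<^esub> z)"
    and "\<lbrakk>c \<in> carrier K; x \<in> carrier A; y \<in> carrier A\<rbrakk> \<Longrightarrow> (c \<odot>\<^bsub>A\<^esub> x) \<otimes>\<^bsub>A\<^esub> y = c \<odot>\<^bsub>A\<^esub> (x \<otimes>\<^bsub>A\<^esub> y)"
    and "\<lbrakk>c \<in> carrier K; x \<in> carrier A; y \<in> carrier A\<rbrakk> \<Longrightarrow> x \<otimes>\<^bsub>A\<^esub> (c \<odot>\<^bsub>A\<^esub> y) = c \<odot>\<^bsub>A\<^esub> (x \<otimes>\<^bsub>A\<^esub> y)"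
proof -
  interpret A: assoc_algebra K A by fact
  show "\<lbrakk>x \<in> carrier A; y \<in> carrier A\<rbrakk> \<Longrightarrow> x \<otimes>\<^bsub>A\<^esub> y \<in> carrier A"
    and "\<one>\<^bsub>A\<^esub> \<in> carrier A"
    and "x \<in> carrier A \<Longrightarrow> \<one>\<^bsub>A\<^esub> \<otimes>\<^bsub>A\<^esub> x = x"
    and "x \<in> carrier A \<Longrightarrow> x \<otimes>\<^bsub>A\<^esub> \<one>\<^bsub>A\<^esub> = x"
    and "\<lbrakk>x \<in> carrier A; y \<in> carrier A; z \<in> carrier A\<rbrakk> \<Longrightarrow> (x \<otimes>\<^bsub>A\<^esub> y) \<otimes>\<^bsub>A\<^esub> z = x \<otimes>\<^bsub>A\<^esub> (y \<otimes>\<^bsub>A\<^esub> z)"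
    and "\<lbrakk>c \<in> carrier K; x \<in> carrier A; y \<in> carrier A\<rbrakk> \<Longrightarrow> (c \<odot>\<^bsub>A\<^esub> x) \<otimes>\<^bsub>A\<^esub> y = c \<odot>\<^bsub>A\<^esub> (x \<otimes>\<^bsub>A\<^esub> y)"
    and "\<lbrakk>c \<in> carrier K; x \<in> carrier A; y \<in> carrier A\<rbrakk> \<Longrightarrow> x \<otimes>\<^bsub>A\<^esub> (c \<odot>\<^bsub>A\<^esub> y) = c \<odot>\<^bsub>A\<^esub> (x \<otimes>\<^bsub>A\<^esub> y)"
    by (simp_all add: A.m_assoc A.smult_mult_left A.smult_mult_right)
qed

lemma same_tensor_algebra: "same_module (tensor_algebra K A B) (tensor_module K A B)"
  by (simp add: same_module_def tensor_algebra_def Let_def)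

lemmas tensor_algebra_rules [simp] =
  same_module_sel[OF same_tensor_algebra] same_module_rules[OF same_tensor_algebra]

lemma tensor_algebra_one [simp]: "\<one>\<^bsub>tensor_algebra K A B\<^esub> = pure_tensor K A B \<one>\<^bsub>A\<^esub> \<one>\<^bsub>B\<^esub>"
  by (simp add: tensor_algebra_def Let_def)

lemma tensor_algebra_mult [simp]:
  assumes "assoc_algebra K A" "assoc_algebra K B"
    and "x \<in> carrier (tensor_module K A B)" "y \<in> carrier (tensor_module K A B)"
  shows "x \<otimes>\<^bsub>tensor_algebra K A B\<^esub> y =
    tlift K A B (tensor_module K A B) (\<lambda>a b. tlift K A B (tensor_module K A B)
      (\<lambda>a' b'. pure_tensor K A B (a \<otimes>\<^bsub>A\<^esub> a') (b \<otimes>\<^bsub>B\<^esub> b')) y) x"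
proof -
  have "x \<otimes>\<^bsub>tensor_algebra K A B\<^esub> y =
    tensor_lift K (tensor_module K A B) (\<lambda>a b. tensor_lift K (tensor_module K A B)
      (\<lambda>a' b'. pure_tensor K A B (a \<otimes>\<^bsub>A\<^esub> a') (b \<otimes>\<^bsub>B\<^esub> b')) y) x"
    by (simp add: tensor_algebra_def Let_def)
  also have "\<dots> = tlift K A B (tensor_module K A B) (\<lambda>a b. tlift K A B (tensor_module K A B)
      (\<lambda>a' b'. pure_tensor K A B (a \<otimes>\<^bsub>A\<^esub> a') (b \<otimes>\<^bsub>B\<^esub> b')) y) x"
    by (rule tensor_lift_tliftI; (rule tensor_lift_tlift)?)
      (use assms in \<open>simp_all add: assoc_algebra_simps[OF assms(1)] assoc_algebra_simps[OF assms(2)]\<close>)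
  finally show ?thesis .
qed

lemma tensor_algebra_assoc_algebra [simp]:
  assumes [simp]: "assoc_algebra K A" "assoc_algebra K B"
  shows "assoc_algebra K (tensor_algebra K A B)"
proof -
  let ?T = "tensor_module K A B"
  let ?R = "tensor_algebra K A B"
  note [simp] = assoc_algebra_simps[OF assms(1)] assoc_algebra_simps[OF assms(2)]
  have mod: "module K ?R" by simp
  interpret R: module K ?R by (rule mod)
  let ?mul = "\<lambda>x y. tlift K A B ?T (\<lambda>a b. tlift K A B ?T
      (\<lambda>a' b'. pure_tensor K A B (a \<otimes>\<^bsub>A\<^esub> a') (b \<otimes>\<^bsub>B\<^esub> b')) y) x"
  have mul: "x \<otimes>\<^bsub>?R\<^esub> y = ?mul x y" if "x \<in> carrier ?T" "y \<in> carrier ?T" for x y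
    using that by simp
  have lin1: "linear_map K ?T ?T (\<lambda>x. ?mul x y)" if "y \<in> carrier ?T" for y
    using that by simp
  have lin2: "linear_map K ?T ?T (\<lambda>y. ?mul x y)" if "x \<in> carrier ?T" for x
    using that by simp
  have assoc: "?mul (?mul x y) z = ?mul x (?mul y z)" if "x \<in> carrier ?T" "y \<in> carrier ?T" "z \<in> carrier ?T" for x y z
  \<comment> \<open>Associativity is an identity in three tensors: \<open>z\<close> is made pure
    first, then \<open>tensor_ext2\<close> treats \<open>x\<close> and \<open>y\<close>
    together.\<close>
  proof (rule tensor_ext[where K = K and A = A and B = B and C = ?T and \<phi> = "\<lambda>z. ?mul (?mul x y) z"])
    fix e f assume ef [simp]: "e \<in> carrier A" "f \<in> carrier B"
    show "?mul (?mul x y) (pure_tensor K A B e f) = ?mul x (?mul y (pure_tensor K A B e f))"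
      by (rule tensor_ext2[where K = K and A = A and B = B and A' = A and B' = B and C = ?T and s = x and t = y])
        (use that in simp_all)
  qed (use that in simp_all)
  have one: "?mul (pure_tensor K A B \<one>\<^bsub>A\<^esub> \<one>\<^bsub>B\<^esub>) x = x" "?mul x (pure_tensor K A B \<one>\<^bsub>A\<^esub> \<one>\<^bsub>B\<^esub>) = x" if "x \<in> carrier ?T" for x
    using that by (simp_all cong: if_cong)
  have "ring ?R"
  proof (rule ringI)
    show "abelian_group ?R" by unfold_locales
    show "monoid ?R"
    proof (rule monoidI)
      fix x y z assume *: "x \<in> carrier ?R" "y \<in> carrier ?R" "z \<in> carrier ?R"
      then show "x \<otimes>\<^bsub>?R\<^esub> y \<in> carrier ?R" by simp
      show "x \<otimes>\<^bsub>?R\<^esub> y \<otimes>\<^bsub>?R\<^esub> z = x \<otimes>\<^bsub>?R\<^esub> (y \<otimes>\<^bsub>?R\<^esub> z)"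
        using assoc[of x y z] * linear_mapD(1)[OF lin1] by (simp only: mul tensor_algebra_rules)
      show "\<one>\<^bsub>?R\<^esub> \<otimes>\<^bsub>?R\<^esub> x = x" "x \<otimes>\<^bsub>?R\<^esub> \<one>\<^bsub>?R\<^esub> = x"
        using one[of x] * by simp_all
    qed simp
  next
    fix x y z assume *: "x \<in> carrier ?R" "y \<in> carrier ?R" "z \<in> carrier ?R"
    then have cl: "x \<oplus>\<^bsub>?R\<^esub> y \<in> carrier ?R" by (intro R.a_closed)
    show "(x \<oplus>\<^bsub>?R\<^esub> y) \<otimes>\<^bsub>?R\<^esub> z = x \<otimes>\<^bsub>?R\<^esub> z \<oplus>\<^bsub>?R\<^esub> y \<otimes>\<^bsub>?R\<^esub> z"
      using * cl linear_mapD(2)[OF lin1, of z x y] by (simp only: mul tensor_algebra_rules)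
    show "z \<otimes>\<^bsub>?R\<^esub> (x \<oplus>\<^bsub>?R\<^esub> y) = z \<otimes>\<^bsub>?R\<^esub> x \<oplus>\<^bsub>?R\<^esub> z \<otimes>\<^bsub>?R\<^esub> y"
      using * cl linear_mapD(2)[OF lin2, of z x y] by (simp only: mul tensor_algebra_rules)
  qed
  moreover have "assoc_algebra_axioms K ?R"
  proof
    fix c x y assume *: "c \<in> carrier K" "x \<in> carrier ?R" "y \<in> carrier ?R"
    then have cl: "c \<odot>\<^bsub>?R\<^esub> x \<in> carrier ?R" "c \<odot>\<^bsub>?R\<^esub> y \<in> carrier ?R" by (auto intro!: R.smult_closed simp del: tensor_algebra_rules)
    show "(c \<odot>\<^bsub>?R\<^esub> x) \<otimes>\<^bsub>?R\<^esub> y = c \<odot>\<^bsub>?R\<^esub> (x \<otimes>\<^bsub>?R\<^esub> y)"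
      using * cl linear_mapD(3)[OF lin1, of y c x] by (simp only: mul tensor_algebra_rules)
    show "x \<otimes>\<^bsub>?R\<^esub> (c \<odot>\<^bsub>?R\<^esub> y) = c \<odot>\<^bsub>?R\<^esub> (x \<otimes>\<^bsub>?R\<^esub> y)"
      using * cl linear_mapD(3)[OF lin2, of x c y] by (simp only: mul tensor_algebra_rules)
  qed
  ultimately show ?thesis
    using mod by (simp add: assoc_algebra_def)
qed

section \<open>Tensor products of Hopf algebras\<close>

lemma bialgebra_coalgebra [simp]: "bialgebra K A \<Longrightarrow> coalgebra K A"
  by (simp add: bialgebra_def)

lemma bialgebra_assoc_algebra [simp]: "bialgebra K A \<Longrightarrow> assoc_algebra K A"
  by (simp add: bialgebra_def)

lemma hopf_bialgebra [simp]: "cocomm_hopf_algebra K A \<Longrightarrow> bialgebra K A"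
  by (simp add: cocomm_hopf_algebra_def)

lemma hopf_field: "cocomm_hopf_algebra K A \<Longrightarrow> field K"
  by (simp add: cocomm_hopf_algebra_def)

lemma linear_antipode [simp]:
  "\<lbrakk>cocomm_hopf_algebra K A; linear_map K X A g\<rbrakk> \<Longrightarrow> linear_map K X A (\<lambda>x. antipode A (g x))"
  by (rule linear_map_comp[OF cocomm_hopf_algebra.antipode_linear])

lemma bialgebra_simps:
  assumes "bialgebra K A"
  shows "\<lbrakk>x \<in> carrier A; y \<in> carrier A\<rbrakk> \<Longrightarrow> counit A (x \<otimes>\<^bsub>A\<^esub> y) = counit A x \<otimes>\<^bsub>K\<^esub> counit A y"
    and "counit A \<one>\<^bsub>A\<^esub> = \<one>\<^bsub>K\<^esub>"
    and "comult A \<one>\<^bsub>A\<^esub> = pure_tensor K A A \<one>\<^bsub>A\<^esub> \<one>\<^bsub>A\<^esub>"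
  using assms bialgebra.counit_mult[OF assms] bialgebra.counit_one[OF assms]
    bialgebra.comult_one[OF assms] by simp_all

lemma antipode_closed:
  "\<lbrakk>cocomm_hopf_algebra K A; x \<in> carrier A\<rbrakk> \<Longrightarrow> antipode A x \<in> carrier A"
  by (rule linear_mapD(1)[OF cocomm_hopf_algebra.antipode_linear])

lemma counit_smult:
  "\<lbrakk>coalgebra K A; c \<in> carrier K; x \<in> carrier A\<rbrakk> \<Longrightarrow> counit A (c \<odot>\<^bsub>A\<^esub> x) = c \<otimes>\<^bsub>K\<^esub> counit A x"
  using linear_mapD(3)[OF coalgebra.counit_linear] by fastforce

lemmas hopf_simps =
  assoc_algebra_simps[OF bialgebra_assoc_algebra[OF hopf_bialgebra]]
  bialgebra_simps[OF hopf_bialgebra] antipode_closed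
  counit_closed[OF bialgebra_coalgebra[OF hopf_bialgebra]]
  module.smult_closed[OF coalgebra_module[OF bialgebra_coalgebra[OF hopf_bialgebra]]]

lemma comult_mult_tlift [simp]:
  assumes "bialgebra K A" "module K D" "x \<in> carrier A" "y \<in> carrier A" "bilinear_map K A A D F"
  shows "tlift K A A D F (comult A (x \<otimes>\<^bsub>A\<^esub> y)) =
    tlift K A A D (\<lambda>a b. tlift K A A D (\<lambda>a' b'. F (a \<otimes>\<^bsub>A\<^esub> a') (b \<otimes>\<^bsub>A\<^esub> b')) (comult A y)) (comult A x)"
proof -
  note [simp] = assms assoc_algebra_simps[OF bialgebra_assoc_algebra[OF assms(1)]]
    bilinear_mapD(1)[OF assms(5)]
  have [simp]: "linear_map K X D (\<lambda>x. F (g x) b)" "linear_map K X D (\<lambda>x. F b (g x))"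
    if "b \<in> carrier A" "linear_map K X A g" for b and X :: "(_, 'x, 'xx) module_scheme" and g
    by (rule linear_map_comp[of _ A _ "\<lambda>a. F a b"] linear_map_comp[of _ A _ "F b"];
        use that assms(5) in simp)+
  show ?thesis
    by (simp add: bialgebra.comult_mult[OF assms(1)])
qed

text \<open>Cocommutativity in Sweedler form. It would rewrite its own result back, so it is never a
  simp rule and each use is an explicit step.\<close>

lemma comult_swap_tlift:
  assumes "cocomm_hopf_algebra K A" "module K D" "x \<in> carrier A" "bilinear_map K A A D F"
  shows "tlift K A A D F (comult A x) = tlift K A A D (\<lambda>a b. F b a) (comult A x)"
proof -
  have "comult A x = tlift K A A (tensor_module K A A) (\<lambda>a b. pure_tensor K A A b a) (comult A x)"
    using cocomm_hopf_algebra.cocommutative[OF assms(1,3)] assms by (simp add: tensor_swap_tlift)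
  then have "tlift K A A D F (comult A x) =
      tlift K A A D F (tlift K A A (tensor_module K A A) (\<lambda>a b. pure_tensor K A A b a) (comult A x))"
    by simp
  also have "\<dots> = tlift K A A D (\<lambda>a b. F b a) (comult A x)"
    using assms by simp
  finally show ?thesis .
qed

lemma antipode_tlift:
  assumes "cocomm_hopf_algebra K A" "x \<in> carrier A"
  shows "tlift K A A A (\<lambda>a b. antipode A a \<otimes>\<^bsub>A\<^esub> b) (comult A x) = counit A x \<odot>\<^bsub>A\<^esub> \<one>\<^bsub>A\<^esub>"
    and "tlift K A A A (\<lambda>a b. a \<otimes>\<^bsub>A\<^esub> antipode A b) (comult A x) = counit A x \<odot>\<^bsub>A\<^esub> \<one>\<^bsub>A\<^esub>"
  using cocomm_hopf_algebra.antipode_left[OF assms] cocomm_hopf_algebra.antipode_right[OF assms] assms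
  by (simp_all add: tensor_lift_tlift[where A = A and B = A] antipode_closed)

lemma cocomm_hopf_algebraI:
  assumes "field K" and [simp]: "assoc_algebra K A" "coalgebra K A" "linear_map K A A (antipode A)"
    and mult: "\<And>x y. \<lbrakk>x \<in> carrier A; y \<in> carrier A\<rbrakk> \<Longrightarrow> comult A (x \<otimes>\<^bsub>A\<^esub> y) =
      tlift K A A (tensor_module K A A) (\<lambda>a b. tlift K A A (tensor_module K A A)
        (\<lambda>a' b'. pure_tensor K A A (a \<otimes>\<^bsub>A\<^esub> a') (b \<otimes>\<^bsub>A\<^esub> b')) (comult A y)) (comult A x)"
    and one: "comult A \<one>\<^bsub>A\<^esub> = pure_tensor K A A \<one>\<^bsub>A\<^esub> \<one>\<^bsub>A\<^esub>"
    and counit: "\<And>x y. \<lbrakk>x \<in> carrier A; y \<in> carrier A\<rbrakk> \<Longrightarrow> counit A (x \<otimes>\<^bsub>A\<^esub> y) = counit A x \<otimes>\<^bsub>K\<^esub> counit A y"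
      "counit A \<one>\<^bsub>A\<^esub> = \<one>\<^bsub>K\<^esub>"
    and antipode: "\<And>x. x \<in> carrier A \<Longrightarrow>
        tlift K A A A (\<lambda>a b. antipode A a \<otimes>\<^bsub>A\<^esub> b) (comult A x) = counit A x \<odot>\<^bsub>A\<^esub> \<one>\<^bsub>A\<^esub>"
      "\<And>x. x \<in> carrier A \<Longrightarrow>
        tlift K A A A (\<lambda>a b. a \<otimes>\<^bsub>A\<^esub> antipode A b) (comult A x) = counit A x \<odot>\<^bsub>A\<^esub> \<one>\<^bsub>A\<^esub>"
    and swap: "\<And>x. x \<in> carrier A \<Longrightarrow>
        tlift K A A (tensor_module K A A) (\<lambda>a b. pure_tensor K A A b a) (comult A x) = comult A x"
  shows "cocomm_hopf_algebra K A"
proof -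
  have [simp]: "linear_map K X A (\<lambda>x. antipode A (g x))" if "linear_map K X A g" for X :: "(_, 'x, 'xx) module_scheme" and g
    by (rule linear_map_comp[OF assms(4)]) fact
  note [simp] = linear_mapD(1)[OF assms(4)] assoc_algebra_simps[OF assms(2)]
  have bi: "bialgebra K A"
    by (intro bialgebra.intro bialgebra_axioms.intro assms(2,3))
      (simp_all add: mult one counit)
  show ?thesis
    by (intro cocomm_hopf_algebra.intro cocomm_hopf_algebra_axioms.intro assms(1,4) bi)
      (simp_all add: tensor_lift_tlift[where A = A and B = A] antipode swap tensor_swap_tlift)
qed

section \<open>Structure maps of the tensor product of two Hopf algebras\<close>

lemma module_extend_sel [simp]:
  "carrier (module.extend M x) = carrier M" "mult (module.extend M x) = mult M"
  "one (module.extend M x) = one M" "zero (module.extend M x) = zero M"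
  "add (module.extend M x) = add M" "smult (module.extend M x) = smult M"
  "comult (module.extend M \<lparr>comult = d, counit = e, antipode = s\<rparr>) = d"
  "counit (module.extend M \<lparr>comult = d, counit = e, antipode = s\<rparr>) = e"
  "antipode (module.extend M \<lparr>comult = d, counit = e, antipode = s\<rparr>) = s"
  by (simp_all add: module.defs)

lemma same_tensor_hopf: "same_module (tensor_hopf K A B) (tensor_module K A B)"
  by (simp add: same_module_def tensor_hopf_def tensor_algebra_def Let_def)

lemmas tensor_hopf_rules [simp] =
  same_module_sel[OF same_tensor_hopf] same_module_rules[OF same_tensor_hopf]

lemma tensor_hopf_one_mult [simp]:
  "\<one>\<^bsub>tensor_hopf K A B\<^esub> = pure_tensor K A B \<one>\<^bsub>A\<^esub> \<one>\<^bsub>B\<^esub>"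
  "mult (tensor_hopf K A B) = mult (tensor_algebra K A B)"
  by (simp_all add: tensor_hopf_def Let_def tensor_algebra_def)

lemma tensor_hopf_antipode [simp]:
  assumes "cocomm_hopf_algebra K A" "cocomm_hopf_algebra K B" "x \<in> carrier (tensor_module K A B)"
  shows "antipode (tensor_hopf K A B) x =
    tlift K A B (tensor_module K A B) (\<lambda>a b. pure_tensor K A B (antipode A a) (antipode B b)) x"
  using assms by (simp add: tensor_hopf_def Let_def tensor_map_tlift[where A = A and B = B])

lemma tensor_hopf_counit [simp]:
  assumes "coalgebra K A" "coalgebra K B" "x \<in> carrier (tensor_module K A B)"
  shows "counit (tensor_hopf K A B) x =
    tlift K A B (ground_module K) (\<lambda>a b. counit A a \<otimes>\<^bsub>K\<^esub> counit B b) x"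
  using assms module_imp_cring[OF coalgebra_module[OF assms(1)]]
  by (simp add: tensor_hopf_def Let_def tensor_lift_tlift[where A = A and B = B])

text \<open>The comultiplication of \<open>tensor_hopf\<close> in terms of \<open>tlift\<close>, as
  a constant of its own so that it stays folded on general tensors and is expanded by the simplifier
  on pure ones.\<close>

definition tensor_comult ::
    "('k, 'm) ring_scheme \<Rightarrow> ('k, 'a, 'n) hopf_scheme \<Rightarrow> ('k, 'b, 'p) hopf_scheme
      \<Rightarrow> ('a \<times> 'b \<Rightarrow> 'k) set \<Rightarrow> (('a \<times> 'b \<Rightarrow> 'k) set \<times> ('a \<times> 'b \<Rightarrow> 'k) set \<Rightarrow> 'k) set" where
  "tensor_comult K A B =
    (let T = tensor_module K A B; TT = tensor_module K T T in
      tlift K A B TT (\<lambda>a b. tlift K A A TT (\<lambda>a\<^sub>1 a\<^sub>2. tlift K B B TT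
        (\<lambda>b\<^sub>1 b\<^sub>2. pure_tensor K T T (pure_tensor K A B a\<^sub>1 b\<^sub>1) (pure_tensor K A B a\<^sub>2 b\<^sub>2))
        (comult B b)) (comult A a)))"

lemma linear_tensor_comult [simp]:
  assumes "coalgebra K A" "coalgebra K B" "linear_map K X (tensor_module K A B) g"
  shows "linear_map K X (tensor_module K (tensor_module K A B) (tensor_module K A B))
    (\<lambda>x. tensor_comult K A B (g x))"
  unfolding tensor_comult_def Let_def using assms by simp

lemma tensor_comult_closed [simp]:
  assumes "coalgebra K A" "coalgebra K B" "x \<in> carrier (tensor_module K A B)"
  shows "tensor_comult K A B x \<in> carrier (tensor_module K (tensor_module K A B) (tensor_module K A B))"
  using linear_mapD(1)[OF linear_tensor_comult[OF assms(1,2) linear_map_id(1)] assms(3)] .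

lemma tensor_comult_pure [simp]:
  assumes "coalgebra K A" "coalgebra K B" "a \<in> carrier A" "b \<in> carrier B"
  shows "tensor_comult K A B (pure_tensor K A B a b) =
    (let T = tensor_module K A B; TT = tensor_module K T T in
      tlift K A A TT (\<lambda>a\<^sub>1 a\<^sub>2. tlift K B B TT
        (\<lambda>b\<^sub>1 b\<^sub>2. pure_tensor K T T (pure_tensor K A B a\<^sub>1 b\<^sub>1) (pure_tensor K A B a\<^sub>2 b\<^sub>2))
        (comult B b)) (comult A a))"
  unfolding tensor_comult_def Let_def using assms by simp

lemma tensor_hopf_comult [simp]:
  assumes [simp]: "coalgebra K A" "coalgebra K B" and x: "x \<in> carrier (tensor_module K A B)"
  shows "comult (tensor_hopf K A B) x = tensor_comult K A B x"
proof -
  define T where "T = tensor_module K A B"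
  define TT where "TT = tensor_module K T T"
  have "comult (tensor_hopf K A B) x = tensor_lift K TT (\<lambda>a b.
      tensor_lift K TT (\<lambda>a\<^sub>1 a\<^sub>2. tensor_lift K TT
        (\<lambda>b\<^sub>1 b\<^sub>2. pure_tensor K T T (pure_tensor K A B a\<^sub>1 b\<^sub>1) (pure_tensor K A B a\<^sub>2 b\<^sub>2))
        (comult B b)) (comult A a)) x"
    by (simp add: tensor_hopf_def Let_def T_def TT_def)
  also have "\<dots> = tensor_comult K A B x"
    using x unfolding T_def TT_def tensor_comult_def Let_def
    by (intro tensor_lift_tliftI; (intro tensor_lift_tliftI; (intro tensor_lift_tlift)?)?) simp_all
  finally show ?thesis .
qed

lemma tlift_ground_closed [simp]:
  assumes "module K A" "module K B" "bilinear_map K A B (ground_module K) h"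
    and "t \<in> carrier (tensor_module K A B)"
  shows "tlift K A B (ground_module K) h t \<in> carrier K"
  using tlift_closed[OF assms(1,2) ground_module_module assms(3,4)] module_imp_cring[OF assms(1)]
  by simp

text \<open>The oriented case of \<open>tlift_swap\<close>: for fixed \<open>A\<close> and
  \<open>B\<close> it brings sums over \<open>A\<close> outside sums over \<open>B\<close>, which
  gives mixed sums a normal form.\<close>

lemma tlift_comult_swap:
  assumes "coalgebra K A" "coalgebra K B" "module K E" "a \<in> carrier A" "b \<in> carrier B"
    and "\<forall>a\<in>carrier A. \<forall>b\<in>carrier A. bilinear_map K B B E (\<lambda>c d. F c d a b)"
    and "\<forall>c\<in>carrier B. \<forall>d\<in>carrier B. bilinear_map K A A E (F c d)"
  shows "tlift K B B E (\<lambda>c d. tlift K A A E (F c d) (comult A a)) (comult B b) =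
    tlift K A A E (\<lambda>a b'. tlift K B B E (\<lambda>c d. F c d a b') (comult B b)) (comult A a)"
  by (rule tlift_swap) (use assms in simp_all)

lemma tensor_hopf_coalgebra [simp]:
  assumes A [simp]: "coalgebra K A" and B [simp]: "coalgebra K B"
  shows "coalgebra K (tensor_hopf K A B)"
proof -
  let ?T = "tensor_module K A B"
  let ?TT = "tensor_module K ?T ?T"
  let ?T3 = "tensor_module K ?T ?TT"
  let ?H = "tensor_hopf K A B"
  let ?\<Delta> = "tensor_comult K A B"
  let ?\<epsilon> = "tlift K A B (ground_module K) (\<lambda>a b. counit A a \<otimes>\<^bsub>K\<^esub> counit B b)"
  have [simp]: "cring K"
    using module_imp_cring[OF coalgebra_module[OF A]] .
  interpret K: cring K by fact
  interpret T: module K ?T by simp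
  \<comment> \<open>The counit of a pure tensor is a product of two scalars. Splitting it and
    drawing one scalar out of the inner sum (\<open>smult_tlift\<close> reversed) lets each counit
    law meet its own sum.\<close>
  note [simp] = tlift_comult_swap[OF A B] K.m_closed Let_def T.smult_assoc1 smult_tlift[symmetric]
  show ?thesis
  proof (rule coalgebraI; (unfold tensor_hopf_rules)?)
    show "linear_map K ?T ?TT (comult ?H)"
      by (rule linear_map_cong[where f = ?\<Delta>]) simp_all
    show "linear_map K ?T (ground_module K) (counit ?H)"
      by (rule linear_map_cong[where f = ?\<epsilon>]) simp_all
  next
    fix x assume x: "x \<in> carrier ?T"
    \<comment> \<open>Exposes the inner comultiplication as a Sweedler sum with the factor
      \<open>a\<close> already inside.\<close>
    have pure_\<Delta>: "pure_tensor K ?T ?TT a (?\<Delta> b) =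
        tlift K ?T ?T ?T3 (\<lambda>b\<^sub>1 b\<^sub>2. pure_tensor K ?T ?TT a (pure_tensor K ?T ?T b\<^sub>1 b\<^sub>2)) (?\<Delta> b)"
      if "a \<in> carrier ?T" "b \<in> carrier ?T" for a b
      using that pure_tlift(2)[where K = K and A = ?T and B = ?T and C = ?T and D = ?TT
          and t = "?\<Delta> b" and k = "pure_tensor K ?T ?T" and c = a] by simp
    have "tlift K ?T ?T ?T3 (\<lambda>a b. tlift K ?T ?T ?T3
          (\<lambda>a\<^sub>1 a\<^sub>2. pure_tensor K ?T ?TT a\<^sub>1 (pure_tensor K ?T ?T a\<^sub>2 b)) (?\<Delta> a)) (?\<Delta> x) =
        tlift K ?T ?T ?T3 (\<lambda>a b. pure_tensor K ?T ?TT a (?\<Delta> b)) (?\<Delta> x)"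
      by (rule tensor_ext[where K = K and A = A and B = B and C = ?T3 and t = x and
          \<phi> = "\<lambda>x. tlift K ?T ?T ?T3 (\<lambda>a b. tlift K ?T ?T ?T3
            (\<lambda>a\<^sub>1 a\<^sub>2. pure_tensor K ?T ?TT a\<^sub>1 (pure_tensor K ?T ?T a\<^sub>2 b)) (?\<Delta> a)) (?\<Delta> x)"])
        (use x in \<open>simp_all add: pure_\<Delta>\<close>)
    then show "tlift K ?T ?T ?T3 (\<lambda>a b. tlift K ?T ?T ?T3
          (\<lambda>a\<^sub>1 a\<^sub>2. pure_tensor K ?T ?TT a\<^sub>1 (pure_tensor K ?T ?T a\<^sub>2 b)) (comult ?H a)) (comult ?H x) =
        tlift K ?T ?T ?T3 (\<lambda>a b. pure_tensor K ?T ?TT a (comult ?H b)) (comult ?H x)"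
      using x by simp
    have "tlift K ?T ?T ?T (\<lambda>a b. ?\<epsilon> a \<odot>\<^bsub>?T\<^esub> b) (?\<Delta> x) = x"
      by (rule tensor_ext[where K = K and A = A and B = B and C = ?T and t = x and
          \<phi> = "\<lambda>x. tlift K ?T ?T ?T (\<lambda>a b. ?\<epsilon> a \<odot>\<^bsub>?T\<^esub> b) (?\<Delta> x)"]) (use x in simp_all)
    then show "tlift K ?T ?T ?T (\<lambda>a b. counit ?H a \<odot>\<^bsub>?T\<^esub> b) (comult ?H x) = x"
      using x by simp
    have "tlift K ?T ?T ?T (\<lambda>a b. ?\<epsilon> b \<odot>\<^bsub>?T\<^esub> a) (?\<Delta> x) = x"
      by (rule tensor_ext[where K = K and A = A and B = B and C = ?T and t = x and
          \<phi> = "\<lambda>x. tlift K ?T ?T ?T (\<lambda>a b. ?\<epsilon> b \<odot>\<^bsub>?T\<^esub> a) (?\<Delta> x)"]) (use x in simp_all)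
    then show "tlift K ?T ?T ?T (\<lambda>a b. counit ?H b \<odot>\<^bsub>?T\<^esub> a) (comult ?H x) = x"
      using x by simp
  qed simp
qed

lemma same_module_assoc_algebra:
  assumes "same_module M M'" "mult M = mult M'" "one M = one M'" "assoc_algebra K M'"
  shows "assoc_algebra K M"
proof -
  interpret M': assoc_algebra K M' by fact
  note [simp] = same_module_sel[OF assms(1)] assms(2,3)
  have mod: "module K M"
    using assms(1) M'.module_axioms by (rule same_module_imp_module)
  moreover have "ring M"
  proof (rule ringI)
    show "abelian_group M" using mod by (simp add: module_def)
    show "monoid M" by (rule monoidI) (simp_all add: M'.m_assoc)
  qed (simp_all add: M'.l_distr M'.r_distr)
  moreover have "assoc_algebra_axioms K M"
    by standard (simp_all add: M'.smult_mult_left M'.smult_mult_right)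
  ultimately show ?thesis by (simp add: assoc_algebra_def)
qed

lemma tensor_hopf_cocomm_hopf_algebra [simp]:
  assumes A [simp]: "cocomm_hopf_algebra K A" and B [simp]: "cocomm_hopf_algebra K B"
  shows "cocomm_hopf_algebra K (tensor_hopf K A B)"
proof -
  let ?T = "tensor_module K A B"
  let ?TT = "tensor_module K ?T ?T"
  let ?H = "tensor_hopf K A B"
  let ?\<Delta> = "tensor_comult K A B"
  let ?\<epsilon> = "tlift K A B (ground_module K) (\<lambda>a b. counit A a \<otimes>\<^bsub>K\<^esub> counit B b)"
  let ?S = "tlift K A B ?T (\<lambda>a b. pure_tensor K A B (antipode A a) (antipode B b))"
  let ?mul = "mult (tensor_algebra K A B)"
  interpret K: field K using A by (rule hopf_field)
  have [simp]: "cring K" by (rule K.is_cring)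
  interpret T: module K ?T by simp
  note [simp] = tlift_comult_swap[of K A B] Let_def hopf_simps[OF A] hopf_simps[OF B]
    assoc_algebra_simps[OF tensor_algebra_assoc_algebra[of K A B], unfolded tensor_algebra_rules]
    linear_mult[OF tensor_algebra_assoc_algebra[of K A B], unfolded tensor_algebra_rules]
    K.m_ac
  show ?thesis
  proof (rule cocomm_hopf_algebraI; (unfold tensor_hopf_rules tensor_hopf_one_mult)?)
    show "field K" by (rule K.field_axioms)
    show "assoc_algebra K ?H"
      by (rule same_module_assoc_algebra[of _ "tensor_algebra K A B"])
        (simp_all add: same_module_def)
    show "linear_map K ?T ?T (antipode ?H)"
      by (rule linear_map_cong[where f = ?S]) simp_all
  next
    fix x y assume xy: "x \<in> carrier ?T" "y \<in> carrier ?T"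
    have "?\<Delta> (?mul x y) = tlift K ?T ?T ?TT (\<lambda>a b. tlift K ?T ?T ?TT
        (\<lambda>a' b'. pure_tensor K ?T ?T (?mul a a') (?mul b b')) (?\<Delta> y)) (?\<Delta> x)"
      by (rule tensor_ext2[where K = K and A = A and B = B and A' = A and B' = B and C = ?TT
            and s = x and t = y and \<phi> = "\<lambda>x y. ?\<Delta> (?mul x y)"])
        (use xy in simp_all)
    then show "comult ?H (?mul x y) = tlift K ?T ?T ?TT (\<lambda>a b. tlift K ?T ?T ?TT
        (\<lambda>a' b'. pure_tensor K ?T ?T (?mul a a') (?mul b b')) (comult ?H y)) (comult ?H x)"
      using xy by simp
    have "?\<epsilon> (?mul x y) = ?\<epsilon> x \<otimes>\<^bsub>K\<^esub> ?\<epsilon> y"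
      by (rule tensor_ext2[where K = K and A = A and B = B and A' = A and B' = B
            and C = "ground_module K" and s = x and t = y and \<phi> = "\<lambda>x y. ?\<epsilon> (?mul x y)"])
        (use xy in simp_all)
    then show "counit ?H (?mul x y) = counit ?H x \<otimes>\<^bsub>K\<^esub> counit ?H y"
      using xy by simp
  next
    show "comult ?H (pure_tensor K A B \<one>\<^bsub>A\<^esub> \<one>\<^bsub>B\<^esub>) =
        pure_tensor K ?T ?T (pure_tensor K A B \<one>\<^bsub>A\<^esub> \<one>\<^bsub>B\<^esub>) (pure_tensor K A B \<one>\<^bsub>A\<^esub> \<one>\<^bsub>B\<^esub>)"
      by simp
    show "counit ?H (pure_tensor K A B \<one>\<^bsub>A\<^esub> \<one>\<^bsub>B\<^esub>) = \<one>\<^bsub>K\<^esub>"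
      by simp
  next
    fix x assume x: "x \<in> carrier ?T"
    \<comment> \<open>On a pure tensor the antipode sum is the tensor product of the antipode sums
      of \<open>A\<close> and \<open>B\<close>; the product of the counits is distributed over the
      two factors accordingly.\<close>
    have eps: "tlift K A A ?T (\<lambda>a\<^sub>1 a\<^sub>2. tlift K B B ?T (\<lambda>b\<^sub>1 b\<^sub>2.
         pure_tensor K A B (antipode A a\<^sub>1 \<otimes>\<^bsub>A\<^esub> a\<^sub>2) (antipode B b\<^sub>1 \<otimes>\<^bsub>B\<^esub> b\<^sub>2)) (comult B b)) (comult A a) =
        (counit A a \<otimes>\<^bsub>K\<^esub> counit B b) \<odot>\<^bsub>?T\<^esub> pure_tensor K A B \<one>\<^bsub>A\<^esub> \<one>\<^bsub>B\<^esub>"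
       "tlift K A A ?T (\<lambda>a\<^sub>1 a\<^sub>2. tlift K B B ?T (\<lambda>b\<^sub>1 b\<^sub>2.
         pure_tensor K A B (a\<^sub>1 \<otimes>\<^bsub>A\<^esub> antipode A a\<^sub>2) (b\<^sub>1 \<otimes>\<^bsub>B\<^esub> antipode B b\<^sub>2)) (comult B b)) (comult A a) =
        (counit A a \<otimes>\<^bsub>K\<^esub> counit B b) \<odot>\<^bsub>?T\<^esub> pure_tensor K A B \<one>\<^bsub>A\<^esub> \<one>\<^bsub>B\<^esub>"
      if [simp]: "a \<in> carrier A" "b \<in> carrier B" for a b
    proof -
      let ?e = "(counit A a \<otimes>\<^bsub>K\<^esub> counit B b) \<odot>\<^bsub>?T\<^esub> pure_tensor K A B \<one>\<^bsub>A\<^esub> \<one>\<^bsub>B\<^esub>"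
      have e: "?e = pure_tensor K A B (counit A a \<odot>\<^bsub>A\<^esub> \<one>\<^bsub>A\<^esub>) (counit B b \<odot>\<^bsub>B\<^esub> \<one>\<^bsub>B\<^esub>)"
        by (subst pure_smult(1)) (simp_all add: T.smult_assoc1)
      show "tlift K A A ?T (\<lambda>a\<^sub>1 a\<^sub>2. tlift K B B ?T (\<lambda>b\<^sub>1 b\<^sub>2.
         pure_tensor K A B (antipode A a\<^sub>1 \<otimes>\<^bsub>A\<^esub> a\<^sub>2) (antipode B b\<^sub>1 \<otimes>\<^bsub>B\<^esub> b\<^sub>2)) (comult B b)) (comult A a) = ?e"
        unfolding e antipode_tlift(1)[OF A that(1), symmetric] antipode_tlift(1)[OF B that(2), symmetric]
        by simp
      show "tlift K A A ?T (\<lambda>a\<^sub>1 a\<^sub>2. tlift K B B ?T (\<lambda>b\<^sub>1 b\<^sub>2.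
         pure_tensor K A B (a\<^sub>1 \<otimes>\<^bsub>A\<^esub> antipode A a\<^sub>2) (b\<^sub>1 \<otimes>\<^bsub>B\<^esub> antipode B b\<^sub>2)) (comult B b)) (comult A a) = ?e"
        unfolding e antipode_tlift(2)[OF A that(1), symmetric] antipode_tlift(2)[OF B that(2), symmetric]
        by simp
    qed
    have "tlift K ?T ?T ?T (\<lambda>a b. ?mul (?S a) b) (?\<Delta> x) = ?\<epsilon> x \<odot>\<^bsub>?T\<^esub> pure_tensor K A B \<one>\<^bsub>A\<^esub> \<one>\<^bsub>B\<^esub>"
      by (rule tensor_ext[where K = K and A = A and B = B and C = ?T and t = x and
          \<phi> = "\<lambda>x. tlift K ?T ?T ?T (\<lambda>a b. ?mul (?S a) b) (?\<Delta> x)"])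
        (use x in \<open>simp_all add: eps\<close>)
    then show "tlift K ?T ?T ?T (\<lambda>a b. ?mul (antipode ?H a) b) (comult ?H x) = counit ?H x \<odot>\<^bsub>?T\<^esub> pure_tensor K A B \<one>\<^bsub>A\<^esub> \<one>\<^bsub>B\<^esub>"
      using x by (simp del: tensor_algebra_mult)
    have "tlift K ?T ?T ?T (\<lambda>a b. ?mul a (?S b)) (?\<Delta> x) = ?\<epsilon> x \<odot>\<^bsub>?T\<^esub> pure_tensor K A B \<one>\<^bsub>A\<^esub> \<one>\<^bsub>B\<^esub>"
      by (rule tensor_ext[where K = K and A = A and B = B and C = ?T and t = x and
          \<phi> = "\<lambda>x. tlift K ?T ?T ?T (\<lambda>a b. ?mul a (?S b)) (?\<Delta> x)"])
        (use x in \<open>simp_all add: eps\<close>)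
    then show "tlift K ?T ?T ?T (\<lambda>a b. ?mul a (antipode ?H b)) (comult ?H x) = counit ?H x \<odot>\<^bsub>?T\<^esub> pure_tensor K A B \<one>\<^bsub>A\<^esub> \<one>\<^bsub>B\<^esub>"
      using x by (simp del: tensor_algebra_mult)
    have "tlift K ?T ?T ?TT (\<lambda>a b. pure_tensor K ?T ?T b a) (?\<Delta> x) = ?\<Delta> x"
      proof (rule tensor_ext[where K = K and A = A and B = B and C = ?TT and t = x and
          \<phi> = "\<lambda>x. tlift K ?T ?T ?TT (\<lambda>a b. pure_tensor K ?T ?T b a) (?\<Delta> x)"])
      fix a b assume [simp]: "a \<in> carrier A" "b \<in> carrier B"
      show "tlift K ?T ?T ?TT (\<lambda>a b. pure_tensor K ?T ?T b a) (?\<Delta> (pure_tensor K A B a b)) =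
          ?\<Delta> (pure_tensor K A B a b)"
      proof -
        let ?p = "\<lambda>a b a' b'. pure_tensor K ?T ?T (pure_tensor K A B a b) (pure_tensor K A B a' b')"
        have "tlift K ?T ?T ?TT (\<lambda>a b. pure_tensor K ?T ?T b a) (?\<Delta> (pure_tensor K A B a b)) =
            tlift K A A ?TT (\<lambda>a\<^sub>1 a\<^sub>2. tlift K B B ?TT (\<lambda>b\<^sub>1 b\<^sub>2. ?p a\<^sub>2 b\<^sub>2 a\<^sub>1 b\<^sub>1) (comult B b)) (comult A a)"
          by simp
        \<comment> \<open>Both pairs of indices have to be interchanged: cocommutativity of
          \<open>A\<close> is used here and that of \<open>B\<close> in the next step.\<close>
        also have "\<dots> = tlift K A A ?TT (\<lambda>a\<^sub>1 a\<^sub>2. tlift K B B ?TT (\<lambda>b\<^sub>1 b\<^sub>2. ?p a\<^sub>1 b\<^sub>2 a\<^sub>2 b\<^sub>1) (comult B b)) (comult A a)"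
          by (rule comult_swap_tlift[OF A]) simp_all
        also have "\<dots> = tlift K A A ?TT (\<lambda>a\<^sub>1 a\<^sub>2. tlift K B B ?TT (\<lambda>b\<^sub>1 b\<^sub>2. ?p a\<^sub>1 b\<^sub>1 a\<^sub>2 b\<^sub>2) (comult B b)) (comult A a)"
          by (intro tlift_cong refl comult_swap_tlift[OF B]) simp_all
        finally show ?thesis by simp
      qed
    qed (use x in simp_all)
    then show "tlift K ?T ?T ?TT (\<lambda>a b. pure_tensor K ?T ?T b a) (comult ?H x) = comult ?H x"
      using x by simp
  qed simp
qed

section \<open>Complements and generalized inverses over a field\<close>

lemma submodule_simps:
  assumes "submodule N K M" "module K M"
  shows "x \<in> N \<Longrightarrow> x \<in> carrier M" "\<zero>\<^bsub>M\<^esub> \<in> N"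
    and "\<lbrakk>x \<in> N; y \<in> N\<rbrakk> \<Longrightarrow> x \<oplus>\<^bsub>M\<^esub> y \<in> N"
    and "\<lbrakk>c \<in> carrier K; x \<in> N\<rbrakk> \<Longrightarrow> c \<odot>\<^bsub>M\<^esub> x \<in> N"
    and "\<lbrakk>x \<in> N; y \<in> N\<rbrakk> \<Longrightarrow> x \<ominus>\<^bsub>M\<^esub> y \<in> N"
proof -
  interpret M: module K M by fact
  show "x \<in> N \<Longrightarrow> x \<in> carrier M" "\<lbrakk>x \<in> N; y \<in> N\<rbrakk> \<Longrightarrow> x \<oplus>\<^bsub>M\<^esub> y \<in> N"
    "\<lbrakk>c \<in> carrier K; x \<in> N\<rbrakk> \<Longrightarrow> c \<odot>\<^bsub>M\<^esub> x \<in> N" "\<lbrakk>x \<in> N; y \<in> N\<rbrakk> \<Longrightarrow> x \<ominus>\<^bsub>M\<^esub> y \<in> N"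
    using M.submoduleE[OF assms(1)] by (auto simp: a_minus_def)
  show "\<zero>\<^bsub>M\<^esub> \<in> N"
    using subgroup.one_closed[OF submodule.axioms(1)[OF assms(1)]] by simp
qed

lemma submoduleI':
  assumes "module K M" "N \<subseteq> carrier M" "\<zero>\<^bsub>M\<^esub> \<in> N"
    and "\<And>x y. \<lbrakk>x \<in> N; y \<in> N\<rbrakk> \<Longrightarrow> x \<oplus>\<^bsub>M\<^esub> y \<in> N"
    and "\<And>c x. \<lbrakk>c \<in> carrier K; x \<in> N\<rbrakk> \<Longrightarrow> c \<odot>\<^bsub>M\<^esub> x \<in> N"
  shows "submodule N K M"
proof -
  interpret M: module K M by fact
  have "\<ominus>\<^bsub>M\<^esub> x \<in> N" if "x \<in> N" for x
    using assms(5)[of "\<ominus>\<^bsub>K\<^esub> \<one>\<^bsub>K\<^esub>" x] that assms(2) M.smult_l_minus[of "\<one>\<^bsub>K\<^esub>" x] by auto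
  then show ?thesis
    by (intro M.submoduleI assms)
qed

text \<open>Zorn's lemma gives a submodule \<open>Q\<close> that is maximal among those meeting
  \<open>P\<close> only in zero. If some \<open>x\<close> were not in \<open>P + Q\<close>, then
  adjoining \<open>x\<close> to \<open>Q\<close> would still give trivial intersection with
  \<open>P\<close>: from an element of \<open>P\<close> in which \<open>x\<close> has a nonzero
  coefficient one could solve for \<open>x\<close>. This division requires a field.\<close>

lemma submodule_complement:
  assumes K: "field K" and M: "module K M" and P: "submodule P K M"
  obtains Q where "submodule Q K M" "P \<inter> Q = {\<zero>\<^bsub>M\<^esub>}"
    "\<forall>x\<in>carrier M. \<exists>p\<in>P. \<exists>q\<in>Q. x = p \<oplus>\<^bsub>M\<^esub> q"
proof -
  interpret K: field K by fact
  interpret M: module K M by fact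
  note P = submodule_simps[OF P M]
  let ?A = "{Q. submodule Q K M \<and> P \<inter> Q = {\<zero>\<^bsub>M\<^esub>}}"
  have "\<exists>Q\<in>?A. \<forall>X\<in>?A. Q \<subseteq> X \<longrightarrow> X = Q"
  proof (rule subset_Zorn_nonempty)
    have "{\<zero>\<^bsub>M\<^esub>} \<in> ?A"
      using P by (auto intro!: submoduleI'[OF M])
    then show "?A \<noteq> {}" by blast
    fix \<C> assume ne: "\<C> \<noteq> {}" and ch: "subset.chain ?A \<C>"
    have sub: "submodule X K M" "P \<inter> X = {\<zero>\<^bsub>M\<^esub>}" if "X \<in> \<C>" for X
      using ch that by (auto simp: subset.chain_def)
    note X = submodule_simps[OF sub(1) M]
    have "submodule (\<Union>\<C>) K M"
    proof (rule submoduleI'[OF M])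
      fix x y assume "x \<in> \<Union>\<C>" "y \<in> \<Union>\<C>"
      then obtain X Y where "X \<in> \<C>" "Y \<in> \<C>" "x \<in> X" "y \<in> Y" by blast
      moreover from this have "X \<subseteq> Y \<or> Y \<subseteq> X"
        using ch by (auto simp: subset.chain_def)
      ultimately show "x \<oplus>\<^bsub>M\<^esub> y \<in> \<Union>\<C>"
        using X(3) by blast
    qed (use X ne in blast)+
    moreover have "P \<inter> \<Union>\<C> = {\<zero>\<^bsub>M\<^esub>}"
      using sub(2) ne by blast
    ultimately show "\<Union>\<C> \<in> ?A" by blast
  qed
  then obtain Q where QA: "Q \<in> ?A" and QX: "\<forall>X\<in>?A. Q \<subseteq> X \<longrightarrow> X = Q"
    by (rule bexE)
  have Q: "submodule Q K M" "P \<inter> Q = {\<zero>\<^bsub>M\<^esub>}"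
    using QA by auto
  have max: "X = Q" if "submodule X K M" "P \<inter> X = {\<zero>\<^bsub>M\<^esub>}" "Q \<subseteq> X" for X
    using QX that by simp
  note Qs = submodule_simps[OF Q(1) M]
  have "\<exists>p\<in>P. \<exists>q\<in>Q. x = p \<oplus>\<^bsub>M\<^esub> q" if x: "x \<in> carrier M" for x
  proof (rule ccontr)
    assume no: "\<not> ?thesis"
    \<comment> \<open>\<open>Q + K x\<close>, which will contradict the maximality of
      \<open>Q\<close>: equality with \<open>Q\<close> would put \<open>x\<close> into
      \<open>Q\<close>.\<close>
    let ?X = "{q \<oplus>\<^bsub>M\<^esub> c \<odot>\<^bsub>M\<^esub> x |q c. q \<in> Q \<and> c \<in> carrier K}"
    have XI: "q \<oplus>\<^bsub>M\<^esub> c \<odot>\<^bsub>M\<^esub> x \<in> ?X" if "q \<in> Q" "c \<in> carrier K" for q c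
      using that by blast
    have "submodule ?X K M"
    proof (rule submoduleI'[OF M])
      show "?X \<subseteq> carrier M"
        using x Qs(1) by auto
      show "\<zero>\<^bsub>M\<^esub> \<in> ?X"
        using XI[of "\<zero>\<^bsub>M\<^esub>" "\<zero>\<^bsub>K\<^esub>"] Qs(2) x by simp
    next
      fix y z assume "y \<in> ?X" "z \<in> ?X"
      then obtain q c q' c' where *: "q \<in> Q" "c \<in> carrier K" "q' \<in> Q" "c' \<in> carrier K"
        "y = q \<oplus>\<^bsub>M\<^esub> c \<odot>\<^bsub>M\<^esub> x" "z = q' \<oplus>\<^bsub>M\<^esub> c' \<odot>\<^bsub>M\<^esub> x" by blast
      then have "y \<oplus>\<^bsub>M\<^esub> z = (q \<oplus>\<^bsub>M\<^esub> q') \<oplus>\<^bsub>M\<^esub> (c \<oplus>\<^bsub>K\<^esub> c') \<odot>\<^bsub>M\<^esub> x"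
        using x Qs(1) by (simp add: M.smult_l_distr M.a_ac)
      then show "y \<oplus>\<^bsub>M\<^esub> z \<in> ?X"
        using XI * Qs(3) by simp
    next
      fix d y assume d: "d \<in> carrier K" and "y \<in> ?X"
      then obtain q c where *: "q \<in> Q" "c \<in> carrier K" "y = q \<oplus>\<^bsub>M\<^esub> c \<odot>\<^bsub>M\<^esub> x" by blast
      then have "d \<odot>\<^bsub>M\<^esub> y = d \<odot>\<^bsub>M\<^esub> q \<oplus>\<^bsub>M\<^esub> (d \<otimes>\<^bsub>K\<^esub> c) \<odot>\<^bsub>M\<^esub> x"
        using x d Qs(1) by (simp add: M.smult_r_distr M.smult_assoc1)
      then show "d \<odot>\<^bsub>M\<^esub> y \<in> ?X"
        using XI * d Qs(4) by simp
    qed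
    moreover have "P \<inter> ?X = {\<zero>\<^bsub>M\<^esub>}"
    proof (rule equalityI; rule subsetI)
      fix y assume "y \<in> P \<inter> ?X"
      then obtain q c where *: "y \<in> P" "q \<in> Q" "c \<in> carrier K" "y = q \<oplus>\<^bsub>M\<^esub> c \<odot>\<^bsub>M\<^esub> x"
        by blast
      show "y \<in> {\<zero>\<^bsub>M\<^esub>}"
      proof (cases "c = \<zero>\<^bsub>K\<^esub>")
        case True
        then show ?thesis using * Q(2) x Qs(1) by auto
      next
        case False
        then have c: "inv\<^bsub>K\<^esub> c \<in> carrier K" "inv\<^bsub>K\<^esub> c \<otimes>\<^bsub>K\<^esub> c = \<one>\<^bsub>K\<^esub>"
          using * K.field_Units by auto
        have "c \<odot>\<^bsub>M\<^esub> x = \<ominus>\<^bsub>M\<^esub> q \<oplus>\<^bsub>M\<^esub> y"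
          using * x Qs(1) by (simp add: M.r_neg1)
        then have "inv\<^bsub>K\<^esub> c \<odot>\<^bsub>M\<^esub> (c \<odot>\<^bsub>M\<^esub> x) = inv\<^bsub>K\<^esub> c \<odot>\<^bsub>M\<^esub> (\<ominus>\<^bsub>M\<^esub> q \<oplus>\<^bsub>M\<^esub> y)"
          by simp
        \<comment> \<open>The negative of \<open>q\<close> is written as a difference from zero, so
          that closure of \<open>Q\<close> under differences applies.\<close>
        then have "x = inv\<^bsub>K\<^esub> c \<odot>\<^bsub>M\<^esub> y \<oplus>\<^bsub>M\<^esub> inv\<^bsub>K\<^esub> c \<odot>\<^bsub>M\<^esub> (\<zero>\<^bsub>M\<^esub> \<ominus>\<^bsub>M\<^esub> q)"
          using * c x Qs(1) P(1) by (simp add: M.smult_r_distr M.a_ac a_minus_def flip: M.smult_assoc1)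
        then show ?thesis
          using no * c P(4) Qs(4) Qs(5)[OF Qs(2)] by blast
      qed
    next
      show "y \<in> P \<inter> ?X" if "y \<in> {\<zero>\<^bsub>M\<^esub>}" for y
        using that P(2) XI[of "\<zero>\<^bsub>M\<^esub>" "\<zero>\<^bsub>K\<^esub>"] Qs(2) x by simp
    qed
    moreover have "Q \<subseteq> ?X"
    proof
      fix q assume "q \<in> Q"
      then show "q \<in> ?X" using XI[of q "\<zero>\<^bsub>K\<^esub>"] x Qs(1) by simp
    qed
    ultimately have "?X = Q" by (rule max)
    then have "x \<in> Q"
      using XI[of "\<zero>\<^bsub>M\<^esub>" "\<one>\<^bsub>K\<^esub>"] x Qs(2) by simp
    then show False
      using no P(2) x by (metis M.l_zero)
  qed
  then show thesis using that Q by blast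
qed

text \<open>Choose a complement \<open>Q\<close> of the kernel and a complement \<open>V\<close> of
  the image. Then \<open>w\<close> restricts to a bijection from \<open>Q\<close> to the image;
  \<open>k\<close> is its inverse there and zero on \<open>V\<close>.\<close>

lemma linear_generalized_inverse:
  assumes K: "field K" and M: "module K M" and W: "module K W" and w: "linear_map K M W w"
  obtains k where "linear_map K W M k" "\<And>x. x \<in> carrier M \<Longrightarrow> w (k (w x)) = w x"
proof -
  interpret M: module K M by fact
  interpret W: module K W by fact
  note wD = linear_mapD[OF w] linear_map_minus[OF M W w] linear_map_zero[OF M W w]
  obtain Q where Q: "submodule Q K M" and Q0: "{x \<in> carrier M. w x = \<zero>\<^bsub>W\<^esub>} \<inter> Q = {\<zero>\<^bsub>M\<^esub>}"
    and Qex: "\<forall>x\<in>carrier M. \<exists>p\<in>{x \<in> carrier M. w x = \<zero>\<^bsub>W\<^esub>}. \<exists>q\<in>Q. x = p \<oplus>\<^bsub>M\<^esub> q"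
    by (rule submodule_complement[OF K M submodule_kernel[OF M W w]])
  have im: "submodule (w ` carrier M) K W"
  proof (rule submoduleI'[OF W])
    show "\<zero>\<^bsub>W\<^esub> \<in> w ` carrier M"
      using wD(5) by (metis M.zero_closed imageI)
  qed (auto simp flip: wD(2,3) intro: wD(1) imageI)
  obtain V where V: "submodule V K W" and V0: "w ` carrier M \<inter> V = {\<zero>\<^bsub>W\<^esub>}"
    and Vex: "\<forall>y\<in>carrier W. \<exists>p\<in>w ` carrier M. \<exists>q\<in>V. y = p \<oplus>\<^bsub>W\<^esub> q"
    by (rule submodule_complement[OF K W im])
  note Qs = submodule_simps[OF Q M] and Vs = submodule_simps[OF V W]
  have wq: "\<exists>q\<in>Q. w x = w q" if x: "x \<in> carrier M" for x
  proof -
    obtain p q where "p \<in> carrier M" "w p = \<zero>\<^bsub>W\<^esub>" "q \<in> Q" "x = p \<oplus>\<^bsub>M\<^esub> q"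
      using bspec[OF Qex x] by blast
    then show ?thesis using Qs(1) wD by auto
  qed
  \<comment> \<open>\<open>w q - w q'\<close> equals \<open>v' - v\<close>, so it lies in the image
    and in \<open>V\<close> and vanishes; then \<open>q - q'\<close> lies in the kernel and in
    \<open>Q\<close> and vanishes too.\<close>
  have uniq: "q = q'" if "q \<in> Q" "q' \<in> Q" "v \<in> V" "v' \<in> V" "w q \<oplus>\<^bsub>W\<^esub> v = w q' \<oplus>\<^bsub>W\<^esub> v'" for q q' v v'
  proof -
    have cl: "q \<in> carrier M" "q' \<in> carrier M" "w q \<in> carrier W" "w q' \<in> carrier W" "v \<in> carrier W" "v' \<in> carrier W"
      using that Qs(1) Vs(1) wD(1) by auto
    have "w q = (w q \<oplus>\<^bsub>W\<^esub> v) \<oplus>\<^bsub>W\<^esub> \<ominus>\<^bsub>W\<^esub> v"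
      using cl by (simp add: W.a_assoc W.r_neg)
    also have "\<dots> = w q' \<oplus>\<^bsub>W\<^esub> (v' \<ominus>\<^bsub>W\<^esub> v)"
      using cl unfolding that(5) by (simp add: W.a_assoc a_minus_def)
    finally have "w q \<ominus>\<^bsub>W\<^esub> w q' = \<ominus>\<^bsub>W\<^esub> w q' \<oplus>\<^bsub>W\<^esub> (w q' \<oplus>\<^bsub>W\<^esub> (v' \<ominus>\<^bsub>W\<^esub> v))"
      using cl by (simp add: a_minus_def W.a_comm)
    also have "\<dots> = v' \<ominus>\<^bsub>W\<^esub> v"
      using cl by (simp add: W.r_neg1)
    finally have "w (q \<ominus>\<^bsub>M\<^esub> q') \<in> V"
      using cl wD(4) Vs(5)[OF that(4,3)] by simp
    then have "w (q \<ominus>\<^bsub>M\<^esub> q') = \<zero>\<^bsub>W\<^esub>"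
      using V0 cl M.minus_closed by blast
    then have "q \<ominus>\<^bsub>M\<^esub> q' = \<zero>\<^bsub>M\<^esub>"
      using Q0 Qs(5)[OF that(1,2)] cl M.minus_closed by blast
    then show ?thesis
      using cl minus_zero_iff[OF M.abelian_group_axioms] by simp
  qed
  \<comment> \<open>\<open>k\<close> reads off the \<open>Q\<close>-part of a decomposition that is
    unique by \<open>uniq\<close> and exists by \<open>ex\<close>. Linearity then follows by adding
    and scaling decompositions.\<close>
  define k where "k y = (THE q. q \<in> Q \<and> (\<exists>v\<in>V. y = w q \<oplus>\<^bsub>W\<^esub> v))" for y
  have k_eq: "k (w q \<oplus>\<^bsub>W\<^esub> v) = q" if "q \<in> Q" "v \<in> V" for q v
    unfolding k_def using that uniq by (intro the_equality) auto
  have ex: "\<exists>q\<in>Q. \<exists>v\<in>V. y = w q \<oplus>\<^bsub>W\<^esub> v" if y: "y \<in> carrier W" for y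
  proof -
    obtain p v where pv: "p \<in> carrier M" "v \<in> V" "y = w p \<oplus>\<^bsub>W\<^esub> v"
      using bspec[OF Vex y] by blast
    obtain q where "q \<in> Q" "w p = w q"
      using wq[OF pv(1)] by blast
    then show ?thesis using pv by auto
  qed
  show thesis
  proof
    show "linear_map K W M k"
    proof (rule linear_mapI)
      show "k y \<in> carrier M" if "y \<in> carrier W" for y
        using ex[OF that] k_eq Qs(1) by auto
      show "k (y \<oplus>\<^bsub>W\<^esub> z) = k y \<oplus>\<^bsub>M\<^esub> k z" if yz: "y \<in> carrier W" "z \<in> carrier W" for y z
      proof -
        obtain q v q' v' where *: "q \<in> Q" "v \<in> V" "y = w q \<oplus>\<^bsub>W\<^esub> v" "q' \<in> Q" "v' \<in> V" "z = w q' \<oplus>\<^bsub>W\<^esub> v'"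
          using ex[OF yz(1)] ex[OF yz(2)] by blast
        then have "y \<oplus>\<^bsub>W\<^esub> z = w (q \<oplus>\<^bsub>M\<^esub> q') \<oplus>\<^bsub>W\<^esub> (v \<oplus>\<^bsub>W\<^esub> v')"
          using Qs(1) Vs(1) wD(1,2) by (simp add: W.a_ac)
        then show ?thesis
          using * k_eq Qs(3) Vs(3) by metis
      qed
      show "k (c \<odot>\<^bsub>W\<^esub> y) = c \<odot>\<^bsub>M\<^esub> k y" if cy: "c \<in> carrier K" "y \<in> carrier W" for c y
      proof -
        obtain q v where *: "q \<in> Q" "v \<in> V" "y = w q \<oplus>\<^bsub>W\<^esub> v"
          using ex[OF cy(2)] by blast
        then have "c \<odot>\<^bsub>W\<^esub> y = w (c \<odot>\<^bsub>M\<^esub> q) \<oplus>\<^bsub>W\<^esub> (c \<odot>\<^bsub>W\<^esub> v)"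
          using Qs(1) Vs(1) wD(1,3) cy by (simp add: W.smult_r_distr)
        then show ?thesis
          using * k_eq Qs(4) Vs(4) cy by metis
      qed
    qed
    show "w (k (w x)) = w x" if x: "x \<in> carrier M" for x
    proof -
      obtain q where q: "q \<in> Q" "w x = w q" using wq[OF x] by blast
      then have "k (w q \<oplus>\<^bsub>W\<^esub> \<zero>\<^bsub>W\<^esub>) = q" using k_eq Vs(2) by blast
      then show ?thesis using q wD(1) Qs(1) by simp
    qed
  qed
qed

section \<open>Hopf subalgebras given by a retraction\<close>

lemma same_sub_hopf: "same_module (sub_hopf K H S) (H\<lparr>carrier := S\<rparr>)"
  by (simp add: same_module_def sub_hopf_def)

lemmas sub_hopf_rules [simp] =
  same_module_sel[OF same_sub_hopf] same_module_rules[OF same_sub_hopf]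

lemma sub_hopf_sel [simp]:
  "mult (sub_hopf K H S) = mult H" "one (sub_hopf K H S) = one H"
  "counit (sub_hopf K H S) = counit H" "antipode (sub_hopf K H S) = antipode H"
  by (simp_all add: sub_hopf_def)

text \<open>The condition \<open>comult_retract\<close> stands for the comultiplication mapping
  \<open>S\<close> into \<open>S \<otimes> S\<close>. It is an equation between elements of
  \<open>H \<otimes> H\<close>, so it can be stated without comparing the two tensor
  squares.\<close>

locale hopf_retract =
  fixes K :: "('k, 'm) ring_scheme" and H :: "('k, 'a) hopf" and S :: "'a set" and \<pi> :: "'a \<Rightarrow> 'a"
  assumes hopf [simp]: "cocomm_hopf_algebra K H"
    and submodule: "submodule S K H"
    and mult_closed: "\<lbrakk>x \<in> S; y \<in> S\<rbrakk> \<Longrightarrow> x \<otimes>\<^bsub>H\<^esub> y \<in> S"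
    and one_closed: "\<one>\<^bsub>H\<^esub> \<in> S"
    and antipode_closed: "x \<in> S \<Longrightarrow> antipode H x \<in> S"
    and retract_linear: "linear_map K H (H\<lparr>carrier := S\<rparr>) \<pi>"
    and retract: "x \<in> S \<Longrightarrow> \<pi> x = x"
    and comult_retract: "x \<in> S \<Longrightarrow>
      tlift K H H (tensor_module K H H) (\<lambda>a b. pure_tensor K H H (\<pi> a) (\<pi> b)) (comult H x) = comult H x"
begin

abbreviation "V \<equiv> H\<lparr>carrier := S\<rparr>"
abbreviation "VV \<equiv> tensor_module K V V"
abbreviation "R \<equiv> sub_hopf K H S"

lemma module_V [simp]: "module K V"
  using submodule by (rule submodule.submodule_is_module) simp

lemma S_subset [simp]: "x \<in> S \<Longrightarrow> x \<in> carrier H"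
  using submodule_simps(1)[OF submodule] by simp

lemma V_add_smult [simp]: "add V = add H" "smult V = smult H"
  by simp_all

lemma linear_incl [simp]: "linear_map K X V g \<Longrightarrow> linear_map K X H g"
  by (auto simp: linear_map_def Pi_iff)

lemma linear_V_id [simp]: "linear_map K V H (\<lambda>x. x)"
  by (auto simp: linear_map_def Pi_iff)

lemma linear_retract [simp]: "linear_map K X H g \<Longrightarrow> linear_map K X V (\<lambda>x. \<pi> (g x))"
  by (rule linear_map_comp[OF retract_linear])

lemma retract_closed [simp]: "x \<in> carrier H \<Longrightarrow> \<pi> x \<in> S"
  using linear_mapD(1)[OF retract_linear] by simp

declare retract_linear [simp] retract [simp] mult_closed [simp] one_closed [simp] antipode_closed [simp]

text \<open>An explicit candidate for the comultiplication that \<open>sub_hopf\<close> introduces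
  by a definite description. It is defined on all of \<open>H\<close>, so the linearity rules for
  maps from \<open>H\<close> apply.\<close>

definition "\<Delta> x = tlift K H H VV (\<lambda>a b. pure_tensor K V V (\<pi> a) (\<pi> b)) (comult H x)"

lemma linear_\<Delta> [simp]: "linear_map K X H g \<Longrightarrow> linear_map K X VV (\<lambda>x. \<Delta> (g x))"
  unfolding \<Delta>_def by simp

lemma \<Delta>_closed [simp]: "x \<in> carrier H \<Longrightarrow> \<Delta> x \<in> carrier VV"
  unfolding \<Delta>_def by simp

text \<open>Existence in the description of \<open>sub_hopf\<close>: the canonical map sends
  \<open>\<Delta> x\<close> to \<open>comult H x\<close> by \<open>comult_retract\<close>.
  Uniqueness: \<open>\<pi> \<otimes> \<pi>\<close> is a left inverse of the canonical map.\<close>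

lemma comult_sub [simp]:
  assumes "x \<in> S"
  shows "comult R x = \<Delta> x"
proof -
  let ?i = "tensor_map K H H id id :: ('a \<times> 'a \<Rightarrow> 'k) set \<Rightarrow> _"
  have i: "?i t = tlift K V V (tensor_module K H H) (pure_tensor K H H) t" if "t \<in> carrier VV" for t
    using that by (subst tensor_map_tlift[where A = V and B = V]) (simp_all add: linear_map_id)
  have left_inv: "tlift K H H VV (\<lambda>a b. pure_tensor K V V (\<pi> a) (\<pi> b)) (?i t) = t" if "t \<in> carrier VV" for t
    using that by (simp add: i)
  have "?i (\<Delta> x) = comult H x"
    using assms comult_retract by (simp add: i \<Delta>_def)
  moreover have "t = \<Delta> x" if "t \<in> carrier VV" "?i t = comult H x" for t
    using left_inv[OF that(1)] that(2) by (simp add: \<Delta>_def)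
  ultimately have "(THE t. t \<in> carrier VV \<and> ?i t = comult H x) = \<Delta> x"
    using assms by (intro the_equality) auto
  then show ?thesis
    by (simp add: sub_hopf_def)
qed

text \<open>Transfers Sweedler sums between the subalgebra and \<open>H\<close>: since
  \<open>\<pi> \<otimes> \<pi>\<close> fixes \<open>comult H x\<close>, a summand defined on
  \<open>H\<close> does not notice in which tensor square the sum is formed.\<close>

lemma tlift_\<Delta>:
  assumes "x \<in> S" "module K D" "bilinear_map K H H D F"
  shows "tlift K V V D F (\<Delta> x) = tlift K H H D F (comult H x)"
proof -
  have F: "bilinear_map K V V D F"
    using assms(3) by (auto intro: linear_map_comp[OF _ linear_V_id])
  have "tlift K H H D F (comult H x) =
      tlift K H H D F (tlift K H H (tensor_module K H H) (\<lambda>a b. pure_tensor K H H (\<pi> a) (\<pi> b)) (comult H x))"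
    using assms comult_retract by simp
  also have "\<dots> = tlift K H H D (\<lambda>a b. F (\<pi> a) (\<pi> b)) (comult H x)"
    using assms by simp
  finally show ?thesis
    using assms F by (simp add: \<Delta>_def)
qed

lemma assoc_algebra_R: "assoc_algebra K R"
proof -
  note [simp] = hopf_simps[OF hopf]
  interpret H: assoc_algebra K H by simp
  have "ring R"
  proof (rule ringI)
    have "module K R" by simp
    then show "abelian_group R" by (simp add: module_def)
    show "monoid R" by (rule monoidI) (simp_all add: H.m_assoc)
  qed (simp_all add: H.l_distr H.r_distr)
  moreover have "assoc_algebra_axioms K R"
    by standard (simp_all add: H.smult_mult_left H.smult_mult_right)
  ultimately show ?thesis by (simp add: assoc_algebra_def)
qed

lemma coalgebra_R: "coalgebra K R"
proof -
  let ?V3 = "tensor_module K V VV"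
  let ?p = "pure_tensor K V V" and ?q = "pure_tensor K V VV"
  note [simp] = hopf_simps[OF hopf]
  have cring: "cring K" by (rule module_imp_cring[OF module_V])
  show ?thesis
  proof (rule coalgebraI; (unfold sub_hopf_rules sub_hopf_sel)?)
    show "linear_map K V VV (comult R)"
      by (rule linear_map_cong[where f = \<Delta>]) simp_all
    show "linear_map K V (ground_module K) (counit H)"
      by simp
  next
    fix x assume "x \<in> carrier V"
    then have x [simp]: "x \<in> S" by simp
    \<comment> \<open>Arguments from \<open>S\<close> are wrapped in \<open>\<pi>\<close>, which
      fixes them, so that the summands extend to all of \<open>H\<close>. Then the sum can be moved
      to \<open>H\<close>, reassociated there and moved back.\<close>
    have "tlift K V V ?V3 (\<lambda>a b. tlift K V V ?V3 (\<lambda>a\<^sub>1 a\<^sub>2. ?q a\<^sub>1 (?p a\<^sub>2 b)) (comult R a)) (comult R x) =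
        tlift K V V ?V3 (\<lambda>a b. tlift K H H ?V3 (\<lambda>a\<^sub>1 a\<^sub>2. ?q (\<pi> a\<^sub>1) (?p (\<pi> a\<^sub>2) (\<pi> b))) (comult H a)) (\<Delta> x)"
      by (rule tlift_cong) (simp_all add: \<Delta>_def)
    also have "\<dots> = tlift K H H ?V3 (\<lambda>a b. tlift K H H ?V3 (\<lambda>a\<^sub>1 a\<^sub>2. ?q (\<pi> a\<^sub>1) (?p (\<pi> a\<^sub>2) (\<pi> b))) (comult H a)) (comult H x)"
      by (rule tlift_\<Delta>) simp_all
    also have "\<dots> = tlift K H H ?V3 (\<lambda>a b. tlift K H H ?V3 (\<lambda>b\<^sub>1 b\<^sub>2. ?q (\<pi> a) (?p (\<pi> b\<^sub>1) (\<pi> b\<^sub>2))) (comult H b)) (comult H x)"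
      by simp
    also have "\<dots> = tlift K V V ?V3 (\<lambda>a b. tlift K H H ?V3 (\<lambda>b\<^sub>1 b\<^sub>2. ?q (\<pi> a) (?p (\<pi> b\<^sub>1) (\<pi> b\<^sub>2))) (comult H b)) (\<Delta> x)"
      by (rule tlift_\<Delta>[symmetric]) simp_all
    also have "\<dots> = tlift K V V ?V3 (\<lambda>a b. ?q a (comult R b)) (comult R x)"
      by (rule tlift_cong) (simp_all add: \<Delta>_def)
    finally show "tlift K V V ?V3 (\<lambda>a b. tlift K V V ?V3 (\<lambda>a\<^sub>1 a\<^sub>2. ?q a\<^sub>1 (?p a\<^sub>2 b)) (comult R a)) (comult R x) =
        tlift K V V ?V3 (\<lambda>a b. ?q a (comult R b)) (comult R x)" .
    have "tlift K V V V (\<lambda>a b. counit H a \<odot>\<^bsub>H\<^esub> b) (comult R x) =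
        tlift K V V V (\<lambda>a b. counit H a \<odot>\<^bsub>V\<^esub> \<pi> b) (\<Delta> x)"
      by (rule tlift_cong) simp_all
    also have "\<dots> = tlift K H H V (\<lambda>a b. counit H a \<odot>\<^bsub>V\<^esub> \<pi> b) (comult H x)"
      by (rule tlift_\<Delta>) (simp_all del: V_add_smult)
    also have "\<dots> = x"
      by (subst counit_left_tlift) (simp_all del: V_add_smult)
    finally show "tlift K V V V (\<lambda>a b. counit H a \<odot>\<^bsub>V\<^esub> b) (comult R x) = x"
      by simp
    have "tlift K V V V (\<lambda>a b. counit H b \<odot>\<^bsub>H\<^esub> a) (comult R x) =
        tlift K V V V (\<lambda>a b. counit H b \<odot>\<^bsub>V\<^esub> \<pi> a) (\<Delta> x)"
      by (rule tlift_cong) simp_all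
    also have "\<dots> = tlift K H H V (\<lambda>a b. counit H b \<odot>\<^bsub>V\<^esub> \<pi> a) (comult H x)"
      by (rule tlift_\<Delta>) (simp_all del: V_add_smult)
    also have "\<dots> = x"
      by (subst counit_right_tlift) (simp_all del: V_add_smult)
    finally show "tlift K V V V (\<lambda>a b. counit H b \<odot>\<^bsub>V\<^esub> a) (comult R x) = x"
      by simp
  qed simp
qed

theorem hopf_R: "cocomm_hopf_algebra K R"
proof -
  let ?p = "pure_tensor K V V"
  note [simp] = hopf_simps[OF hopf]
  interpret V: module K V by simp
  show ?thesis
  proof (rule cocomm_hopf_algebraI; (unfold sub_hopf_rules sub_hopf_sel)?)
    show "field K" by (rule hopf_field[OF hopf])
    show "assoc_algebra K R" by (rule assoc_algebra_R)
    show "coalgebra K R" by (rule coalgebra_R)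
    show "linear_map K V V (antipode H)"
      using linear_antipode[OF hopf linear_V_id] by (auto simp: linear_map_def Pi_iff)
    show "comult R \<one>\<^bsub>H\<^esub> = ?p \<one>\<^bsub>H\<^esub> \<one>\<^bsub>H\<^esub>"
      by (simp add: \<Delta>_def)
  next
    fix x y assume "x \<in> carrier V" "y \<in> carrier V"
    then have [simp]: "x \<in> S" "y \<in> S" by simp_all
    have "comult R (x \<otimes>\<^bsub>H\<^esub> y) =
        tlift K H H VV (\<lambda>a b. tlift K H H VV (\<lambda>a' b'. ?p (\<pi> (a \<otimes>\<^bsub>H\<^esub> a')) (\<pi> (b \<otimes>\<^bsub>H\<^esub> b'))) (comult H y)) (comult H x)"
      by (simp add: \<Delta>_def)
    also have "\<dots> = tlift K V V VV (\<lambda>a b. tlift K H H VV (\<lambda>a' b'. ?p (\<pi> (a \<otimes>\<^bsub>H\<^esub> a')) (\<pi> (b \<otimes>\<^bsub>H\<^esub> b'))) (comult H y)) (\<Delta> x)"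
      by (rule tlift_\<Delta>[symmetric]) simp_all
    also have "\<dots> = tlift K V V VV (\<lambda>a b. tlift K V V VV (\<lambda>a' b'. ?p (\<pi> (a \<otimes>\<^bsub>H\<^esub> a')) (\<pi> (b \<otimes>\<^bsub>H\<^esub> b'))) (\<Delta> y)) (\<Delta> x)"
      by (intro tlift_cong refl tlift_\<Delta>[symmetric]) simp_all
    also have "\<dots> = tlift K V V VV (\<lambda>a b. tlift K V V VV (\<lambda>a' b'. ?p (a \<otimes>\<^bsub>H\<^esub> a') (b \<otimes>\<^bsub>H\<^esub> b')) (comult R y)) (comult R x)"
      by (intro tlift_cong) simp_all
    finally show "comult R (x \<otimes>\<^bsub>H\<^esub> y) =
        tlift K V V VV (\<lambda>a b. tlift K V V VV (\<lambda>a' b'. ?p (a \<otimes>\<^bsub>H\<^esub> a') (b \<otimes>\<^bsub>H\<^esub> b')) (comult R y)) (comult R x)" .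
    show "counit H (x \<otimes>\<^bsub>H\<^esub> y) = counit H x \<otimes>\<^bsub>K\<^esub> counit H y" by simp
  next
    fix x assume "x \<in> carrier V"
    then have [simp]: "x \<in> S" by simp
    have one: "\<pi> (counit H x \<odot>\<^bsub>H\<^esub> \<one>\<^bsub>H\<^esub>) = counit H x \<odot>\<^bsub>H\<^esub> \<one>\<^bsub>H\<^esub>"
      using V.smult_closed[of "counit H x" "\<one>\<^bsub>H\<^esub>"] by simp
    \<comment> \<open>The sums below take values in \<open>V\<close>. Drawing \<open>\<pi>\<close>
      out reveals the antipode sum of \<open>H\<close>; its value is a multiple of the unit, hence
      fixed by \<open>\<pi>\<close>.\<close>
    have \<pi>: "tlift K H H V (\<lambda>a b. \<pi> (F a b)) (comult H x) = \<pi> (tlift K H H H F (comult H x))"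
      if "bilinear_map K H H H F" for F
      by (rule tlift_push[OF retract_linear, symmetric]) (use that in simp_all)
    have "tlift K V V V (\<lambda>a b. antipode H a \<otimes>\<^bsub>H\<^esub> b) (comult R x) =
        tlift K V V V (\<lambda>a b. \<pi> (antipode H a \<otimes>\<^bsub>H\<^esub> b)) (\<Delta> x)"
      by (rule tlift_cong) simp_all
    also have "\<dots> = tlift K H H V (\<lambda>a b. \<pi> (antipode H a \<otimes>\<^bsub>H\<^esub> b)) (comult H x)"
      by (rule tlift_\<Delta>) simp_all
    also have "\<dots> = counit H x \<odot>\<^bsub>H\<^esub> \<one>\<^bsub>H\<^esub>"
      by (subst \<pi>) (simp_all add: antipode_tlift[OF hopf] one)
    finally show "tlift K V V V (\<lambda>a b. antipode H a \<otimes>\<^bsub>H\<^esub> b) (comult R x) = counit H x \<odot>\<^bsub>V\<^esub> \<one>\<^bsub>H\<^esub>"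
      by simp
    have "tlift K V V V (\<lambda>a b. a \<otimes>\<^bsub>H\<^esub> antipode H b) (comult R x) =
        tlift K V V V (\<lambda>a b. \<pi> (a \<otimes>\<^bsub>H\<^esub> antipode H b)) (\<Delta> x)"
      by (rule tlift_cong) simp_all
    also have "\<dots> = tlift K H H V (\<lambda>a b. \<pi> (a \<otimes>\<^bsub>H\<^esub> antipode H b)) (comult H x)"
      by (rule tlift_\<Delta>) simp_all
    also have "\<dots> = counit H x \<odot>\<^bsub>H\<^esub> \<one>\<^bsub>H\<^esub>"
      by (subst \<pi>) (simp_all add: antipode_tlift[OF hopf] one)
    finally show "tlift K V V V (\<lambda>a b. a \<otimes>\<^bsub>H\<^esub> antipode H b) (comult R x) = counit H x \<odot>\<^bsub>V\<^esub> \<one>\<^bsub>H\<^esub>"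
      by simp
    have "tlift K V V VV (\<lambda>a b. ?p b a) (comult R x) = tlift K H H VV (\<lambda>a b. ?p (\<pi> b) (\<pi> a)) (comult H x)"
      by (simp add: \<Delta>_def)
    also have "\<dots> = comult R x"
      by (subst comult_swap_tlift[OF hopf]) (simp_all add: \<Delta>_def)
    finally show "tlift K V V VV (\<lambda>a b. ?p b a) (comult R x) = comult R x" .
  qed simp_all
qed

end

section \<open>Equalizers of algebra maps\<close>

lemma bilinear_map_linear:
  assumes "bilinear_map K A B C h"
  shows "\<lbrakk>linear_map K X A f; b \<in> carrier B\<rbrakk> \<Longrightarrow> linear_map K X C (\<lambda>x. h (f x) b)"
    and "\<lbrakk>linear_map K X B g; a \<in> carrier A\<rbrakk> \<Longrightarrow> linear_map K X C (\<lambda>x. h a (g x))"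
    and "\<lbrakk>a \<in> carrier A; b \<in> carrier B\<rbrakk> \<Longrightarrow> h a b \<in> carrier C"
proof -
  show "linear_map K X C (\<lambda>x. h (f x) b)" if "linear_map K X A f" "b \<in> carrier B"
    by (rule linear_map_comp[of _ A C "\<lambda>a. h a b"]) (use that assms in auto)
  show "linear_map K X C (\<lambda>x. h a (g x))" if "linear_map K X B g" "a \<in> carrier A"
    by (rule linear_map_comp[of _ B C "h a"]) (use that assms in auto)
  show "\<lbrakk>a \<in> carrier A; b \<in> carrier B\<rbrakk> \<Longrightarrow> h a b \<in> carrier C"
    using assms by (rule bilinear_mapD)
qed

lemma linear_minus [simp]:
  assumes "module K B" "module K A" "linear_map K A B f" "linear_map K A B g"
  shows "linear_map K A B (\<lambda>x. f x \<ominus>\<^bsub>B\<^esub> g x)"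
proof -
  interpret B: module K B by fact
  note D = linear_mapD[OF assms(3)] linear_mapD[OF assms(4)]
  show ?thesis
    by (rule linear_mapI)
      (auto simp: D a_minus_def B.minus_add B.smult_r_distr B.smult_r_minus B.a_ac)
qed

text \<open>Reassociate to the left, interchange the two factors that now come from one
  comultiplication, and reassociate back.\<close>

lemma comult_swap12_tlift:
  assumes H: "cocomm_hopf_algebra K A" and D: "module K D" and x: "x \<in> carrier A" and E: "trilinear_map K A A A D E"
  shows "tlift K A A D (\<lambda>a b. tlift K A A D (E a) (comult A b)) (comult A x) =
    tlift K A A D (\<lambda>a b. tlift K A A D (\<lambda>b\<^sub>1 b\<^sub>2. E b\<^sub>1 a b\<^sub>2) (comult A b)) (comult A x)"
proof -
  note [simp] = D x trilinear_mapD[OF E] H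
  have "tlift K A A D (\<lambda>a b. tlift K A A D (E a) (comult A b)) (comult A x) =
      tlift K A A D (\<lambda>a b. tlift K A A D (\<lambda>a\<^sub>1 a\<^sub>2. E a\<^sub>1 a\<^sub>2 b) (comult A a)) (comult A x)"
    by simp
  also have "\<dots> = tlift K A A D (\<lambda>a b. tlift K A A D (\<lambda>a\<^sub>1 a\<^sub>2. E a\<^sub>2 a\<^sub>1 b) (comult A a)) (comult A x)"
    by (intro tlift_cong refl comult_swap_tlift) simp_all
  also have "\<dots> = tlift K A A D (\<lambda>a b. tlift K A A D (\<lambda>b\<^sub>1 b\<^sub>2. E b\<^sub>1 a b\<^sub>2) (comult A b)) (comult A x)"
    by simp
  finally show ?thesis .
qed

text \<open>\<open>M\<close> enters only as an algebra. What links the equalizer to the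
  comultiplication is the hypothesis \<open>coact\<close>, from which both the retraction and
  stability under the antipode are derived.\<close>

locale hopf_equalizer =
  fixes K :: "('k, 'm) ring_scheme" and H :: "('k, 'a) hopf" and M :: "('k, 'b, 'q) module_scheme"
    and u v :: "'a \<Rightarrow> 'b"
  assumes hopf [simp]: "cocomm_hopf_algebra K H" and alg [simp]: "assoc_algebra K M"
    and u_linear [simp]: "linear_map K H M u" and v_linear [simp]: "linear_map K H M v"
    and u_mult: "\<lbrakk>x \<in> carrier H; y \<in> carrier H\<rbrakk> \<Longrightarrow> u (x \<otimes>\<^bsub>H\<^esub> y) = u x \<otimes>\<^bsub>M\<^esub> u y"
    and v_mult: "\<lbrakk>x \<in> carrier H; y \<in> carrier H\<rbrakk> \<Longrightarrow> v (x \<otimes>\<^bsub>H\<^esub> y) = v x \<otimes>\<^bsub>M\<^esub> v y"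
    and u_one: "u \<one>\<^bsub>H\<^esub> = \<one>\<^bsub>M\<^esub>" and v_one: "v \<one>\<^bsub>H\<^esub> = \<one>\<^bsub>M\<^esub>"
    and coact: "\<lbrakk>x \<in> carrier H; u x = v x\<rbrakk> \<Longrightarrow>
      tlift K H H (tensor_module K M H) (\<lambda>a b. pure_tensor K M H (u a) b) (comult H x) =
      tlift K H H (tensor_module K M H) (\<lambda>a b. pure_tensor K M H (v a) b) (comult H x)"
begin

abbreviation "P \<equiv> {x \<in> carrier H. u x = v x}"

lemma maps_linear [simp]:
  "linear_map K X H g \<Longrightarrow> linear_map K X M (\<lambda>x. u (g x))"
  "linear_map K X H g \<Longrightarrow> linear_map K X M (\<lambda>x. v (g x))"
  by (rule linear_map_comp[OF u_linear], assumption) (rule linear_map_comp[OF v_linear], assumption)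

lemma maps_closed [simp]: "x \<in> carrier H \<Longrightarrow> u x \<in> carrier M" "x \<in> carrier H \<Longrightarrow> v x \<in> carrier M"
  by (rule linear_mapD(1)[OF u_linear] linear_mapD(1)[OF v_linear], assumption)+

declare hopf_simps[OF hopf, simp] assoc_algebra_simps[OF alg, simp]

text \<open>\<open>coact\<close> is an equation in \<open>M \<otimes> H\<close>; applying the linear
  map induced by \<open>G\<close> gives it for every bilinear summand.\<close>

lemma coact_left:
  assumes "x \<in> P" "module K D" "bilinear_map K M H D G"
  shows "tlift K H H D (\<lambda>a b. G (u a) b) (comult H x) = tlift K H H D (\<lambda>a b. G (v a) b) (comult H x)"
proof -
  note [simp] = bilinear_map_linear[OF assms(3)] assms(2)
  have "tlift K M H D G (tlift K H H (tensor_module K M H) (\<lambda>a b. pure_tensor K M H (u a) b) (comult H x)) =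
      tlift K M H D G (tlift K H H (tensor_module K M H) (\<lambda>a b. pure_tensor K M H (v a) b) (comult H x))"
    using coact assms(1) by simp
  then show ?thesis
    using assms(1) by simp
qed

text \<open>Cocommutativity moves the relation from the first tensor factor to the second, so a
  one-sided hypothesis controls both sides.\<close>

lemma coact_right:
  assumes "x \<in> P" "module K D" "bilinear_map K H M D G"
  shows "tlift K H H D (\<lambda>a b. G a (u b)) (comult H x) = tlift K H H D (\<lambda>a b. G a (v b)) (comult H x)"
proof -
  note [simp] = bilinear_map_linear[OF assms(3)] assms(2)
  have "tlift K H H D (\<lambda>a b. G a (u b)) (comult H x) = tlift K H H D (\<lambda>a b. G b (u a)) (comult H x)"
    using assms(1) by (intro comult_swap_tlift) simp_all
  also have "\<dots> = tlift K H H D (\<lambda>a b. G b (v a)) (comult H x)"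
    by (rule coact_left[OF assms(1,2), where G = "\<lambda>m h. G h m"]) simp
  also have "\<dots> = tlift K H H D (\<lambda>a b. G a (v b)) (comult H x)"
    using assms(1) by (intro comult_swap_tlift) simp_all
  finally show ?thesis .
qed

theorem equalizer_retract: "\<exists>\<pi>. hopf_retract K H P \<pi>"
proof -
  have mod [simp]: "module K H" "module K M" by simp_all
  interpret H: module K H by simp
  interpret M: module K M by simp
  note Mmin = minus_zero_iff[OF M.abelian_group_axioms]
  let ?w = "\<lambda>x. u x \<ominus>\<^bsub>M\<^esub> v x"
  have w: "linear_map K H M ?w" by simp
  obtain k where k: "linear_map K M H k" and wkw: "\<And>x. x \<in> carrier H \<Longrightarrow> ?w (k (?w x)) = ?w x"
    using linear_generalized_inverse[OF hopf_field[OF hopf] mod w] by metis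
  have [simp]: "linear_map K X H (\<lambda>x. k (g x))" if "linear_map K X M g" for X :: "(_, 'x, 'xx) module_scheme" and g
    by (rule linear_map_comp[OF k that])
  have [simp]: "k x \<in> carrier H" if "x \<in> carrier M" for x
    using linear_mapD(1)[OF k that] .
  have [simp]: "x \<ominus>\<^bsub>H\<^esub> y \<in> carrier H" if "x \<in> carrier H" "y \<in> carrier H" for x y
    using that by (rule H.minus_closed)
  have [simp]: "x \<ominus>\<^bsub>M\<^esub> y \<in> carrier M" if "x \<in> carrier M" "y \<in> carrier M" for x y
    using that by (rule M.minus_closed)
  \<comment> \<open>Since \<open>w k w = w\<close>, the map \<open>w\<close> vanishes on the image
    of \<open>\<pi>\<close>, so \<open>\<pi>\<close> lands in the equalizer; where \<open>w\<close>
    vanishes, nothing is subtracted, so \<open>\<pi>\<close> is the identity there.\<close>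
  define \<pi> where "\<pi> x = x \<ominus>\<^bsub>H\<^esub> k (?w x)" for x
  have P_eq: "P = {x \<in> carrier H. ?w x = \<zero>\<^bsub>M\<^esub>}"
    using Mmin by auto
  have sub: "submodule P K H"
    unfolding P_eq by (rule submodule_kernel[OF mod w])
  have \<pi>_lin: "linear_map K H H \<pi>"
    unfolding \<pi>_def by simp
  have \<pi>_P: "\<pi> x \<in> P" if x: "x \<in> carrier H" for x
  proof -
    have "?w (\<pi> x) = ?w x \<ominus>\<^bsub>M\<^esub> ?w (k (?w x))"
      unfolding \<pi>_def using x by (intro linear_map_minus[OF mod w]) simp_all
    also have "\<dots> = \<zero>\<^bsub>M\<^esub>"
      using x wkw[OF x] Mmin by simp
    finally show ?thesis
      unfolding P_eq using x by (simp add: \<pi>_def)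
  qed
  have \<pi>_id: "\<pi> x = x" if "x \<in> P" for x
  proof -
    have "?w x = \<zero>\<^bsub>M\<^esub>" using that unfolding P_eq by simp
    then show ?thesis
      using that linear_map_zero[OF mod(2,1) k] unfolding \<pi>_def by (simp add: a_minus_def)
  qed
  have [simp]: "linear_map K X H (\<lambda>x. \<pi> (g x))" if "linear_map K X H g" for X :: "(_, 'x, 'xx) module_scheme" and g
    by (rule linear_map_comp[OF \<pi>_lin that])
  have [simp]: "\<pi> x \<in> carrier H" if "x \<in> carrier H" for x
    using linear_mapD(1)[OF \<pi>_lin that] .
  \<comment> \<open>Expanding \<open>\<pi>\<close> subtracts the sum of \<open>G (k (u a)) b\<close>
    minus the sum of \<open>G (k (v a)) b\<close>, and these two sums agree by
    \<open>coact_left\<close>.\<close>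
  have \<pi>_left: "tlift K H H D (\<lambda>a b. G (\<pi> a) b) (comult H x) = tlift K H H D G (comult H x)"
    if x: "x \<in> P" and D [simp]: "module K D" and G: "bilinear_map K H H D G" for x G and D :: "(_, 'x, 'xx) module_scheme"
  proof -
    interpret D: module K D by fact
    note [simp] = bilinear_map_linear[OF G]
    have xH [simp]: "x \<in> carrier H" using x by simp
    have G_minus: "G (a \<ominus>\<^bsub>H\<^esub> a') b = G a b \<ominus>\<^bsub>D\<^esub> G a' b" if "a \<in> carrier H" "a' \<in> carrier H" "b \<in> carrier H" for a a' b
      using that by (intro linear_map_minus[where f = "\<lambda>a. G a b" and A = H and K = K]) simp_all
    have k_minus: "k (y \<ominus>\<^bsub>M\<^esub> z) = k y \<ominus>\<^bsub>H\<^esub> k z" if "y \<in> carrier M" "z \<in> carrier M" for y z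
      using that by (intro linear_map_minus[OF mod(2,1) k])
    have tlift_minus: "tlift K H H D (\<lambda>a b. F a b \<ominus>\<^bsub>D\<^esub> F' a b) t = tlift K H H D F t \<ominus>\<^bsub>D\<^esub> tlift K H H D F' t"
      if F: "bilinear_map K H H D F" "bilinear_map K H H D F'" and t: "t \<in> carrier (tensor_module K H H)" for F F' t
    proof -
      note [simp] = bilinear_map_linear[OF F(1)] bilinear_map_linear[OF F(2)]
      show ?thesis
        by (rule tensor_ext[where K = K and A = H and B = H and C = D and t = t and
              \<phi> = "tlift K H H D (\<lambda>a b. F a b \<ominus>\<^bsub>D\<^esub> F' a b)"]) (use t in simp_all)
    qed
    have "tlift K H H D (\<lambda>a b. G (\<pi> a) b) (comult H x) =
        tlift K H H D (\<lambda>a b. G a b \<ominus>\<^bsub>D\<^esub> (G (k (u a)) b \<ominus>\<^bsub>D\<^esub> G (k (v a)) b)) (comult H x)"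
      by (simp add: \<pi>_def G_minus k_minus)
    also have "\<dots> = tlift K H H D G (comult H x) \<ominus>\<^bsub>D\<^esub>
        (tlift K H H D (\<lambda>a b. G (k (u a)) b) (comult H x) \<ominus>\<^bsub>D\<^esub> tlift K H H D (\<lambda>a b. G (k (v a)) b) (comult H x))"
      by (simp add: tlift_minus)
    also have "tlift K H H D (\<lambda>a b. G (k (u a)) b) (comult H x) = tlift K H H D (\<lambda>a b. G (k (v a)) b) (comult H x)"
      by (rule coact_left[OF x D, where G = "\<lambda>m h. G (k m) h"]) simp
    finally show ?thesis
      by (simp add: a_minus_def D.r_neg)
  qed
  have \<pi>_right: "tlift K H H D (\<lambda>a b. G a (\<pi> b)) (comult H x) = tlift K H H D G (comult H x)"
    if x: "x \<in> P" and D [simp]: "module K D" and G: "bilinear_map K H H D G" for x G and D :: "(_, 'x, 'xx) module_scheme"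
  proof -
    note [simp] = bilinear_map_linear[OF G]
    have "tlift K H H D (\<lambda>a b. G a (\<pi> b)) (comult H x) = tlift K H H D (\<lambda>a b. G b (\<pi> a)) (comult H x)"
      using x by (intro comult_swap_tlift) simp_all
    also have "\<dots> = tlift K H H D (\<lambda>a b. G b a) (comult H x)"
      by (rule \<pi>_left[OF x D]) simp
    also have "\<dots> = tlift K H H D G (comult H x)"
      using x by (intro comult_swap_tlift[symmetric]) simp_all
    finally show ?thesis .
  qed
  have antipode: "u (antipode H x) = v (antipode H x)" if x: "x \<in> P" for x
  proof -
    have xH [simp]: "x \<in> carrier H" using x by simp
    define J where "J y = tlift K H H M (\<lambda>a b. u (antipode H a) \<otimes>\<^bsub>M\<^esub> v b) (comult H y)" for y
    have J_lin [simp]: "linear_map K X M (\<lambda>x. J (g x))" if "linear_map K X H g" for X :: "(_, 'x, 'xx) module_scheme" and g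
      unfolding J_def using that by simp
    have [simp]: "J y \<in> carrier M" if "y \<in> carrier H" for y
      unfolding J_def using that by simp
    have J_P: "J y = counit H y \<odot>\<^bsub>M\<^esub> \<one>\<^bsub>M\<^esub>" if y: "y \<in> P" for y
    proof -
      have [simp]: "y \<in> carrier H" using y by simp
      \<comment> \<open>On the equalizer \<open>v\<close> may be exchanged for \<open>u\<close>;
        multiplicativity of \<open>u\<close> then leaves the antipode law of \<open>H\<close> inside
        \<open>u\<close>.\<close>
      have "J y = tlift K H H M (\<lambda>a b. u (antipode H a) \<otimes>\<^bsub>M\<^esub> u b) (comult H y)"
        unfolding J_def by (rule coact_right[where G = "\<lambda>a m. u (antipode H a) \<otimes>\<^bsub>M\<^esub> m", OF y, symmetric]) simp_all
      also have "\<dots> = tlift K H H M (\<lambda>a b. u (antipode H a \<otimes>\<^bsub>H\<^esub> b)) (comult H y)"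
        by (simp add: u_mult)
      also have "\<dots> = u (tlift K H H H (\<lambda>a b. antipode H a \<otimes>\<^bsub>H\<^esub> b) (comult H y))"
        by (rule tlift_push[OF u_linear, symmetric]) simp_all
      also have "\<dots> = counit H y \<odot>\<^bsub>M\<^esub> \<one>\<^bsub>M\<^esub>"
        by (simp add: antipode_tlift[OF hopf] linear_mapD(3)[OF u_linear] u_one)
      finally show ?thesis .
    qed
    have v_anti: "tlift K H H M (\<lambda>a b. v a \<otimes>\<^bsub>M\<^esub> v (antipode H b)) (comult H y) = counit H y \<odot>\<^bsub>M\<^esub> \<one>\<^bsub>M\<^esub>"
      if [simp]: "y \<in> carrier H" for y
    proof -
      have "tlift K H H M (\<lambda>a b. v a \<otimes>\<^bsub>M\<^esub> v (antipode H b)) (comult H y) =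
          tlift K H H M (\<lambda>a b. v (a \<otimes>\<^bsub>H\<^esub> antipode H b)) (comult H y)"
        by (simp add: v_mult)
      also have "\<dots> = v (tlift K H H H (\<lambda>a b. a \<otimes>\<^bsub>H\<^esub> antipode H b) (comult H y))"
        by (rule tlift_push[OF v_linear, symmetric]) simp_all
      also have "\<dots> = counit H y \<odot>\<^bsub>M\<^esub> \<one>\<^bsub>M\<^esub>"
        by (simp add: antipode_tlift[OF hopf] linear_mapD(3)[OF v_linear] v_one)
      finally show ?thesis .
    qed
    \<comment> \<open>\<open>u \<circ> S = (u \<circ> S) * (v * (v \<circ> S)) = ((u \<circ> S) * v) * (v \<circ> S) = v \<circ> S\<close> on the equalizer, with \<open>J = (u \<circ> S) * v\<close>\<close>
    have "u (antipode H x) = tlift K H H M (\<lambda>a b. counit H b \<odot>\<^bsub>M\<^esub> u (antipode H a)) (comult H x)"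
      by simp
    also have "\<dots> = tlift K H H M (\<lambda>a b. u (antipode H a) \<otimes>\<^bsub>M\<^esub>
        tlift K H H M (\<lambda>b\<^sub>1 b\<^sub>2. v b\<^sub>1 \<otimes>\<^bsub>M\<^esub> v (antipode H b\<^sub>2)) (comult H b)) (comult H x)"
      by (rule tlift_cong) (simp_all add: v_anti)
    also have "\<dots> = tlift K H H M (\<lambda>a b. J a \<otimes>\<^bsub>M\<^esub> v (antipode H b)) (comult H x)"
      unfolding J_def by simp
    \<comment> \<open>\<open>J\<close> is known only on the equalizer, while \<open>a\<close> ranges
      over \<open>H\<close>. The retraction is inserted by \<open>\<pi>_left\<close>, the value of
      \<open>J\<close> is used, and the retraction is removed again.\<close>
    also have "\<dots> = tlift K H H M (\<lambda>a b. J (\<pi> a) \<otimes>\<^bsub>M\<^esub> v (antipode H b)) (comult H x)"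
      by (rule \<pi>_left[OF x, symmetric]) simp_all
    also have "\<dots> = tlift K H H M (\<lambda>a b. counit H (\<pi> a) \<odot>\<^bsub>M\<^esub> v (antipode H b)) (comult H x)"
      by (rule tlift_cong) (simp_all add: J_P[OF \<pi>_P])
    also have "\<dots> = tlift K H H M (\<lambda>a b. counit H a \<odot>\<^bsub>M\<^esub> v (antipode H b)) (comult H x)"
      by (rule \<pi>_left[OF x]) simp_all
    also have "\<dots> = v (antipode H x)"
      by simp
    finally show ?thesis .
  qed
  have "hopf_retract K H P \<pi>"
  proof (rule hopf_retract.intro)
    show "linear_map K H (H\<lparr>carrier := P\<rparr>) \<pi>"
      using \<pi>_lin \<pi>_P by (auto simp: linear_map_def)
    show "tlift K H H (tensor_module K H H) (\<lambda>a b. pure_tensor K H H (\<pi> a) (\<pi> b)) (comult H x) = comult H x"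
      if x: "x \<in> P" for x
    proof -
      have [simp]: "x \<in> carrier H" using x by simp
      have "tlift K H H (tensor_module K H H) (\<lambda>a b. pure_tensor K H H (\<pi> a) (\<pi> b)) (comult H x) =
          tlift K H H (tensor_module K H H) (\<lambda>a b. pure_tensor K H H a (\<pi> b)) (comult H x)"
        by (rule \<pi>_left[OF x]) simp_all
      also have "\<dots> = tlift K H H (tensor_module K H H) (pure_tensor K H H) (comult H x)"
        by (rule \<pi>_right[OF x]) simp_all
      finally show ?thesis by simp
    qed
  qed (simp_all add: sub \<pi>_id u_mult v_mult u_one v_one antipode)
  then show ?thesis by blast
qed

end

section \<open>Pullbacks\<close>

lemma coalgebra_hom_rules:
  assumes f: "coalgebra_hom K A B f" and A: "coalgebra K A" and B: "coalgebra K B"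
  shows "linear_map K X A h \<Longrightarrow> linear_map K X B (\<lambda>x. f (h x))"
    and "x \<in> carrier A \<Longrightarrow> f x \<in> carrier B"
    and "x \<in> carrier A \<Longrightarrow> counit B (f x) = counit A x"
    and "\<lbrakk>x \<in> carrier A; module K D; bilinear_map K B B D F\<rbrakk> \<Longrightarrow>
      tlift K B B D F (comult B (f x)) = tlift K A A D (\<lambda>a b. F (f a) (f b)) (comult A x)"
proof -
  have lin: "linear_map K A B f" using f by (simp add: coalgebra_hom_def)
  show lin': "linear_map K X A h \<Longrightarrow> linear_map K X B (\<lambda>x. f (h x))" for X :: "(_, 'x, 'xx) module_scheme" and h
    by (rule linear_map_comp[OF lin])
  show cl: "x \<in> carrier A \<Longrightarrow> f x \<in> carrier B" for x
    by (rule linear_mapD(1)[OF lin])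
  show "x \<in> carrier A \<Longrightarrow> counit B (f x) = counit A x"
    using f by (simp add: coalgebra_hom_def)
  show "tlift K B B D F (comult B (f x)) = tlift K A A D (\<lambda>a b. F (f a) (f b)) (comult A x)"
    if [simp]: "x \<in> carrier A" "module K D" and F: "bilinear_map K B B D F"
  proof -
    note [simp] = A B lin lin' cl
    have "comult B (f x) = tensor_map K B B f f (comult A x)"
      using f by (simp add: coalgebra_hom_def)
    also have "\<dots> = tlift K A A (tensor_module K B B) (\<lambda>a b. pure_tensor K B B (f a) (f b)) (comult A x)"
      by (rule tensor_map_tlift) simp_all
    finally show ?thesis using F by simp
  qed
qed

lemma coalgebra_homI:
  assumes "coalgebra K A" "coalgebra K B" "linear_map K A B f"
    and "\<And>x. x \<in> carrier A \<Longrightarrow> comult B (f x) =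
      tlift K A A (tensor_module K B B) (\<lambda>a b. pure_tensor K B B (f a) (f b)) (comult A x)"
    and "\<And>x. x \<in> carrier A \<Longrightarrow> counit B (f x) = counit A x"
  shows "coalgebra_hom K A B f"
  unfolding coalgebra_hom_def using assms by (simp add: tensor_map_tlift[where A = A and B = A])

locale pullback_pair =
  fixes K :: "('k, 'm) ring_scheme" and A :: "('k, 'a) hopf" and B :: "('k, 'b) hopf" and C :: "('k, 'c) hopf"
    and f :: "'a \<Rightarrow> 'c" and g :: "'b \<Rightarrow> 'c"
  assumes f: "hopf_coc_hom K A C f" and g: "hopf_coc_hom K B C g"
begin

lemma hopf [simp]: "cocomm_hopf_algebra K A" "cocomm_hopf_algebra K B" "cocomm_hopf_algebra K C"
  using f g by (simp_all add: hopf_coc_hom_def)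

lemma hom: "coalgebra_hom K A C f" "coalgebra_hom K B C g"
  using f g by (simp_all add: hopf_coc_hom_def)

declare hopf_simps[OF hopf(1), simp] hopf_simps[OF hopf(2), simp] hopf_simps[OF hopf(3), simp]

lemmas hom_rules [simp] =
  coalgebra_hom_rules[OF hom(1) bialgebra_coalgebra[OF hopf_bialgebra[OF hopf(1)]]
    bialgebra_coalgebra[OF hopf_bialgebra[OF hopf(3)]]]
  coalgebra_hom_rules[OF hom(2) bialgebra_coalgebra[OF hopf_bialgebra[OF hopf(2)]]
    bialgebra_coalgebra[OF hopf_bialgebra[OF hopf(3)]]]

lemma hom_mult [simp]:
  "\<lbrakk>x \<in> carrier A; y \<in> carrier A\<rbrakk> \<Longrightarrow> f (x \<otimes>\<^bsub>A\<^esub> y) = f x \<otimes>\<^bsub>C\<^esub> f y" "f \<one>\<^bsub>A\<^esub> = \<one>\<^bsub>C\<^esub>"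
  "\<lbrakk>x' \<in> carrier B; y' \<in> carrier B\<rbrakk> \<Longrightarrow> g (x' \<otimes>\<^bsub>B\<^esub> y') = g x' \<otimes>\<^bsub>C\<^esub> g y'" "g \<one>\<^bsub>B\<^esub> = \<one>\<^bsub>C\<^esub>"
  using f g by (auto simp: hopf_coc_hom_def ring_hom_def)

abbreviation "T \<equiv> tensor_module K A B"
abbreviation "TT \<equiv> tensor_module K T T"
abbreviation "CB \<equiv> tensor_module K C B"
abbreviation "W \<equiv> tensor_module K A CB"
abbreviation "H \<equiv> tensor_hopf K A B"
abbreviation "M \<equiv> tensor_algebra K A (tensor_algebra K C B)"
abbreviation "w a c b \<equiv> pure_tensor K A CB a (pure_tensor K C B c b)"

definition "u = tlift K A B W (\<lambda>a b. tlift K A A W (\<lambda>a\<^sub>1 a\<^sub>2. w a\<^sub>1 (f a\<^sub>2) b) (comult A a))"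
definition "v = tlift K A B W (\<lambda>a b. tlift K B B W (\<lambda>b\<^sub>1 b\<^sub>2. w a (g b\<^sub>1) b\<^sub>2) (comult B b))"

lemma pullback_carrier_eq: "pullback_carrier K A B C f g = {t \<in> carrier T. u t = v t}"
proof -
  have "tensor_lift K W (\<lambda>a b. tensor_lift K W (\<lambda>a\<^sub>1 a\<^sub>2. w a\<^sub>1 (f a\<^sub>2) b) (comult A a)) t = u t"
    "tensor_lift K W (\<lambda>a b. tensor_lift K W (\<lambda>b\<^sub>1 b\<^sub>2. w a (g b\<^sub>1) b\<^sub>2) (comult B b)) t = v t"
    if "t \<in> carrier T" for t
    unfolding u_def v_def using that
    by (intro tensor_lift_tliftI; (intro tensor_lift_tlift)?; simp)+
  then show ?thesis
    by (auto simp: pullback_carrier_def Let_def)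
qed

lemma uv_linear [simp]: "linear_map K T W u" "linear_map K T W v"
  unfolding u_def v_def by simp_all

lemma uv_linear_comp [simp]:
  "linear_map K X T h \<Longrightarrow> linear_map K X W (\<lambda>x. u (h x))"
  "linear_map K X T h \<Longrightarrow> linear_map K X W (\<lambda>x. v (h x))"
  by (rule linear_map_comp[OF uv_linear(1)], assumption) (rule linear_map_comp[OF uv_linear(2)], assumption)

lemma uv_closed [simp]: "x \<in> carrier T \<Longrightarrow> u x \<in> carrier W" "x \<in> carrier T \<Longrightarrow> v x \<in> carrier W"
  by (rule linear_mapD(1)[OF uv_linear(1)], assumption) (rule linear_mapD(1)[OF uv_linear(2)], assumption)

lemma u_pure [simp]:
  "\<lbrakk>a \<in> carrier A; b \<in> carrier B\<rbrakk> \<Longrightarrow>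
    u (pure_tensor K A B a b) = tlift K A A W (\<lambda>a\<^sub>1 a\<^sub>2. w a\<^sub>1 (f a\<^sub>2) b) (comult A a)"
  unfolding u_def by simp

lemma v_pure [simp]:
  "\<lbrakk>a \<in> carrier A; b \<in> carrier B\<rbrakk> \<Longrightarrow>
    v (pure_tensor K A B a b) = tlift K B B W (\<lambda>b\<^sub>1 b\<^sub>2. w a (g b\<^sub>1) b\<^sub>2) (comult B b)"
  unfolding v_def by simp

declare assoc_algebra_simps[OF tensor_algebra_assoc_algebra[OF bialgebra_assoc_algebra[OF hopf_bialgebra[OF hopf(1)]]
    bialgebra_assoc_algebra[OF hopf_bialgebra[OF hopf(2)]]], unfolded tensor_algebra_rules, simp]
declare assoc_algebra_simps[OF tensor_algebra_assoc_algebra[OF bialgebra_assoc_algebra[OF hopf_bialgebra[OF hopf(3)]]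
    bialgebra_assoc_algebra[OF hopf_bialgebra[OF hopf(2)]]], unfolded tensor_algebra_rules, simp]
declare linear_mult[OF tensor_algebra_assoc_algebra[OF bialgebra_assoc_algebra[OF hopf_bialgebra[OF hopf(1)]]
    bialgebra_assoc_algebra[OF hopf_bialgebra[OF hopf(2)]]], unfolded tensor_algebra_rules, simp]
declare linear_mult[OF tensor_algebra_assoc_algebra[OF bialgebra_assoc_algebra[OF hopf_bialgebra[OF hopf(3)]]
    bialgebra_assoc_algebra[OF hopf_bialgebra[OF hopf(2)]]], unfolded tensor_algebra_rules, simp]

lemma M_alg [simp]: "assoc_algebra K M" by simp

declare linear_mult[OF M_alg, unfolded tensor_algebra_rules, simp]

text \<open>On pure tensors this is multiplicativity of \<open>comult A\<close> and \<open>f\<close>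
  for \<open>u\<close>, and of \<open>comult B\<close> and \<open>g\<close> for
  \<open>v\<close>.\<close>

lemma uv_mult:
  assumes "x \<in> carrier T" "y \<in> carrier T"
  shows "u (x \<otimes>\<^bsub>tensor_algebra K A B\<^esub> y) = u x \<otimes>\<^bsub>M\<^esub> u y"
    and "v (x \<otimes>\<^bsub>tensor_algebra K A B\<^esub> y) = v x \<otimes>\<^bsub>M\<^esub> v y"
proof -
  show "u (x \<otimes>\<^bsub>tensor_algebra K A B\<^esub> y) = u x \<otimes>\<^bsub>M\<^esub> u y"
    by (rule tensor_ext2[where K = K and A = A and B = B and A' = A and B' = B and C = W and s = x and t = y
          and \<phi> = "\<lambda>x y. u (x \<otimes>\<^bsub>tensor_algebra K A B\<^esub> y)" and \<psi> = "\<lambda>x y. u x \<otimes>\<^bsub>M\<^esub> u y"])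
      (use assms in simp_all)
  show "v (x \<otimes>\<^bsub>tensor_algebra K A B\<^esub> y) = v x \<otimes>\<^bsub>M\<^esub> v y"
    by (rule tensor_ext2[where K = K and A = A and B = B and A' = A and B' = B and C = W and s = x and t = y
          and \<phi> = "\<lambda>x y. v (x \<otimes>\<^bsub>tensor_algebra K A B\<^esub> y)" and \<psi> = "\<lambda>x y. v x \<otimes>\<^bsub>M\<^esub> v y"])
      (use assms in simp_all)
qed


section \<open>The map relating \<open>u\<close> and \<open>v\<close> to the comultiplication of
  \<open>A \<otimes> B\<close>\<close>

abbreviation "\<Delta> \<equiv> tensor_comult K A B"
abbreviation "WT \<equiv> tensor_module K W T"
abbreviation "p a b \<equiv> pure_tensor K A B a b"

definition "\<Phi> = tlift K A CB WT (\<lambda>a s. tlift K C B WT (\<lambda>c b. tlift K A A WT (\<lambda>a\<^sub>1 a\<^sub>2. tlift K B B WT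
  (\<lambda>b\<^sub>1 b\<^sub>2. pure_tensor K W T (w a\<^sub>1 c b\<^sub>1) (p a\<^sub>2 b\<^sub>2)) (comult B b)) (comult A a)) s)"

lemma \<Phi>_linear [simp]: "linear_map K W WT \<Phi>"
  unfolding \<Phi>_def by simp

lemma \<Phi>_pure [simp]:
  "\<lbrakk>a \<in> carrier A; c \<in> carrier C; b \<in> carrier B\<rbrakk> \<Longrightarrow> \<Phi> (w a c b) = tlift K A A WT (\<lambda>a\<^sub>1 a\<^sub>2. tlift K B B WT
  (\<lambda>b\<^sub>1 b\<^sub>2. pure_tensor K W T (w a\<^sub>1 c b\<^sub>1) (p a\<^sub>2 b\<^sub>2)) (comult B b)) (comult A a)"
  unfolding \<Phi>_def by simp

lemma \<Phi>_linear_comp [simp]: "linear_map K X W h \<Longrightarrow> linear_map K X WT (\<lambda>x. \<Phi> (h x))"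
  by (rule linear_map_comp[OF \<Phi>_linear])

lemma \<Phi>_tlift [simp]:
  assumes "module K X" "module K Y" "bilinear_map K X Y W h" "t \<in> carrier (tensor_module K X Y)"
  shows "\<Phi> (tlift K X Y W h t) = tlift K X Y WT (\<lambda>x y. \<Phi> (h x y)) t"
  by (rule tlift_push[OF \<Phi>_linear]) (use assms in simp_all)

lemma swap_AB [simp]:
  assumes "module K E" "a \<in> carrier A" "b \<in> carrier B"
    and "\<forall>a\<in>carrier A. \<forall>b\<in>carrier A. bilinear_map K B B E (\<lambda>c d. F c d a b)"
    and "\<forall>c\<in>carrier B. \<forall>d\<in>carrier B. bilinear_map K A A E (F c d)"
  shows "tlift K B B E (\<lambda>c d. tlift K A A E (F c d) (comult A a)) (comult B b) =
    tlift K A A E (\<lambda>a b'. tlift K B B E (\<lambda>c d. F c d a b') (comult B b)) (comult A a)"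
  by (rule tlift_comult_swap) (use assms in simp_all)

text \<open>After expansion \<open>f\<close> stands on the third Sweedler factor of
  \<open>a\<close>, whereas the right-hand side needs it on the second; cocommutativity of
  \<open>A\<close> interchanges the two.\<close>

lemma \<Phi>_u:
  assumes "t \<in> carrier T"
  shows "\<Phi> (u t) = tlift K T T WT (\<lambda>a b. pure_tensor K W T (u a) b) (\<Delta> t)"
proof (rule tensor_ext[where K = K and A = A and B = B and C = WT and t = t and \<phi> = "\<lambda>t. \<Phi> (u t)"])
  fix a b assume [simp]: "a \<in> carrier A" "b \<in> carrier B"
  let ?q = "\<lambda>a\<^sub>1 a\<^sub>2 a\<^sub>3. tlift K B B WT (\<lambda>b\<^sub>1 b\<^sub>2. pure_tensor K W T (w a\<^sub>1 (f a\<^sub>2) b\<^sub>1) (p a\<^sub>3 b\<^sub>2)) (comult B b)"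
  have "\<Phi> (u (p a b)) = tlift K A A WT (\<lambda>a\<^sub>1 a\<^sub>2. tlift K A A WT (\<lambda>b\<^sub>1 b\<^sub>2. ?q a\<^sub>1 b\<^sub>2 b\<^sub>1) (comult A a\<^sub>2)) (comult A a)"
    by simp
  also have "\<dots> = tlift K A A WT (\<lambda>a\<^sub>1 a\<^sub>2. tlift K A A WT (?q a\<^sub>1) (comult A a\<^sub>2)) (comult A a)"
    by (intro tlift_cong refl comult_swap_tlift) simp_all
  also have "\<dots> = tlift K T T WT (\<lambda>a b. pure_tensor K W T (u a) b) (\<Delta> (p a b))"
    by (simp add: Let_def)
  finally show "\<Phi> (u (p a b)) = tlift K T T WT (\<lambda>a b. pure_tensor K W T (u a) b) (\<Delta> (p a b))" .
qed (use assms in simp_all)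

text \<open>Here \<open>g\<close> already stands on the first factor of \<open>b\<close> on both
  sides, so the coassociative normal forms coincide.\<close>

lemma \<Phi>_v:
  assumes "t \<in> carrier T"
  shows "\<Phi> (v t) = tlift K T T WT (\<lambda>a b. pure_tensor K W T (v a) b) (\<Delta> t)"
  by (rule tensor_ext[where K = K and A = A and B = B and C = WT and t = t and \<phi> = "\<lambda>t. \<Phi> (v t)"])
    (use assms in \<open>simp_all add: Let_def\<close>)

sublocale hopf_equalizer K H M u v
proof (rule hopf_equalizer.intro; (unfold tensor_hopf_rules tensor_algebra_rules tensor_hopf_one_mult)?)
  show "u (x \<otimes>\<^bsub>tensor_algebra K A B\<^esub> y) = u x \<otimes>\<^bsub>M\<^esub> u y"
    "v (x \<otimes>\<^bsub>tensor_algebra K A B\<^esub> y) = v x \<otimes>\<^bsub>M\<^esub> v y"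
    if "x \<in> carrier T" "y \<in> carrier T" for x y
    using that by (rule uv_mult)+
  \<comment> \<open>Both sides are values of \<open>\<Phi>\<close>, at \<open>u x\<close> and at
    \<open>v x\<close>, which are equal by assumption.\<close>
  show "tlift K T T WT (\<lambda>a b. pure_tensor K W T (u a) b) (comult H x) =
      tlift K T T WT (\<lambda>a b. pure_tensor K W T (v a) b) (comult H x)"
    if "x \<in> carrier T" "u x = v x" for x
    using that \<Phi>_u[of x] \<Phi>_v[of x] by simp
qed simp_all

definition "PB = {t \<in> carrier T. u t = v t}"

text \<open>The equalizer theorem asserts only existence; one retraction is chosen so that the
  results on retracts become available for the pullback.\<close>

definition "\<pi> = (SOME \<pi>. hopf_retract K H PB \<pi>)"

lemma retract_PB: "hopf_retract K H PB \<pi>"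
  unfolding \<pi>_def using equalizer_retract by (intro someI_ex[where P = "hopf_retract K H PB"]) (simp add: PB_def)

lemma pullback_eq: "pullback K A B C f g = sub_hopf K H PB"
  by (simp add: pullback_def pullback_carrier_eq PB_def)

end

lemma comult_smult:
  "\<lbrakk>coalgebra K A; c \<in> carrier K; x \<in> carrier A\<rbrakk> \<Longrightarrow>
    comult A (c \<odot>\<^bsub>A\<^esub> x) = c \<odot>\<^bsub>tensor_module K A A\<^esub> comult A x"
  by (rule linear_mapD(3)[OF coalgebra.comult_linear])

section \<open>The projection to \<open>B\<close> and its coalgebra section\<close>

context pullback_pair
begin

sublocale R: hopf_retract K H PB \<pi>
  by (rule retract_PB)

definition "q = tlift K A B B (\<lambda>a b. counit A a \<odot>\<^bsub>B\<^esub> b)"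

lemma PB_T [simp]: "x \<in> PB \<Longrightarrow> x \<in> carrier T"
  by (simp add: PB_def)

lemma q_eq: "t \<in> carrier T \<Longrightarrow> pullback_snd K A B t = q t"
  unfolding q_def pullback_snd_def by (rule tensor_lift_tlift) simp_all

lemma q_linear [simp]: "linear_map K T B q"
  unfolding q_def by simp

lemma q_linear_comp [simp]: "linear_map K X T h \<Longrightarrow> linear_map K X B (\<lambda>x. q (h x))"
  by (rule linear_map_comp[OF q_linear])

lemma q_closed [simp]: "x \<in> carrier T \<Longrightarrow> q x \<in> carrier B"
  by (rule linear_mapD(1)[OF q_linear])

lemma q_pure [simp]: "\<lbrakk>a \<in> carrier A; b \<in> carrier B\<rbrakk> \<Longrightarrow> q (p a b) = counit A a \<odot>\<^bsub>B\<^esub> b"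
  unfolding q_def by simp

lemma cring_K [simp]: "cring K"
  using hopf_field[OF hopf(1)] by (simp add: field_def domain_def)

lemma q_mult:
  assumes "x \<in> carrier T" "y \<in> carrier T"
  shows "q (x \<otimes>\<^bsub>tensor_algebra K A B\<^esub> y) = q x \<otimes>\<^bsub>B\<^esub> q y"
proof -
  interpret K: cring K by simp
  interpret B: module K B by simp
  show ?thesis
    by (rule tensor_ext2[where K = K and A = A and B = B and A' = A and B' = B and C = B and s = x and t = y
          and \<phi> = "\<lambda>x y. q (x \<otimes>\<^bsub>tensor_algebra K A B\<^esub> y)" and \<psi> = "\<lambda>x y. q x \<otimes>\<^bsub>B\<^esub> q y"])
      (use assms in \<open>simp_all add: K.m_comm flip: B.smult_assoc1\<close>)
qed

lemma q_counit:
  assumes "x \<in> carrier T"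
  shows "counit B (q x) = counit H x"
proof -
  have "counit B (q x) = tlift K A B (ground_module K) (\<lambda>a b. counit A a \<otimes>\<^bsub>K\<^esub> counit B b) x"
    by (rule tensor_ext[where K = K and A = A and B = B and C = "ground_module K" and t = x
        and \<phi> = "\<lambda>x. counit B (q x)"]) (use assms in \<open>simp_all add: counit_smult\<close>)
  then show ?thesis using assms by simp
qed

lemma q_comult:
  assumes "x \<in> carrier T"
  shows "comult B (q x) = tlift K T T (tensor_module K B B) (\<lambda>a b. pure_tensor K B B (q a) (q b)) (\<Delta> x)"
  by (rule tensor_ext[where K = K and A = A and B = B and C = "tensor_module K B B" and t = x
        and \<phi> = "\<lambda>x. comult B (q x)"])
    (use assms in \<open>simp_all add: comult_smult Let_def smult_tlift[symmetric]\<close>)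

lemma q_hom: "hopf_coc_hom K R.R B (pullback_snd K A B)"
  unfolding hopf_coc_hom_def
proof (intro conjI)
  show R: "cocomm_hopf_algebra K R.R" by (rule R.hopf_R)
  show "coalgebra_hom K R.R B (pullback_snd K A B)"
  proof (rule coalgebra_homI; (unfold sub_hopf_rules sub_hopf_sel)?)
    show "coalgebra K R.R" using R by simp
    have "linear_map K R.V B q"
      using q_linear by (rule linear_map_comp) (simp add: linear_map_def)
    then show "linear_map K R.V B (pullback_snd K A B)"
      by (rule linear_map_cong[rotated]) (simp_all add: q_eq)
    fix x assume "x \<in> carrier R.V"
    then have x: "x \<in> PB" by simp
    then show "counit B (pullback_snd K A B x) = counit H x"
      by (simp add: q_eq q_counit del: tensor_hopf_counit)
    have "comult B (pullback_snd K A B x) = tlift K T T (tensor_module K B B) (\<lambda>a b. pure_tensor K B B (q a) (q b)) (\<Delta> x)"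
      using x by (simp add: q_eq q_comult)
    also have "\<dots> = tlift K H H (tensor_module K B B) (\<lambda>a b. pure_tensor K B B (q a) (q b)) (comult H x)"
      using x by simp
    \<comment> \<open>\<open>q\<close> is defined on all of \<open>A \<otimes> B\<close>, so the sum
      over the tensor product can be exchanged for one over the pullback.\<close>
    also have "\<dots> = tlift K R.V R.V (tensor_module K B B) (\<lambda>a b. pure_tensor K B B (q a) (q b)) (R.\<Delta> x)"
      by (rule R.tlift_\<Delta>[symmetric]) (use x in simp_all)
    also have "\<dots> = tlift K R.V R.V (tensor_module K B B)
        (\<lambda>a b. pure_tensor K B B (pullback_snd K A B a) (pullback_snd K A B b)) (comult R.R x)"
      by (rule tlift_cong) (use x in \<open>simp_all add: q_eq R.comult_sub\<close>)
    finally show "comult B (pullback_snd K A B x) = tlift K R.V R.V (tensor_module K B B)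
        (\<lambda>a b. pure_tensor K B B (pullback_snd K A B a) (pullback_snd K A B b)) (comult R.R x)" .
  qed simp
  show "pullback_snd K A B \<in> ring_hom R.R B"
  proof (rule ring_hom_memI; (unfold sub_hopf_rules sub_hopf_sel tensor_hopf_one_mult)?)
    have cl: "x \<otimes>\<^bsub>tensor_algebra K A B\<^esub> y \<in> carrier T" if "x \<in> PB" "y \<in> PB" for x y
      using R.mult_closed[OF that] by (simp only: tensor_hopf_one_mult PB_T)
    fix x y assume "x \<in> carrier R.V" "y \<in> carrier R.V"
    then have xy: "x \<in> PB" "y \<in> PB" by simp_all
    then show "pullback_snd K A B x \<in> carrier B" by (simp add: q_eq)
    show "pullback_snd K A B (x \<oplus>\<^bsub>R.V\<^esub> y) = pullback_snd K A B x \<oplus>\<^bsub>B\<^esub> pullback_snd K A B y"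
    proof -
      have "x \<oplus>\<^bsub>T\<^esub> y \<in> PB"
        using submodule_simps(3)[OF R.submodule _ xy] by simp
      then show ?thesis using xy linear_mapD(2)[OF q_linear] by (simp add: q_eq)
    qed
    show "pullback_snd K A B (x \<otimes>\<^bsub>tensor_algebra K A B\<^esub> y) = pullback_snd K A B x \<otimes>\<^bsub>B\<^esub> pullback_snd K A B y"
      using xy cl[OF xy] by (simp only: q_eq PB_T q_mult)
  next
    interpret B: module K B by simp
    show "pullback_snd K A B (p \<one>\<^bsub>A\<^esub> \<one>\<^bsub>B\<^esub>) = \<one>\<^bsub>B\<^esub>" by (simp add: q_eq)
  qed
qed simp

lemma pullback_snd_section:
  assumes s: "coalgebra_hom K C A s" and fs: "\<And>c. c \<in> carrier C \<Longrightarrow> f (s c) = c"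
  obtains \<sigma> where "coalgebra_hom K B R.R \<sigma>" "\<And>b. b \<in> carrier B \<Longrightarrow> pullback_snd K A B (\<sigma> b) = b"
proof
  note [simp] = coalgebra_hom_rules[OF s] fs
  define \<sigma> where "\<sigma> = (\<lambda>b. tlift K B B T (\<lambda>b\<^sub>1 b\<^sub>2. p (s (g b\<^sub>1)) b\<^sub>2) (comult B b))"
  have \<sigma>_lin [simp]: "linear_map K X T (\<lambda>x. \<sigma> (h x))" if "linear_map K X B h" for X :: "(_, 'x, 'xx) module_scheme" and h
    unfolding \<sigma>_def using that by simp
  have \<sigma>_closed [simp]: "\<sigma> b \<in> carrier T" if "b \<in> carrier B" for b
    unfolding \<sigma>_def using that by simp
  have push: "\<psi> (\<sigma> b) = tlift K B B D (\<lambda>b\<^sub>1 b\<^sub>2. \<psi> (p (s (g b\<^sub>1)) b\<^sub>2)) (comult B b)"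
    if "linear_map K T D \<psi>" "module K D" "b \<in> carrier B" for \<psi> b and D :: "(_, 'x, 'xx) module_scheme"
    unfolding \<sigma>_def using that by (intro tlift_push) simp_all
  \<comment> \<open>Both \<open>u (\<sigma> b)\<close> and \<open>v (\<sigma> b)\<close> become the
    sum of \<open>s (g b\<^sub>1) \<otimes> g b\<^sub>2 \<otimes> b\<^sub>3\<close>: for
    \<open>u\<close> because \<open>s\<close> and \<open>g\<close> preserve comultiplication and
    \<open>f\<close> undoes \<open>s\<close>, for \<open>v\<close> by coassociativity.\<close>
  have \<sigma>_PB [simp]: "\<sigma> b \<in> PB" if [simp]: "b \<in> carrier B" for b
    unfolding PB_def by (simp add: push[OF uv_linear(1)] push[OF uv_linear(2)])
  \<comment> \<open>Compatibility of \<open>\<sigma>\<close> with comultiplication, for any bilinear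
    \<open>G\<close>: below it is applied with \<open>\<pi>\<close> in both arguments, as the
    comultiplication of the pullback requires.\<close>
  have key: "tlift K T T D G (\<Delta> (\<sigma> b)) = tlift K B B D (\<lambda>b\<^sub>1 b\<^sub>2. G (\<sigma> b\<^sub>1) (\<sigma> b\<^sub>2)) (comult B b)"
    if [simp]: "b \<in> carrier B" "module K D" and G: "bilinear_map K T T D G" for b G and D :: "(_, 'x, 'xx) module_scheme"
  proof -
    note [simp] = bilinear_map_linear[OF G]
    let ?E = "\<lambda>b\<^sub>1 b\<^sub>2 b\<^sub>3 b\<^sub>4. G (p (s (g b\<^sub>1)) b\<^sub>2) (p (s (g b\<^sub>3)) b\<^sub>4)"
    have "tlift K T T D G (\<Delta> (\<sigma> b)) = tlift K B B D (\<lambda>b\<^sub>1 r. tlift K B B D (\<lambda>b\<^sub>2 r'. tlift K B B D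
        (\<lambda>b\<^sub>3 b\<^sub>4. ?E b\<^sub>1 b\<^sub>3 b\<^sub>2 b\<^sub>4) (comult B r')) (comult B r)) (comult B b)"
      by (subst push[of D "\<lambda>t. tlift K T T D G (\<Delta> t)"]) (simp_all add: Let_def)
    \<comment> \<open>Comultiplying \<open>s (g b\<^sub>1)\<close> and \<open>b\<^sub>2\<close>
      separately leaves the two middle factors of \<open>b\<close> in the wrong order;
      cocommutativity of \<open>B\<close> interchanges them.\<close>
    also have "\<dots> = tlift K B B D (\<lambda>b\<^sub>1 r. tlift K B B D (\<lambda>b\<^sub>2 r'. tlift K B B D
        (\<lambda>b\<^sub>3 b\<^sub>4. ?E b\<^sub>1 b\<^sub>2 b\<^sub>3 b\<^sub>4) (comult B r')) (comult B r)) (comult B b)"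
      by (intro tlift_cong refl comult_swap12_tlift) simp_all
    also have "\<dots> = tlift K B B D (\<lambda>b\<^sub>1 b\<^sub>2. tlift K B B D (\<lambda>b\<^sub>1 b\<^sub>1'. tlift K B B D
        (\<lambda>b\<^sub>2 b\<^sub>2'. ?E b\<^sub>1 b\<^sub>1' b\<^sub>2 b\<^sub>2') (comult B b\<^sub>2)) (comult B b\<^sub>1)) (comult B b)"
      by simp
    also have "\<dots> = tlift K B B D (\<lambda>b\<^sub>1 b\<^sub>2. G (\<sigma> b\<^sub>1) (\<sigma> b\<^sub>2)) (comult B b)"
    proof (rule tlift_cong[OF refl])
      fix x y assume [simp]: "x \<in> carrier B" "y \<in> carrier B"
      have "G (\<sigma> x) (\<sigma> y) = tlift K B B D (\<lambda>x\<^sub>1 x\<^sub>2. G (p (s (g x\<^sub>1)) x\<^sub>2) (\<sigma> y)) (comult B x)"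
        by (rule push) simp_all
      also have "\<dots> = tlift K B B D (\<lambda>x\<^sub>1 x\<^sub>2. tlift K B B D (\<lambda>y\<^sub>1 y\<^sub>2. ?E x\<^sub>1 x\<^sub>2 y\<^sub>1 y\<^sub>2) (comult B y)) (comult B x)"
        by (intro tlift_cong refl push) simp_all
      finally show "tlift K B B D (\<lambda>x\<^sub>1 x\<^sub>2. tlift K B B D (\<lambda>y\<^sub>1 y\<^sub>2. ?E x\<^sub>1 x\<^sub>2 y\<^sub>1 y\<^sub>2) (comult B y)) (comult B x) = G (\<sigma> x) (\<sigma> y)"
        by simp
    qed
    finally show ?thesis .
  qed
  show "coalgebra_hom K B R.R \<sigma>"
  proof (rule coalgebra_homI; (unfold sub_hopf_rules sub_hopf_sel)?)
    show "coalgebra K R.R" using R.hopf_R by simp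
    show "linear_map K B R.V \<sigma>"
      using \<sigma>_lin[OF linear_map_id(1)] by (auto simp: linear_map_def)
    fix b assume b [simp]: "b \<in> carrier B"
    have "comult R.R (\<sigma> b) = tlift K H H R.VV (\<lambda>x y. pure_tensor K R.V R.V (\<pi> x) (\<pi> y)) (comult H (\<sigma> b))"
      by (subst R.comult_sub) (simp_all only: R.\<Delta>_def \<sigma>_PB b)
    also have "\<dots> = tlift K T T R.VV (\<lambda>x y. pure_tensor K R.V R.V (\<pi> x) (\<pi> y)) (\<Delta> (\<sigma> b))"
      by simp
    also have "\<dots> = tlift K B B R.VV (\<lambda>x y. pure_tensor K R.V R.V (\<pi> (\<sigma> x)) (\<pi> (\<sigma> y))) (comult B b)"
    proof (rule key)
      have "bilinear_map K H H R.VV (\<lambda>x y. pure_tensor K R.V R.V (\<pi> x) (\<pi> y))"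
        using R.linear_retract[OF linear_map_id(1)] R.retract_closed by simp
      then show "bilinear_map K T T R.VV (\<lambda>x y. pure_tensor K R.V R.V (\<pi> x) (\<pi> y))"
        unfolding tensor_hopf_rules .
    qed simp_all
    also have "\<dots> = tlift K B B R.VV (\<lambda>x y. pure_tensor K R.V R.V (\<sigma> x) (\<sigma> y)) (comult B b)"
      by (rule tlift_cong) (simp_all add: R.retract)
    finally show "comult R.R (\<sigma> b) = tlift K B B R.VV (\<lambda>x y. pure_tensor K R.V R.V (\<sigma> x) (\<sigma> y)) (comult B b)" .
    show "counit H (\<sigma> b) = counit B b"
      using counit_left_tlift[of K B "ground_module K" b "counit B"]
      by (simp add: push[of "ground_module K" "tlift K A B (ground_module K) (\<lambda>a b. counit A a \<otimes>\<^bsub>K\<^esub> counit B b)"])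
  qed simp
  show "pullback_snd K A B (\<sigma> b) = b" if [simp]: "b \<in> carrier B" for b
    by (simp add: q_eq push[OF q_linear])
qed

end

lemma cleft_pullback:
  fixes A :: "('k, 'a) hopf" and B :: "('k, 'b) hopf" and C :: "('k, 'c) hopf"
  assumes cleft: "cleft_extension K A C f" and hom: "hopf_coc_hom K B C g"
  shows "cleft_extension K (pullback K A B C f g) B (pullback_snd K A B)"
proof -
  interpret pullback_pair K A B C f g
    using cleft hom by (simp add: pullback_pair_def cleft_extension_def)
  obtain s where "coalgebra_hom K C A s" "\<forall>c\<in>carrier C. f (s c) = c"
    using cleft by (auto simp: cleft_extension_def)
  then obtain \<sigma> where \<sigma>: "coalgebra_hom K B R.R \<sigma>" "\<And>b. b \<in> carrier B \<Longrightarrow> pullback_snd K A B (\<sigma> b) = b"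
    using pullback_snd_section by blast
  have "b \<in> pullback_snd K A B ` carrier R.R" if "b \<in> carrier B" for b
    using \<sigma> that by (metis coalgebra_hom_def imageI linear_mapD(1))
  moreover have "pullback_snd K A B x \<in> carrier B" if "x \<in> carrier R.R" for x
    using q_hom that by (auto simp: hopf_coc_hom_def coalgebra_hom_def linear_map_def)
  ultimately show ?thesis
    using q_hom \<sigma> by (auto simp: cleft_extension_def pullback_eq)
qed

section \<open>Composition and cancellation of cleft extensions\<close>

lemma coalgebra_hom_comp:
  assumes f: "coalgebra_hom K A B f" and g: "coalgebra_hom K B C g"
    and [simp]: "coalgebra K A" "coalgebra K B" "coalgebra K C"
  shows "coalgebra_hom K A C (g \<circ> f)"
proof -
  note [simp] = coalgebra_hom_rules[OF f] coalgebra_hom_rules[OF g]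
  have "comult C (g (f x)) = tlift K A A (tensor_module K C C) (\<lambda>a b. pure_tensor K C C (g (f a)) (g (f b))) (comult A x)"
    if x [simp]: "x \<in> carrier A" for x
  proof -
    \<comment> \<open>The rules for coalgebra maps rewrite a comultiplication only under a lift, so
      a trivial lift is inserted and protected from being simplified away.\<close>
    have "comult C (g (f x)) = tlift K C C (tensor_module K C C) (pure_tensor K C C) (comult C (g (f x)))"
      by (subst tlift_pure_id) simp_all
    also have "\<dots> = tlift K A A (tensor_module K C C) (\<lambda>a b. pure_tensor K C C (g (f a)) (g (f b))) (comult A x)"
      by (simp del: tlift_pure_id)
    finally show ?thesis .
  qed
  moreover have "linear_map K A C (g \<circ> f)"
    using f g linear_map_comp[of K B C g A f] unfolding coalgebra_hom_def comp_def by blast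
  ultimately show ?thesis
    by (intro coalgebra_homI) simp_all
qed

lemma hopf_coc_hom_coalgebra:
  assumes "hopf_coc_hom K A B f"
  shows "coalgebra K A" "coalgebra K B" "coalgebra_hom K A B f"
  using assms by (simp_all add: hopf_coc_hom_def)

lemma hopf_coc_hom_comp:
  assumes "hopf_coc_hom K A B f" "hopf_coc_hom K B C g"
  shows "hopf_coc_hom K A C (g \<circ> f)"
proof -
  have "coalgebra_hom K A C (g \<circ> f)"
    using hopf_coc_hom_coalgebra[OF assms(1)] hopf_coc_hom_coalgebra[OF assms(2)]
    by (intro coalgebra_hom_comp)
  moreover have "g \<circ> f \<in> ring_hom A C"
    using assms ring_hom_trans by (auto simp: hopf_coc_hom_def)
  ultimately show ?thesis
    using assms by (simp add: hopf_coc_hom_def)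
qed

lemma coalgebra_hom_closed: "\<lbrakk>coalgebra_hom K A B f; x \<in> carrier A\<rbrakk> \<Longrightarrow> f x \<in> carrier B"
  by (auto simp: coalgebra_hom_def linear_map_def)

text \<open>A right inverse forces surjectivity, so only the coalgebra section has to be
  supplied.\<close>

lemma cleft_extensionI:
  assumes p: "hopf_coc_hom K M N p" and s: "coalgebra_hom K N M s" "\<And>y. y \<in> carrier N \<Longrightarrow> p (s y) = y"
  shows "cleft_extension K M N p"
proof -
  have "p ` carrier M = carrier N"
    using coalgebra_hom_closed[OF hopf_coc_hom_coalgebra(3)[OF p]] coalgebra_hom_closed[OF s(1)] s(2)
    by (metis (no_types, lifting) image_eqI image_subsetI subsetI subset_antisym)
  then show ?thesis
    using assms by (auto simp: cleft_extension_def)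
qed

text \<open>The inverse isomorphism is a coalgebra section.\<close>

lemma cleft_iso:
  assumes "hopf_coc_iso K A B f"
  shows "cleft_extension K A B f"
  using assms unfolding hopf_coc_iso_def
  by (auto intro!: cleft_extensionI dest: hopf_coc_hom_coalgebra(3))

text \<open>Sections compose in the opposite order.\<close>

lemma cleft_comp:
  assumes "cleft_extension K A B f" "cleft_extension K B C g"
  shows "cleft_extension K A C (g \<circ> f)"
proof -
  obtain s t where st: "coalgebra_hom K B A s" "\<forall>y\<in>carrier B. f (s y) = y"
      "coalgebra_hom K C B t" "\<forall>y\<in>carrier C. g (t y) = y"
    and fg: "hopf_coc_hom K A B f" "hopf_coc_hom K B C g"
    using assms by (auto simp: cleft_extension_def)
  show ?thesis
  proof (rule cleft_extensionI)
    show "hopf_coc_hom K A C (g \<circ> f)"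
      using fg by (rule hopf_coc_hom_comp)
    show "coalgebra_hom K C A (s \<circ> t)"
      using st hopf_coc_hom_coalgebra[OF fg(1)] hopf_coc_hom_coalgebra[OF fg(2)]
      by (intro coalgebra_hom_comp)
    show "(g \<circ> f) ((s \<circ> t) y) = y" if "y \<in> carrier C" for y
      using that st coalgebra_hom_closed[OF st(3)] by simp
  qed
qed

text \<open>If \<open>s\<close> is a section of the composite, then \<open>f \<circ> s\<close> is
  one of \<open>g\<close>.\<close>

lemma cleft_cancel:
  assumes fg: "hopf_coc_hom K A B f" "hopf_coc_hom K B C g" and gf: "cleft_extension K A C (g \<circ> f)"
  shows "cleft_extension K B C g"
proof -
  obtain s where s: "coalgebra_hom K C A s" "\<forall>y\<in>carrier C. g (f (s y)) = y"
    using gf by (auto simp: cleft_extension_def)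
  show ?thesis
  proof (rule cleft_extensionI[OF fg(2)])
    show "coalgebra_hom K C B (f \<circ> s)"
      using s hopf_coc_hom_coalgebra[OF fg(1)] hopf_coc_hom_coalgebra[OF fg(2)]
      by (intro coalgebra_hom_comp)
  qed (use s in simp)
qed

theorem lemma3p7:
  fixes K :: "'k ring"
  assumes "field K"
  shows
    "(\<forall>(A :: ('k, 'a) hopf) (B :: ('k, 'b) hopf) f.
        hopf_coc_iso K A B f \<longrightarrow> cleft_extension K A B f) \<and>
     (\<forall>(A :: ('k, 'a) hopf) (B :: ('k, 'b) hopf) (C :: ('k, 'c) hopf) f g.
        cleft_extension K A C f \<and> hopf_coc_hom K B C g \<longrightarrow>
        cleft_extension K (pullback K A B C f g) B (pullback_snd K A B)) \<and>
     (\<forall>(A :: ('k, 'a) hopf) (B :: ('k, 'b) hopf) (C :: ('k, 'c) hopf) f g.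
        cleft_extension K A B f \<and> cleft_extension K B C g \<longrightarrow> cleft_extension K A C (g \<circ> f)) \<and>
     (\<forall>(A :: ('k, 'a) hopf) (B :: ('k, 'b) hopf) (C :: ('k, 'c) hopf) f g.
        hopf_coc_hom K A B f \<and> hopf_coc_hom K B C g \<and> cleft_extension K A C (g \<circ> f) \<longrightarrow>
        cleft_extension K B C g)"
  by (auto intro: cleft_iso cleft_pullback cleft_comp cleft_cancel)

end
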